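(* Let $\mathfrak g=\mathfrak g_0\ltimes\mathfrak s$ be the Levi decomposition of a Lie algebra $\mathfrak g$ over $\mathbb K$ ($\mathfrak g_0$ semisimple, $\mathfrak s$ the solvable radical) and let $\operatorname{Der}(\mathfrak g)_0=\{D\in\operatorname{Der}(\mathfrak g): D(\mathfrak g_0)\subseteq\mathfrak g_0\}$. If $(\pi,V)\in\Gamma_\circ^p(\mathfrak g)$, then the action $\psi$ of $\operatorname{Der}(\mathfrak g)_0$ on $\Lambda\mathfrak g^*\otimes V$ given, for $D\in\operatorname{Der}(\mathfrak g)_0$, $f\in\Lambda\mathfrak g^*$ and $v\in V$, by $$\psi(D)(f\otimes v)=-\overline D^{\,t}(f)\otimes v+f\otimes\pi(X_D)(v)$$ induces an action of $\operatorname{Der}(\mathfrak g)_0$ on $H^p(\mathfrak g,V)$ for all $p$. In particular $\psi$ defines an action of $\operatorname{Der}(\mathfrak g)_0$ on $TH^p(\mathfrak g)$ for all $p$.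
   Context: $\mathbb K$ is an algebraically closed field of characteristic $0$; all Lie algebras and modules are finite dimensional over $\mathbb K$. "Action" means Lie algebra action. $\Gamma_\circ^p(\mathfrak g)$ is the (finite) set of equivalence classes of irreducible finite dimensional representations $(\pi,V)$ of $\mathfrak g$ with $H^p(\mathfrak g,V)\neq0$. The total cohomology is $TH^p(\mathfrak g)=\bigoplus_{(\pi,V)\in\Gamma_\circ^p(\mathfrak g)}H^p(\mathfrak g,V)$. $H^*(\mathfrak g,V)$ is the cohomology of the Chevalley-Eilenberg complex $\Lambda\mathfrak g^*\otimes V$. For $D\in\operatorname{Der}(\mathfrak g)_0$, $X_D$ denotes the unique element of $\mathfrak g_0$ with $D|_{\mathfrak g_0}=\operatorname{ad}_{\mathfrak g_0}(X_D)$; $\overline D$ is the canonical extension of $D$ (as a derivation) to the exterior algebra $\Lambda\mathfrak g$, and $\overline D^{\,t}$ is its transpose on $\Lambda\mathfrak g^*$. *)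

theory Defs
  imports
    "HOL-Computational_Algebra.Polynomial"
    "HOL-Library.Function_Algebras"
    "HOL-Library.Set_Algebras"
begin

(* Conventions. A Lie algebra g is a whole type 'g with scalar multiplication sg and bracket br;
   its subalgebras and ideals are sets. A module is a set V in an ambient vector space ('v, sv), so
   that modules of different dimensions live in one type. Functions are added pointwise
   (Function_Algebras), and sets, in particular cosets, elementwise (Set_Algebras). *)

section \<open>Lie algebras and Levi decompositions\<close>

definition finite_dim :: "('k::field \<Rightarrow> 'v::ab_group_add \<Rightarrow> 'v) \<Rightarrow> 'v set \<Rightarrow> bool" where
  "finite_dim sv V \<longleftrightarrow> (\<exists>B. finite B \<and> module.span sv B = V)"

definition fscale :: "('k \<Rightarrow> 'v \<Rightarrow> 'v) \<Rightarrow> 'k \<Rightarrow> ('i \<Rightarrow> 'v) \<Rightarrow> ('i \<Rightarrow> 'v)" where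
  "fscale sv c f = (\<lambda>i. sv c (f i))"

locale lie_algebra = vector_space sg
  for sg :: "'k::field \<Rightarrow> 'g::ab_group_add \<Rightarrow> 'g" +
  fixes br :: "'g \<Rightarrow> 'g \<Rightarrow> 'g"
  assumes br_add_left: "br (x + y) z = br x z + br y z"
    and br_add_right: "br x (y + z) = br x y + br x z"
    and br_scale_left: "br (sg c x) y = sg c (br x y)"
    and br_scale_right: "br x (sg c y) = sg c (br x y)"
    and br_self: "br x x = 0"
    and jacobi: "br x (br y z) + br y (br z x) + br z (br x y) = 0"

definition lie_subalgebra ::
    "('k::field \<Rightarrow> 'g::ab_group_add \<Rightarrow> 'g) \<Rightarrow> ('g \<Rightarrow> 'g \<Rightarrow> 'g) \<Rightarrow> 'g set \<Rightarrow> bool" where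
  "lie_subalgebra sg br S \<longleftrightarrow> module.subspace sg S \<and> (\<forall>x\<in>S. \<forall>y\<in>S. br x y \<in> S)"

definition lie_ideal ::
    "('k::field \<Rightarrow> 'g::ab_group_add \<Rightarrow> 'g) \<Rightarrow> ('g \<Rightarrow> 'g \<Rightarrow> 'g) \<Rightarrow> 'g set \<Rightarrow> 'g set \<Rightarrow> bool" where
  "lie_ideal sg br I S \<longleftrightarrow> module.subspace sg I \<and> I \<subseteq> S \<and> (\<forall>x\<in>S. \<forall>y\<in>I. br x y \<in> I)"

definition derived_algebra ::
    "('k::field \<Rightarrow> 'g::ab_group_add \<Rightarrow> 'g) \<Rightarrow> ('g \<Rightarrow> 'g \<Rightarrow> 'g) \<Rightarrow> 'g set \<Rightarrow> 'g set" where
  "derived_algebra sg br S = module.span sg {br x y |x y. x \<in> S \<and> y \<in> S}"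

definition lie_solvable ::
    "('k::field \<Rightarrow> 'g::ab_group_add \<Rightarrow> 'g) \<Rightarrow> ('g \<Rightarrow> 'g \<Rightarrow> 'g) \<Rightarrow> 'g set \<Rightarrow> bool" where
  "lie_solvable sg br S \<longleftrightarrow> (\<exists>n. (derived_algebra sg br ^^ n) S = {0})"

definition lie_semisimple ::
    "('k::field \<Rightarrow> 'g::ab_group_add \<Rightarrow> 'g) \<Rightarrow> ('g \<Rightarrow> 'g \<Rightarrow> 'g) \<Rightarrow> 'g set \<Rightarrow> bool" where
  "lie_semisimple sg br S \<longleftrightarrow> lie_subalgebra sg br S \<and>
     (\<forall>I. lie_ideal sg br I S \<and> lie_solvable sg br I \<longrightarrow> I = {0})"

definition solvable_radical ::
    "('k::field \<Rightarrow> 'g::ab_group_add \<Rightarrow> 'g) \<Rightarrow> ('g \<Rightarrow> 'g \<Rightarrow> 'g) \<Rightarrow> 'g set \<Rightarrow> bool" where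
  "solvable_radical sg br S \<longleftrightarrow> lie_ideal sg br S UNIV \<and> lie_solvable sg br S \<and>
     (\<forall>I. lie_ideal sg br I UNIV \<and> lie_solvable sg br I \<longrightarrow> I \<subseteq> S)"

definition levi_decomposition ::
    "('k::field \<Rightarrow> 'g::ab_group_add \<Rightarrow> 'g) \<Rightarrow> ('g \<Rightarrow> 'g \<Rightarrow> 'g) \<Rightarrow> 'g set \<Rightarrow> 'g set \<Rightarrow> bool" where
  "levi_decomposition sg br g0 s \<longleftrightarrow>
     lie_semisimple sg br g0 \<and> solvable_radical sg br s \<and> g0 \<inter> s = {0} \<and> g0 + s = UNIV"

section \<open>Actions and modules\<close>

(* rho is an action of the Lie algebra (L, sL, brL) by linear maps on (W, +, sW). The last line is
   the commutator identity, rearranged because W may consist of cosets, where the type-wide minus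
   is not the one of the quotient. *)
definition lie_action ::
    "('k \<Rightarrow> 'l \<Rightarrow> 'l) \<Rightarrow> ('l::plus \<Rightarrow> 'l \<Rightarrow> 'l) \<Rightarrow> 'l set \<Rightarrow>
     ('k \<Rightarrow> 'w \<Rightarrow> 'w) \<Rightarrow> 'w::plus set \<Rightarrow> ('l \<Rightarrow> 'w \<Rightarrow> 'w) \<Rightarrow> bool" where
  "lie_action sL brL L sW W \<rho> \<longleftrightarrow>
     (\<forall>x\<in>L. \<forall>w\<in>W. \<rho> x w \<in> W) \<and>
     (\<forall>x\<in>L. \<forall>v\<in>W. \<forall>w\<in>W. \<rho> x (v + w) = \<rho> x v + \<rho> x w) \<and>
     (\<forall>x\<in>L. \<forall>c. \<forall>w\<in>W. \<rho> x (sW c w) = sW c (\<rho> x w)) \<and>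
     (\<forall>x\<in>L. \<forall>y\<in>L. \<forall>w\<in>W. \<rho> (x + y) w = \<rho> x w + \<rho> y w) \<and>
     (\<forall>x\<in>L. \<forall>c. \<forall>w\<in>W. \<rho> (sL c x) w = sW c (\<rho> x w)) \<and>
     (\<forall>x\<in>L. \<forall>y\<in>L. \<forall>w\<in>W. \<rho> (brL x y) w + \<rho> y (\<rho> x w) = \<rho> x (\<rho> y w))"

definition irreducible_rep ::
    "('k::field \<Rightarrow> 'g::ab_group_add \<Rightarrow> 'g) \<Rightarrow> ('g \<Rightarrow> 'g \<Rightarrow> 'g) \<Rightarrow>
     ('k \<Rightarrow> 'v::ab_group_add \<Rightarrow> 'v) \<Rightarrow> 'v set \<Rightarrow> ('g \<Rightarrow> 'v \<Rightarrow> 'v) \<Rightarrow> bool" where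
  "irreducible_rep sg br sv V \<pi> \<longleftrightarrow>
     module.subspace sv V \<and> finite_dim sv V \<and> lie_action sg br UNIV sv V \<pi> \<and> V \<noteq> {0} \<and>
     (\<forall>U. module.subspace sv U \<and> U \<subseteq> V \<and> (\<forall>x. \<forall>u\<in>U. \<pi> x u \<in> U) \<longrightarrow> U = {0} \<or> U = V)"

definition equivalent_reps ::
    "('k \<Rightarrow> 'v::plus \<Rightarrow> 'v) \<Rightarrow> 'v set \<Rightarrow> ('g \<Rightarrow> 'v \<Rightarrow> 'v) \<Rightarrow>
     'v set \<Rightarrow> ('g \<Rightarrow> 'v \<Rightarrow> 'v) \<Rightarrow> bool" where
  "equivalent_reps sv V \<pi> V' \<pi>' \<longleftrightarrow>
     (\<exists>T. bij_betw T V V' \<and> (\<forall>v\<in>V. \<forall>w\<in>V. T (v + w) = T v + T w) \<and>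
          (\<forall>c. \<forall>v\<in>V. T (sv c v) = sv c (T v)) \<and> (\<forall>x. \<forall>v\<in>V. T (\<pi> x v) = \<pi>' x (T v)))"

section \<open>The Chevalley-Eilenberg complex\<close>

(* The dual of the exterior algebra of g: the list [x1, ..., xp] stands for x1 /\ ... /\ xp, and a
   functional on the exterior algebra is given by its values on these elements, of all degrees p.
   As g is finite dimensional, such a function vanishes on the lists longer than dim g. *)
definition exterior_dual ::
    "('k::field \<Rightarrow> 'g::ab_group_add \<Rightarrow> 'g) \<Rightarrow> ('g list \<Rightarrow> 'k) set" where
  "exterior_dual sg = {f.
     (\<forall>us x y ws. f (us @ (x + y) # ws) = f (us @ x # ws) + f (us @ y # ws)) \<and>
     (\<forall>us c x ws. f (us @ sg c x # ws) = c * f (us @ x # ws)) \<and>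
     (\<forall>xs. \<not> distinct xs \<longrightarrow> f xs = 0)}"

(* f (x) v, as a V-valued function on the exterior algebra. *)
definition tensor :: "('k \<Rightarrow> 'v \<Rightarrow> 'v) \<Rightarrow> ('g list \<Rightarrow> 'k) \<Rightarrow> 'v \<Rightarrow> ('g list \<Rightarrow> 'v)" where
  "tensor sv f v = (\<lambda>xs. sv (f xs) v)"

definition exterior_tensor ::
    "('k::field \<Rightarrow> 'g::ab_group_add \<Rightarrow> 'g) \<Rightarrow> ('k \<Rightarrow> 'v::ab_group_add \<Rightarrow> 'v) \<Rightarrow>
     'v set \<Rightarrow> ('g list \<Rightarrow> 'v) set" where
  "exterior_tensor sg sv V =
     module.span (fscale sv) {tensor sv f v |f v. f \<in> exterior_dual sg \<and> v \<in> V}"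

definition cochains ::
    "('k::field \<Rightarrow> 'g::ab_group_add \<Rightarrow> 'g) \<Rightarrow> ('k \<Rightarrow> 'v::ab_group_add \<Rightarrow> 'v) \<Rightarrow>
     nat \<Rightarrow> 'v set \<Rightarrow> ('g list \<Rightarrow> 'v) set" where
  "cochains sg sv p V =
     {\<omega> \<in> exterior_tensor sg sv V. \<forall>xs. length xs \<noteq> p \<longrightarrow> \<omega> xs = 0}"

definition delete_nth :: "nat \<Rightarrow> 'a list \<Rightarrow> 'a list" where
  "delete_nth i xs = take i xs @ drop (Suc i) xs"

(* With indices starting at 0:
   (d w)(x0, ..., xp) = sum_i (-1)^i x_i . w(..., omit x_i, ...)
                        + sum_(i<j) (-1)^(i+j) w([x_i, x_j], ..., omit x_i, ..., omit x_j, ...). *)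
definition ce_differential ::
    "('g \<Rightarrow> 'g \<Rightarrow> 'g) \<Rightarrow> ('k::field \<Rightarrow> 'v::ab_group_add \<Rightarrow> 'v) \<Rightarrow> ('g \<Rightarrow> 'v \<Rightarrow> 'v) \<Rightarrow>
     ('g list \<Rightarrow> 'v) \<Rightarrow> ('g list \<Rightarrow> 'v)" where
  "ce_differential br sv \<pi> \<omega> = (\<lambda>xs.
     (\<Sum>i<length xs. sv ((-1) ^ i) (\<pi> (xs ! i) (\<omega> (delete_nth i xs)))) +
     (\<Sum>j<length xs. \<Sum>i<j. sv ((-1) ^ (i + j))
        (\<omega> (br (xs ! i) (xs ! j) # delete_nth i (delete_nth j xs)))))"

definition cocycles ::
    "('k::field \<Rightarrow> 'g::ab_group_add \<Rightarrow> 'g) \<Rightarrow> ('g \<Rightarrow> 'g \<Rightarrow> 'g) \<Rightarrow>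
     ('k \<Rightarrow> 'v::ab_group_add \<Rightarrow> 'v) \<Rightarrow> nat \<Rightarrow> 'v set \<Rightarrow> ('g \<Rightarrow> 'v \<Rightarrow> 'v) \<Rightarrow> ('g list \<Rightarrow> 'v) set" where
  "cocycles sg br sv p V \<pi> = {\<omega> \<in> cochains sg sv p V. ce_differential br sv \<pi> \<omega> = 0}"

definition coboundaries ::
    "('k::field \<Rightarrow> 'g::ab_group_add \<Rightarrow> 'g) \<Rightarrow> ('g \<Rightarrow> 'g \<Rightarrow> 'g) \<Rightarrow>
     ('k \<Rightarrow> 'v::ab_group_add \<Rightarrow> 'v) \<Rightarrow> nat \<Rightarrow> 'v set \<Rightarrow> ('g \<Rightarrow> 'v \<Rightarrow> 'v) \<Rightarrow> ('g list \<Rightarrow> 'v) set" where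
  "coboundaries sg br sv p V \<pi> =
     (case p of 0 \<Rightarrow> {0} | Suc q \<Rightarrow> ce_differential br sv \<pi> ` cochains sg sv q V)"

definition cohomology ::
    "('k::field \<Rightarrow> 'g::ab_group_add \<Rightarrow> 'g) \<Rightarrow> ('g \<Rightarrow> 'g \<Rightarrow> 'g) \<Rightarrow>
     ('k \<Rightarrow> 'v::ab_group_add \<Rightarrow> 'v) \<Rightarrow> nat \<Rightarrow> 'v set \<Rightarrow> ('g \<Rightarrow> 'v \<Rightarrow> 'v) \<Rightarrow>
     ('g list \<Rightarrow> 'v) set set" where
  "cohomology sg br sv p V \<pi> =
     {z +o coboundaries sg br sv p V \<pi> |z. z \<in> cocycles sg br sv p V \<pi>}"

(* The map on cosets of B induced by an additive map phi with phi(B) contained in B: it sends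
   z + B to phi(z) + B. The summand B matters, phi(B) may be smaller (e.g. phi = 0). *)
definition quotient_map :: "'a::plus set \<Rightarrow> ('a \<Rightarrow> 'a) \<Rightarrow> 'a set \<Rightarrow> 'a set" where
  "quotient_map B \<phi> A = \<phi> ` A + B"

definition cohomology_scale ::
    "('k::field \<Rightarrow> 'g::ab_group_add \<Rightarrow> 'g) \<Rightarrow> ('g \<Rightarrow> 'g \<Rightarrow> 'g) \<Rightarrow>
     ('k \<Rightarrow> 'v::ab_group_add \<Rightarrow> 'v) \<Rightarrow> nat \<Rightarrow> 'v set \<Rightarrow> ('g \<Rightarrow> 'v \<Rightarrow> 'v) \<Rightarrow>
     'k \<Rightarrow> ('g list \<Rightarrow> 'v) set \<Rightarrow> ('g list \<Rightarrow> 'v) set" where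
  "cohomology_scale sg br sv p V \<pi> c = quotient_map (coboundaries sg br sv p V \<pi>) (fscale sv c)"

section \<open>The irreducible modules with nonzero cohomology\<close>

definition cohomological_irreps ::
    "('k::field \<Rightarrow> 'g::ab_group_add \<Rightarrow> 'g) \<Rightarrow> ('g \<Rightarrow> 'g \<Rightarrow> 'g) \<Rightarrow>
     ('k \<Rightarrow> 'v::ab_group_add \<Rightarrow> 'v) \<Rightarrow> nat \<Rightarrow> ('v set \<times> ('g \<Rightarrow> 'v \<Rightarrow> 'v)) set" where
  "cohomological_irreps sg br sv p =
     {(V, \<pi>). irreducible_rep sg br sv V \<pi> \<and>
               cohomology sg br sv p V \<pi> \<noteq> {coboundaries sg br sv p V \<pi>}}"

definition Gamma ::
    "('k::field \<Rightarrow> 'g::ab_group_add \<Rightarrow> 'g) \<Rightarrow> ('g \<Rightarrow> 'g \<Rightarrow> 'g) \<Rightarrow>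
     ('k \<Rightarrow> 'v::ab_group_add \<Rightarrow> 'v) \<Rightarrow> nat \<Rightarrow> ('v set \<times> ('g \<Rightarrow> 'v \<Rightarrow> 'v)) set set" where
  "Gamma sg br sv p = cohomological_irreps sg br sv p //
     {(R, R'). R \<in> cohomological_irreps sg br sv p \<and> R' \<in> cohomological_irreps sg br sv p \<and>
               equivalent_reps sv (fst R) (snd R) (fst R') (snd R')}"

section \<open>The action of the derivations\<close>

definition Der ::
    "('k::field \<Rightarrow> 'g::ab_group_add \<Rightarrow> 'g) \<Rightarrow> ('g \<Rightarrow> 'g \<Rightarrow> 'g) \<Rightarrow> ('g \<Rightarrow> 'g) set" where
  "Der sg br =
     {D. Vector_Spaces.linear sg sg D \<and> (\<forall>x y. D (br x y) = br (D x) y + br x (D y))}"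

definition Der0 ::
    "('k::field \<Rightarrow> 'g::ab_group_add \<Rightarrow> 'g) \<Rightarrow> ('g \<Rightarrow> 'g \<Rightarrow> 'g) \<Rightarrow> 'g set \<Rightarrow> ('g \<Rightarrow> 'g) set" where
  "Der0 sg br g0 = {D \<in> Der sg br. D ` g0 \<subseteq> g0}"

definition commutator :: "('a::minus \<Rightarrow> 'a) \<Rightarrow> ('a \<Rightarrow> 'a) \<Rightarrow> ('a \<Rightarrow> 'a)" where
  "commutator D E = (\<lambda>x. D (E x) - E (D x))"

definition inner_elem :: "('g \<Rightarrow> 'g \<Rightarrow> 'g) \<Rightarrow> 'g set \<Rightarrow> ('g \<Rightarrow> 'g) \<Rightarrow> 'g" where
  "inner_elem br g0 D = (THE X. X \<in> g0 \<and> (\<forall>y\<in>g0. D y = br X y))"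

(* The derivation of the exterior algebra extending D maps x1 /\ ... /\ xp to the sum over i of
   x1 /\ ... /\ D(xi) /\ ... /\ xp; this is composition of w with it. *)
definition derivation_transpose ::
    "('g \<Rightarrow> 'g) \<Rightarrow> ('g list \<Rightarrow> 'w::ab_group_add) \<Rightarrow> ('g list \<Rightarrow> 'w)" where
  "derivation_transpose D \<omega> = (\<lambda>xs. \<Sum>i<length xs. \<omega> (xs[i := D (xs ! i)]))"

(* The linear extension of
   f (x) v  |->  - (transpose of D)(f) (x) v + f (x) pi(X_D)(v). *)
definition psi ::
    "('g \<Rightarrow> 'g \<Rightarrow> 'g) \<Rightarrow> 'g set \<Rightarrow> ('g \<Rightarrow> 'v \<Rightarrow> 'v) \<Rightarrow>
     ('g \<Rightarrow> 'g) \<Rightarrow> ('g list \<Rightarrow> 'v::ab_group_add) \<Rightarrow> ('g list \<Rightarrow> 'v)" where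
  "psi br g0 \<pi> D \<omega> = - derivation_transpose D \<omega> + (\<lambda>xs. \<pi> (inner_elem br g0 D) (\<omega> xs))"

definition psi_cohomology ::
    "('k::field \<Rightarrow> 'g::ab_group_add \<Rightarrow> 'g) \<Rightarrow> ('g \<Rightarrow> 'g \<Rightarrow> 'g) \<Rightarrow> 'g set \<Rightarrow>
     ('k \<Rightarrow> 'v::ab_group_add \<Rightarrow> 'v) \<Rightarrow> nat \<Rightarrow> 'v set \<Rightarrow> ('g \<Rightarrow> 'v \<Rightarrow> 'v) \<Rightarrow>
     ('g \<Rightarrow> 'g) \<Rightarrow> ('g list \<Rightarrow> 'v) set \<Rightarrow> ('g list \<Rightarrow> 'v) set" where
  "psi_cohomology sg br g0 sv p V \<pi> D =
     quotient_map (coboundaries sg br sv p V \<pi>) (psi br g0 \<pi> D)"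

section \<open>Total cohomology\<close>

(* Every finite dimensional module is isomorphic to one in the space of sequences in K, so the
   classes of modules in this space are all the equivalence classes. The parameter r chooses a
   representative of each class; the elements of the direct sum are families indexed by the
   classes, with finite support, and with the dummy value {0} off Gamma. *)
abbreviation seq_scale :: "'k::field \<Rightarrow> (nat \<Rightarrow> 'k) \<Rightarrow> (nat \<Rightarrow> 'k)" where
  "seq_scale \<equiv> fscale (*)"

type_synonym ('k, 'g) seq_rep = "(nat \<Rightarrow> 'k) set \<times> ('g \<Rightarrow> (nat \<Rightarrow> 'k) \<Rightarrow> (nat \<Rightarrow> 'k))"

type_synonym ('k, 'g) coh_family = "('k, 'g) seq_rep set \<Rightarrow> ('g list \<Rightarrow> nat \<Rightarrow> 'k) set"

definition total_cohomology ::
    "('k::field \<Rightarrow> 'g::ab_group_add \<Rightarrow> 'g) \<Rightarrow> ('g \<Rightarrow> 'g \<Rightarrow> 'g) \<Rightarrow> nat \<Rightarrow>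
     (('k, 'g) seq_rep set \<Rightarrow> ('k, 'g) seq_rep) \<Rightarrow> ('k, 'g) coh_family set" where
  "total_cohomology sg br p r = {\<Phi>.
     (\<forall>C\<in>Gamma sg br seq_scale p. \<Phi> C \<in> cohomology sg br seq_scale p (fst (r C)) (snd (r C))) \<and>
     (\<forall>C. C \<notin> Gamma sg br seq_scale p \<longrightarrow> \<Phi> C = {0}) \<and>
     finite {C \<in> Gamma sg br seq_scale p.
               \<Phi> C \<noteq> coboundaries sg br seq_scale p (fst (r C)) (snd (r C))}}"

definition total_scale ::
    "('k::field \<Rightarrow> 'g::ab_group_add \<Rightarrow> 'g) \<Rightarrow> ('g \<Rightarrow> 'g \<Rightarrow> 'g) \<Rightarrow> nat \<Rightarrow>
     (('k, 'g) seq_rep set \<Rightarrow> ('k, 'g) seq_rep) \<Rightarrow>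
     'k \<Rightarrow> ('k, 'g) coh_family \<Rightarrow> ('k, 'g) coh_family" where
  "total_scale sg br p r c \<Phi> = (\<lambda>C.
     if C \<in> Gamma sg br seq_scale p
     then cohomology_scale sg br seq_scale p (fst (r C)) (snd (r C)) c (\<Phi> C) else {0})"

definition psi_total ::
    "('k::field \<Rightarrow> 'g::ab_group_add \<Rightarrow> 'g) \<Rightarrow> ('g \<Rightarrow> 'g \<Rightarrow> 'g) \<Rightarrow> 'g set \<Rightarrow> nat \<Rightarrow>
     (('k, 'g) seq_rep set \<Rightarrow> ('k, 'g) seq_rep) \<Rightarrow>
     ('g \<Rightarrow> 'g) \<Rightarrow> ('k, 'g) coh_family \<Rightarrow> ('k, 'g) coh_family" where
  "psi_total sg br g0 p r D \<Phi> = (\<lambda>C.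
     if C \<in> Gamma sg br seq_scale p
     then psi_cohomology sg br g0 seq_scale p (fst (r C)) (snd (r C)) D (\<Phi> C) else {0})"

end

theory Submission
  imports Defs
begin

text \<open>For \<open>D \<in> Der(g)\<^sub>0\<close> let \<open>X = X\<^sub>D\<close>, which exists because derivations of semisimple Lie algebras are
  inner. If \<open>\<pi> \<circ> D = [\<pi>(X), \<pi>(\<cdot>)]\<close> on \<open>g\<close>, then \<open>\<psi>(D)\<close> is a Lie derivative and commutes with the
  differential. The derivation \<open>E = D - ad X\<close> vanishes on the Levi factor, and for \<open>u\<close> in the radical
  \<open>E u\<close> is in the radical, acts on \<open>V\<close> by a scalar, and is ad-nilpotent. If this scalar were nonzero,
  then the Lie derivative along \<open>E u\<close>, which is null-homotopic, would be invertible on cochains, so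
  that \<open>H\<^sup>p(g, V) = 0\<close>. Hence \<open>\<pi> \<circ> E = 0\<close>; this is where \<open>H\<^sup>p(g, V) \<noteq> 0\<close> is needed, as for one
  dimensional \<open>g\<close> and \<open>D = id\<close> a nontrivial character of \<open>g\<close> shows.\<close>

section \<open>Operators on finite dimensional subspaces\<close>

text \<open>Semisimple means only that no nonzero solvable ideal exists, and the radical is only the
  largest solvable ideal, so every fact that the overview names has to be derived from these
  definitions. The common engine is the weight argument of Lie's theorem, used twice: on
  \<open>V\<close> it makes the radical act by scalars, and on the subquotients of g it shows that
  \<open>ad (E u) = [E, ad u]\<close> acts as zero on each irreducible one, hence nilpotently on g.
  In the second use the derivation itself has to be one of the operators, next to the
  \<open>ad u\<close>. This is why the argument is set up for a subquotient \<open>W / U\<close> and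
  a mere set \<open>L\<close> of labelled operators, instead of a Lie algebra and its module. That
  derivations preserve the radical rests on the Leibniz rule for even powers of \<open>D\<close>,
  where characteristic 0 makes a middle binomial coefficient invertible.\<close>

locale alg_closed_vector_space = vector_space scale
  for scale :: "'a::{alg_closed_field, field_char_0} \<Rightarrow> 'b::ab_group_add \<Rightarrow> 'b" (infixr "*s" 75)
begin

text \<open>Linearity is demanded on \<open>W\<close> alone, because a representation is constrained
  only on its carrier \<open>V\<close> and may take arbitrary values outside.\<close>

definition endo_on :: "'b set \<Rightarrow> ('b \<Rightarrow> 'b) \<Rightarrow> bool" where
  "endo_on W T \<longleftrightarrow> (\<forall>w\<in>W. T w \<in> W) \<and> (\<forall>v\<in>W. \<forall>w\<in>W. T (v + w) = T v + T w) \<and>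
     (\<forall>c. \<forall>w\<in>W. T (c *s w) = c *s T w)"

lemma endo_on_mem: "endo_on W T \<Longrightarrow> w \<in> W \<Longrightarrow> T w \<in> W"
  by (auto simp: endo_on_def)

lemma endo_on_add: "endo_on W T \<Longrightarrow> v \<in> W \<Longrightarrow> w \<in> W \<Longrightarrow> T (v + w) = T v + T w"
  by (auto simp: endo_on_def)

lemma endo_on_scale: "endo_on W T \<Longrightarrow> w \<in> W \<Longrightarrow> T (c *s w) = c *s T w"
  by (auto simp: endo_on_def)

lemma endo_on_subset:
  "endo_on W T \<Longrightarrow> M \<subseteq> W \<Longrightarrow> (\<And>m. m \<in> M \<Longrightarrow> T m \<in> M) \<Longrightarrow> endo_on M T"
  by (simp add: endo_on_def subset_iff)

lemma endo_on_0: "endo_on W T \<Longrightarrow> subspace W \<Longrightarrow> T 0 = 0"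
  using endo_on_scale[of W T 0 0] subspace_0[of W] by simp

lemma endo_on_uminus: "endo_on W T \<Longrightarrow> w \<in> W \<Longrightarrow> T (- w) = - T w"
  using endo_on_scale[of W T w "-1"] by simp

lemma endo_on_diff:
  assumes "endo_on W T" "subspace W" "v \<in> W" "w \<in> W"
  shows "T (v - w) = T v - T w"
  using endo_on_add[OF assms(1,3), of "- w"] endo_on_uminus[OF assms(1,4)] subspace_neg[OF assms(2,4)]
  by simp

lemma endo_on_sum:
  assumes "endo_on W T" "subspace W" "\<And>i. i \<in> I \<Longrightarrow> f i \<in> W"
  shows "T (sum f I) = (\<Sum>i\<in>I. T (f i))"
  using assms(3)
  by (induction I rule: infinite_finite_induct)
     (simp_all add: endo_on_0[OF assms(1,2)] endo_on_add[OF assms(1)] subspace_sum[OF assms(2)])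

lemma endo_on_funpow: "endo_on W T \<Longrightarrow> w \<in> W \<Longrightarrow> (T ^^ n) w \<in> W"
  by (induction n) (auto simp: endo_on_mem)

lemma linear_imp_endo_on:
  assumes "Vector_Spaces.linear scale scale T" "T ` W \<subseteq> W"
  shows "endo_on W T"
proof -
  interpret Vector_Spaces.linear scale scale T by fact
  show ?thesis using assms(2) by (auto simp: endo_on_def add scale)
qed

section \<open>Subspaces of extremal dimension and linear dependence of orbits\<close>

lemma dim_strict_mono:
  assumes U: "subspace U" and W: "W \<subseteq> span F" "finite F" and UW: "U \<subset> W"
  shows "dim U < dim W"
proof -
  obtain B where B: "B \<subseteq> U" "independent B" "U \<subseteq> span B"
    by (rule maximal_independent_subset)
  obtain C where C: "B \<subseteq> C" "C \<subseteq> W" "independent C" "W \<subseteq> span C"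
    by (rule maximal_independent_subset_extend[of B W]) (use B UW in auto)
  have fC: "finite C"
    using independent_span_bound[OF W(2) C(3)] C(2) W(1) by auto
  have "B \<noteq> C"
    using C(4) UW span_minimal[OF B(1) U] by auto
  then have "card B < card C"
    using C(1) fC by (simp add: psubset_card_mono psubset_eq)
  then show ?thesis
    using basis_card_eq_dim[OF B(1,3,2)] basis_card_eq_dim[OF C(2,4,3)] by simp
qed

lemma ex_minimal_subspace:
  assumes "P W0" and sub: "\<And>W. P W \<Longrightarrow> subspace W \<and> W \<subseteq> span F" and "finite F"
  shows "\<exists>W. P W \<and> (\<forall>W'. P W' \<and> W' \<subseteq> W \<longrightarrow> W' = W)"
proof -
  obtain W where W: "P W" "\<And>W'. P W' \<Longrightarrow> dim W \<le> dim W'"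
    using exists_least_iff[of "\<lambda>n. \<exists>W. P W \<and> dim W = n"] assms(1)
    by (metis linorder_not_less)
  have "W' = W" if "P W'" "W' \<subseteq> W" for W'
  proof (rule ccontr)
    assume "W' \<noteq> W"
    then have "dim W' < dim W"
      using that sub W(1) by (intro dim_strict_mono[OF _ _ \<open>finite F\<close>]) auto
    with W(2)[OF that(1)] show False by simp
  qed
  with W(1) show ?thesis by blast
qed

lemma ex_maximal_subspace:
  assumes "P W0" and sub: "\<And>W. P W \<Longrightarrow> subspace W \<and> W \<subseteq> span F" and "finite F"
  shows "\<exists>W. P W \<and> (\<forall>W'. P W' \<and> W \<subseteq> W' \<longrightarrow> W' = W)"
proof -
  have bound: "\<And>y. \<exists>W. P W \<and> dim W = y \<Longrightarrow> y \<le> card F"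
    using sub dim_le_card[OF _ \<open>finite F\<close>] by blast
  obtain W where W: "P W" "dim W = (GREATEST n. \<exists>W. P W \<and> dim W = n)"
    using GreatestI_ex_nat[of "\<lambda>n. \<exists>W. P W \<and> dim W = n", OF _ bound] assms(1) by blast
  have max: "dim W' \<le> dim W" if "P W'" for W'
    unfolding W(2) by (rule Greatest_le_nat[OF _ bound]) (use that in auto)
  have "W' = W" if "P W'" "W \<subseteq> W'" for W'
  proof (rule ccontr)
    assume "W' \<noteq> W"
    then have "dim W < dim W'"
      using that sub W(1) by (intro dim_strict_mono[OF _ _ \<open>finite F\<close>]) auto
    with max[OF that(1)] show False by simp
  qed
  with W(1) show ?thesis by blast
qed

text \<open>Otherwise each vector would lie outside the span of its predecessors, and
  \<open>Suc (card F)\<close> independent vectors would fit into \<open>span F\<close>. The sets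
  \<open>S n\<close> may exceed these spans, so that the lemma also covers vectors taken modulo a
  subspace.\<close>

lemma krylov_dependent:
  fixes X :: "nat \<Rightarrow> 'b"
  assumes F: "finite F" and X: "\<And>n. X n \<in> span F" and U: "\<And>n. S n \<supseteq> span (X ` {..<n})"
  shows "\<exists>n. X n \<in> S n"
proof (rule ccontr)
  assume "\<nexists>n. X n \<in> S n"
  then have notin: "X n \<notin> span (X ` {..<n})" for n using U by blast
  have "independent (X ` {..<n}) \<and> card (X ` {..<n}) = n" for n
  proof (induction n)
    case (Suc n)
    have "X n \<notin> X ` {..<n}" using notin[of n] span_base[of "X n"] by metis
    moreover have "X ` {..<Suc n} = insert (X n) (X ` {..<n})" by (simp add: lessThan_Suc)
    ultimately show ?case
      using Suc independent_insertI[OF notin[of n]] by simp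
  qed (simp add: independent_empty)
  moreover have "X ` {..<Suc (card F)} \<subseteq> span F" using X by blast
  ultimately show False
    using independent_span_bound[OF F, of "X ` {..<Suc (card F)}"] by (metis Suc_n_not_le_n)
qed

text \<open>The polynomial \<open>p\<close> annihilates \<open>w\<close> modulo \<open>U\<close>.
  Split off a root, \<open>p = (x - a) q\<close>, and put \<open>v = q(T) w\<close>. Then
  \<open>(T - a) v\<close> is in \<open>U\<close>, so \<open>v\<close> is an eigenvector modulo
  \<open>U\<close> unless it lies in \<open>U\<close> itself; in that case \<open>q\<close>
  annihilates \<open>w\<close> and has smaller degree. A constant \<open>p\<close> would force
  \<open>w\<close> into \<open>U\<close>. The bound \<open>n\<close> may be any number above the
  degree.\<close>

lemma eigenvector_of_annihilator:
  assumes T: "endo_on W T" and W: "subspace W" and U: "subspace U" "U \<subseteq> W"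
    and "p \<noteq> 0" and "\<And>i. i \<ge> n \<Longrightarrow> coeff p i = 0"
    and "w \<in> W" "w \<notin> U" "(\<Sum>i<n. coeff p i *s (T ^^ i) w) \<in> U"
  shows "\<exists>v\<in>W - U. \<exists>a. T v - a *s v \<in> U"
  using assms(5-)
proof (induction "degree p" arbitrary: p n rule: less_induct)
  case less
  have n: "degree p < n"
    using less.prems(1,2) by (metis leading_coeff_0_iff linorder_not_less)
  show ?case
  proof (cases "degree p = 0")
    case True
    have "(\<Sum>i<n. coeff p i *s (T ^^ i) w) = (\<Sum>i<n. if i = 0 then coeff p 0 *s w else 0)"
      using True by (intro sum.cong) (auto simp: coeff_eq_0)
    also have "\<dots> = coeff p 0 *s w" using n by (simp add: sum.delta)
    finally have "inverse (coeff p 0) *s coeff p 0 *s w \<in> U"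
      using less.prems(5) subspace_scale[OF U(1)] by metis
    moreover have "coeff p 0 \<noteq> 0" using True less.prems(1) by (metis leading_coeff_0_iff)
    ultimately show ?thesis using less.prems(4) by simp
  next
    case False
    then obtain a where "poly p a = 0" using alg_closed_imp_poly_has_root[of p] by auto
    then obtain q where q: "p = [:-a, 1:] * q" by (auto simp: poly_eq_0_iff_dvd)
    have q0: "q \<noteq> 0" using q less.prems(1) by auto
    have degq: "degree p = Suc (degree q)" unfolding q using q0 by (subst degree_mult_eq) auto
    define m where "m = n - 1"
    have m: "n = Suc m" "degree q < m" using n degq m_def by auto
    define v where "v = (\<Sum>i<m. coeff q i *s (T ^^ i) w)"
    have Tw: "(T ^^ i) w \<in> W" for i using endo_on_funpow[OF T less.prems(3)] .
    have vW: "v \<in> W" unfolding v_def by (intro subspace_sum[OF W] subspace_scale[OF W] Tw)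
    have qm: "coeff q i = 0" if "i \<ge> m" for i using that m by (intro coeff_eq_0) auto
    have c: "coeff p i = (case i of 0 \<Rightarrow> 0 | Suc j \<Rightarrow> coeff q j) - a * coeff q i" for i
      by (simp add: q coeff_pCons)
    have "(\<Sum>i<n. coeff p i *s (T ^^ i) w)
        = (\<Sum>i<Suc m. (case i of 0 \<Rightarrow> 0 | Suc j \<Rightarrow> coeff q j) *s (T ^^ i) w)
          - a *s (\<Sum>i<Suc m. coeff q i *s (T ^^ i) w)"
      by (simp add: c m scale_left_diff_distrib sum_subtractf scale_sum_right scale_right_distrib del: sum.lessThan_Suc)
    also have "(\<Sum>i<Suc m. (case i of 0 \<Rightarrow> 0 | Suc j \<Rightarrow> coeff q j) *s (T ^^ i) w)
        = (\<Sum>i<m. coeff q i *s T ((T ^^ i) w))"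
      by (subst sum.lessThan_Suc_shift) simp
    also have "\<dots> = T v"
      unfolding v_def using Tw
      by (simp add: endo_on_sum[OF T W] endo_on_scale[OF T] subspace_scale[OF W])
    also have "(\<Sum>i<Suc m. coeff q i *s (T ^^ i) w) = v" by (simp add: v_def qm)
    finally have ev: "T v - a *s v \<in> U" using less.prems(5) by simp
    show ?thesis
    proof (cases "v \<in> U")
      case True
      show ?thesis
        by (rule less.hyps[of q m]) (use degq q0 qm less.prems(3,4) True v_def in auto)
    next
      case False
      then show ?thesis using vW ev by blast
    qed
  qed
qed

lemma eigenvector_mod:
  assumes T: "endo_on W T" and W: "subspace W" "W \<subseteq> span F" "finite F"
    and U: "subspace U" and UW: "U \<subset> W"
  shows "\<exists>v\<in>W - U. \<exists>a. T v - a *s v \<in> U"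
proof -
  obtain w where w: "w \<in> W" "w \<notin> U" using UW by auto
  define X where "X i = (T ^^ i) w" for i
  have XW: "X i \<in> W" for i unfolding X_def by (rule endo_on_funpow[OF T w(1)])
  obtain n where "X n \<in> span (X ` {..<n})"
    using krylov_dependent[OF W(3), of X "\<lambda>n. span (X ` {..<n})"] XW W(2) by blast
  then have "\<exists>c. X n = (\<Sum>i<n. c i *s X i)"
  proof (induction rule: span_induct_alt)
    case base
    show ?case by (rule exI[of _ "\<lambda>_. 0"]) simp
  next
    case (step d x y)
    then obtain j c where j: "j < n" "x = X j" and y: "y = (\<Sum>i<n. c i *s X i)" by auto
    have "d *s x + y = (\<Sum>i<n. (c i + (if i = j then d else 0)) *s X i)"
      using j by (simp add: y scale_left_distrib sum.distrib if_distrib[of "\<lambda>c. c *s _"] sum.delta cong: if_cong)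
    then show ?case by auto
  qed
  then obtain c where c: "X n = (\<Sum>i<n. c i *s X i)" by auto
  \<comment> \<open>The first linear relation among the iterates of \<open>w\<close>, read as a
    monic polynomial. It annihilates \<open>w\<close> exactly, hence also modulo
    \<open>U\<close>.\<close>
  define p where "p = monom 1 n - (\<Sum>i<n. monom (c i) i)"
  have cp: "coeff p i = (if i = n then 1 else if i < n then - c i else 0)" for i
    by (auto simp: p_def coeff_diff coeff_sum sum.delta)
  have "coeff p n = 1" by (simp add: cp)
  then have p0: "p \<noteq> 0" by auto
  have "(\<Sum>i<Suc n. coeff p i *s X i) = 0"
    by (simp add: cp c sum_negf)
  then have "(\<Sum>i<Suc n. coeff p i *s (T ^^ i) w) \<in> U"
    using subspace_0[OF U] by (simp add: X_def)
  then show ?thesis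
    using UW w by (intro eigenvector_of_annihilator[OF T W(1) U _ p0, of "Suc n"]) (auto simp: cp)
qed

end

section \<open>Irreducible subquotients\<close>

text \<open>The representation on \<open>W / U\<close> without a quotient type: statements about it
  are congruences modulo \<open>U\<close>. The set \<open>L\<close> of labels need not be closed
  under anything; \<open>bracket\<close> only has to name commutators of the operators on
  \<open>W\<close>.\<close>

locale rep_subquotient = alg_closed_vector_space scale
  for scale :: "'a::{alg_closed_field, field_char_0} \<Rightarrow> 'b::ab_group_add \<Rightarrow> 'b" (infixr "*s" 75) +
  fixes U W F :: "'b set" and L :: "'l set" and \<rho> :: "'l \<Rightarrow> 'b \<Rightarrow> 'b"
    and bracket :: "'l \<Rightarrow> 'l \<Rightarrow> 'l"
  assumes U: "subspace U" and W: "subspace W" and UW: "U \<subseteq> W"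
    and F: "finite F" "W \<subseteq> span F"
    and \<rho>W: "x \<in> L \<Longrightarrow> endo_on W (\<rho> x)"
    and \<rho>U: "x \<in> L \<Longrightarrow> u \<in> U \<Longrightarrow> \<rho> x u \<in> U"
    and \<rho>_bracket: "x \<in> L \<Longrightarrow> y \<in> L \<Longrightarrow> w \<in> W \<Longrightarrow>
      \<rho> (bracket x y) w = \<rho> x (\<rho> y w) - \<rho> y (\<rho> x w)"
begin

text \<open>On the vectors \<open>X i = \<rho>(x)\<^sup>i w\<close> the operator \<open>\<rho> y - \<nu> y\<close> lowers the index by one, with
  coefficient \<open>i \<nu>([y, x])\<close>. The first \<open>X n\<close> depending on its predecessors then gives
  \<open>n \<nu>([y, x]) = 0\<close>.\<close>

lemma weight_vanishes_on_bracket: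
  assumes x: "x \<in> L" and I: "I \<subseteq> L" and Ix: "\<And>y. y \<in> I \<Longrightarrow> bracket y x \<in> I"
    and w: "w \<in> W" "w \<notin> U" and lam: "\<And>y. y \<in> I \<Longrightarrow> \<rho> y w - \<nu> y *s w \<in> U" and y: "y \<in> I"
  shows "\<nu> (bracket y x) = 0"
proof -
  define X where "X i = (\<rho> x ^^ i) w" for i
  \<comment> \<open>A filtration that starts at \<open>S 0 = U\<close>. Each \<open>S j\<close> is
    spanned modulo \<open>U\<close> by the first \<open>j\<close> iterates, and \<open>x\<close>
    raises the index by at most one.\<close>
  define S where "S j = span (X ` {..<j} \<union> U)" for j
  note ex = \<rho>W[OF x]
  have XW: "X i \<in> W" for i unfolding X_def by (rule endo_on_funpow[OF ex w(1)])
  have XS: "X (Suc i) = \<rho> x (X i)" for i by (simp add: X_def)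
  have SW: "S j \<subseteq> W" for j unfolding S_def using XW UW by (intro span_minimal W) auto
  have subS: "subspace (S j)" for j by (simp add: S_def)
  have US: "U \<subseteq> S j" for j unfolding S_def using span_superset by blast
  have XinS: "i < j \<Longrightarrow> X i \<in> S j" for i j unfolding S_def by (rule span_base) auto
  have mono: "i \<le> j \<Longrightarrow> S i \<subseteq> S j" for i j unfolding S_def by (rule span_mono) auto
  have xS: "\<rho> x r \<in> S (Suc j)" if "r \<in> S j" for r j
  proof -
    have "r \<in> W \<and> \<rho> x r \<in> S (Suc j)"
      using that unfolding S_def[of j]
    proof (induction rule: span_induct_alt)
      case base
      show ?case using subspace_0[OF W] endo_on_0[OF ex W] subspace_0[OF subS] by simp
    next
      case (step c v r)
      have v: "v \<in> W" "\<rho> x v \<in> S (Suc j)"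
      proof -
        have "v \<in> W \<and> \<rho> x v \<in> S (Suc j)"
        proof (cases "v \<in> U")
          case True
          then show ?thesis using UW \<rho>U[OF x True] US by blast
        next
          case False
          then obtain k where "k < j" "v = X k" using step(1) by blast
          then show ?thesis using XW[of k] XinS[of "Suc k" "Suc j"] by (simp add: XS)
        qed
        then show "v \<in> W" "\<rho> x v \<in> S (Suc j)" by auto
      qed
      show ?case
        using v step(2) by (auto simp: endo_on_add[OF ex] endo_on_scale[OF ex]
            subspace_scale[OF W] subspace_add[OF W] subspace_scale[OF subS] subspace_add[OF subS])
    qed
    then show ?thesis by simp
  qed
  have S0: "S 0 = U" by (simp add: S_def U)
  have xS0: "\<rho> x r \<in> S 0" if "r \<in> S 0" for r using that \<rho>U[OF x] S0 by auto
  \<comment> \<open>The error in the rule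
    \<open>y X_i = \<nu>(y) X_i + i \<nu>([y, x]) X_(i-1)\<close>, to be shown to lie one filtration
    step lower than \<open>X_i\<close> needs. At \<open>i = 0\<close> the index \<open>i - 1\<close>
    is truncated to 0, which is harmless because its coefficient is 0.\<close>
  define rem where "rem y i = \<rho> y (X i) - \<nu> y *s X i - (of_nat i * \<nu> (bracket y x)) *s X (i - 1)" for y i
  have lower: "rem y i \<in> S (i - 1)" if "y \<in> I" for y i
    using that
  proof (induction i arbitrary: y)
    case 0
    then show ?case using lam S0 by (simp add: X_def rem_def)
  next
    case (Suc i)
    let ?b = "bracket y x"
    have yL: "y \<in> L" using Suc.prems I by auto
    have r1: "rem y i \<in> S (i - 1)" and r2: "rem ?b i \<in> S (i - 1)"
      using Suc Ix by auto
    have yX: "\<rho> y (X i) = \<nu> y *s X i + (of_nat i * \<nu> ?b) *s X (i - 1) + rem y i" by (simp add: rem_def)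
    have bX: "\<rho> ?b (X i) = \<nu> ?b *s X i + (of_nat i * \<nu> (bracket ?b x)) *s X (i - 1) + rem ?b i"
      by (simp add: rem_def)
    have rW: "rem y i \<in> W" using r1 SW by auto
    have "\<rho> x (\<rho> y (X i)) = \<nu> y *s X (Suc i) + (of_nat i * \<nu> ?b) *s \<rho> x (X (i - 1)) + \<rho> x (rem y i)"
      unfolding yX using XW rW
      by (simp add: endo_on_add[OF ex] endo_on_scale[OF ex] subspace_scale[OF W] subspace_add[OF W] XS)
    moreover have "of_nat i *s \<rho> x (X (i - 1)) = of_nat i *s X i" by (cases i) (simp_all add: XS)
    ultimately have xy: "\<rho> x (\<rho> y (X i)) = \<nu> y *s X (Suc i) + (of_nat i * \<nu> ?b) *s X i + \<rho> x (rem y i)"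
      by (metis mult.commute scale_scale)
    have "\<rho> y (X (Suc i)) = \<rho> x (\<rho> y (X i)) + \<rho> ?b (X i)"
      using \<rho>_bracket[OF yL x XW, of i] by (simp add: XS)
    also have "\<dots> = \<nu> y *s X (Suc i) + (of_nat (Suc i) * \<nu> ?b) *s X i
        + (\<rho> x (rem y i) + (of_nat i * \<nu> (bracket ?b x)) *s X (i - 1) + rem ?b i)"
      unfolding xy bX by (simp add: algebra_simps)
    finally have "rem y (Suc i) = \<rho> x (rem y i) + (of_nat i * \<nu> (bracket ?b x)) *s X (i - 1) + rem ?b i"
      by (simp add: rem_def)
    \<comment> \<open>For positive \<open>i\<close> the index rises from \<open>i - 1\<close> to
      \<open>i\<close>. For \<open>i = 0\<close> truncation leaves no room to rise, and invariance
      of \<open>S 0 = U\<close> is used instead.\<close>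
    moreover have "\<rho> x (rem y i) \<in> S i"
      using r1 xS[of "rem y i" "i - 1"] xS0 by (cases i) auto
    moreover have "(of_nat i * \<nu> (bracket ?b x)) *s X (i - 1) \<in> S i"
      using XinS[of "i - 1" i] subspace_scale[OF subS] subspace_0[OF subS] by (cases i) auto
    moreover have "rem ?b i \<in> S i" using r2 mono[OF diff_le_self[of i 1]] by blast
    ultimately show ?case by (simp add: subspace_add[OF subS])
  qed
  obtain n where n: "X n \<in> S n" and least: "\<And>k. k < n \<Longrightarrow> X k \<notin> S k"
  proof -
    have "\<exists>n. X n \<in> S n"
    proof (rule krylov_dependent[OF F(1)])
      show "X n \<in> span F" for n using XW F(2) by blast
      show "span (X ` {..<n}) \<subseteq> S n" for n unfolding S_def by (rule span_mono) blast
    qed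
    then show ?thesis using that exists_least_iff[of "\<lambda>n. X n \<in> S n"] by blast
  qed
  have n0: "n \<noteq> 0"
  proof
    assume "n = 0"
    with n S0 w(2) show False by (simp add: X_def)
  qed
  have yL: "y \<in> L" using y I by auto
  note ey = \<rho>W[OF yL]
  \<comment> \<open>On all of \<open>S n\<close> the operator \<open>\<rho> y - \<nu> y\<close>
    drops the index by one. As \<open>X n\<close> is itself in \<open>S n\<close>, this compares the
    rule for \<open>X n\<close> with membership in \<open>S (n - 1)\<close>.\<close>
  have Nr: "\<rho> y r - \<nu> y *s r \<in> S (n - 1)" if "r \<in> S n" for r
  proof -
    have "r \<in> W \<and> \<rho> y r - \<nu> y *s r \<in> S (n - 1)"
      using that unfolding S_def[of n]
    proof (induction rule: span_induct_alt)
      case base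
      show ?case using subspace_0[OF W] endo_on_0[OF ey W] subspace_0[OF subS] by simp
    next
      case (step c v r)
      have v: "v \<in> W \<and> \<rho> y v - \<nu> y *s v \<in> S (n - 1)"
      proof (cases "v \<in> U")
        case True
        then have "\<rho> y v - \<nu> y *s v \<in> U" using \<rho>U[OF yL] U by (simp add: subspace_diff subspace_scale)
        then show ?thesis using True UW US by auto
      next
        case False
        then obtain k where k: "k < n" "v = X k" using step(1) by auto
        have eq: "\<rho> y v - \<nu> y *s v = rem y k + (of_nat k * \<nu> (bracket y x)) *s X (k - 1)"
          by (simp add: rem_def k)
        have "rem y k \<in> S (n - 1)" using lower[OF y, of k] mono[OF diff_le_mono[OF less_imp_le[OF k(1)], of 1]] by blast
        moreover have "(of_nat k * \<nu> (bracket y x)) *s X (k - 1) \<in> S (n - 1)"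
          using XinS[of "k - 1" "n - 1"] k subspace_scale[OF subS] subspace_0[OF subS] by (cases k) auto
        ultimately show ?thesis using k XW eq by (simp add: subspace_add[OF subS])
      qed
      have eq: "\<rho> y (c *s v + r) - \<nu> y *s (c *s v + r)
          = c *s (\<rho> y v - \<nu> y *s v) + (\<rho> y r - \<nu> y *s r)"
        using v step(2) by (simp add: endo_on_add[OF ey] endo_on_scale[OF ey] subspace_scale[OF W] algebra_simps)
      show ?case unfolding eq
        using v step(2) by (simp add: subspace_add[OF subS] subspace_scale[OF subS] subspace_add[OF W] subspace_scale[OF W])
    qed
    then show ?thesis by simp
  qed
  \<comment> \<open>Only the term in \<open>X (n - 1)\<close> is left, and it lies in
    \<open>S (n - 1)\<close>. Minimality of \<open>n\<close> keeps \<open>X (n - 1)\<close> out of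
    that space, so the coefficient is 0, and in characteristic 0 the factor \<open>n\<close> can be
    cancelled.\<close>
  have "(of_nat n * \<nu> (bracket y x)) *s X (n - 1) = (\<rho> y (X n) - \<nu> y *s X n) - rem y n"
    by (simp add: rem_def)
  then have mem: "(of_nat n * \<nu> (bracket y x)) *s X (n - 1) \<in> S (n - 1)"
    using Nr[OF n] lower[OF y, of n] by (simp add: subspace_diff[OF subS])
  show ?thesis
  proof (rule ccontr)
    assume "\<nu> (bracket y x) \<noteq> 0"
    then have nz: "of_nat n * \<nu> (bracket y x) \<noteq> 0" using n0 by simp
    have "X (n - 1) \<in> S (n - 1)"
      using subspace_scale[OF subS mem, of "inverse (of_nat n * \<nu> (bracket y x))"]
      unfolding scale_scale left_inverse[OF nz] by simp
    with least[of "n - 1"] n0 show False by simp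
  qed
qed

text \<open>Take an invariant \<open>M\<close> that is minimal among those strictly above
  \<open>U\<close>. For each \<open>a\<close> the eigenvectors of \<open>a\<close> in
  \<open>M\<close> modulo \<open>U\<close>, for one eigenvalue, again form such a subspace because
  the operators commute modulo \<open>U\<close>. By minimality it is all of \<open>M\<close>, so
  every \<open>a\<close> acts on \<open>M\<close> by a scalar.\<close>

lemma common_eigenvector_mod:
  assumes A: "A \<subseteq> L" and proper: "U \<noteq> W"
    and comm: "\<And>a b w. a \<in> A \<Longrightarrow> b \<in> A \<Longrightarrow> w \<in> W \<Longrightarrow> \<rho> a (\<rho> b w) - \<rho> b (\<rho> a w) \<in> U"
  shows "\<exists>w\<in>W - U. \<exists>\<nu>. \<forall>a\<in>A. \<rho> a w - \<nu> a *s w \<in> U"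
proof -
  define P where "P M \<longleftrightarrow> subspace M \<and> U \<subset> M \<and> M \<subseteq> W \<and> (\<forall>a\<in>A. \<forall>m\<in>M. \<rho> a m \<in> M)" for M
  have "\<rho> a m \<in> W" if "a \<in> A" "m \<in> W" for a m
    using that A by (intro endo_on_mem[OF \<rho>W]) auto
  then have "P W" using W UW proper by (simp add: P_def psubset_eq)
  moreover have "subspace M \<and> M \<subseteq> span F" if "P M" for M
    using that F(2) by (simp add: P_def subset_trans[OF _ F(2)])
  ultimately obtain M where M: "P M" and min: "\<And>M'. P M' \<Longrightarrow> M' \<subseteq> M \<Longrightarrow> M' = M"
    using ex_minimal_subspace[OF _ _ F(1), of P W] by blast
  have MW: "M \<subseteq> W" and sM: "subspace M" and UM: "U \<subset> M" using M by (auto simp: P_def)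
  have "\<exists>c. \<forall>m\<in>M. \<rho> a m - c *s m \<in> U" if a: "a \<in> A" for a
  proof -
    have aL: "a \<in> L" using a A by auto
    note ea = \<rho>W[OF aL]
    have "endo_on M (\<rho> a)" using M a by (intro endo_on_subset[OF ea MW]) (simp add: P_def)
    then obtain v c where v: "v \<in> M" "v \<notin> U" "\<rho> a v - c *s v \<in> U"
      using eigenvector_mod[OF _ sM subset_trans[OF MW F(2)] F(1) U UM] by blast
    let ?M = "{m \<in> M. \<rho> a m - c *s m \<in> U}"
    have UM': "U \<subseteq> ?M"
      using UM \<rho>U[OF aL] U by (auto simp: subspace_diff subspace_scale)
    have "P ?M"
      unfolding P_def
    proof (intro conjI ballI)
      show "subspace ?M"
      proof (rule subspaceI)
        show "0 \<in> ?M" by (rule subsetD[OF UM' subspace_0[OF U]])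
      next
        fix m n assume mn: "m \<in> ?M" "n \<in> ?M"
        then have "\<rho> a (m + n) - c *s (m + n) = (\<rho> a m - c *s m) + (\<rho> a n - c *s n)"
          using MW by (auto simp: endo_on_add[OF ea] subsetD algebra_simps)
        then show "m + n \<in> ?M" using mn subspace_add[OF U] subspace_add[OF sM] by auto
      next
        fix d m assume m: "m \<in> ?M"
        then have "\<rho> a (d *s m) - c *s (d *s m) = d *s (\<rho> a m - c *s m)"
          using MW by (auto simp: endo_on_scale[OF ea] subsetD algebra_simps)
        then show "d *s m \<in> ?M" using m subspace_scale[OF U] subspace_scale[OF sM] by auto
      qed
      show "U \<subset> ?M" using UM' v by auto
      show "?M \<subseteq> W" using MW by auto
    next
      fix b m assume b: "b \<in> A" and m: "m \<in> ?M"
      have bL: "b \<in> L" using b A by auto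
      note eb = \<rho>W[OF bL]
      have bm: "\<rho> b m \<in> M" using M b m by (auto simp: P_def)
      have mW: "m \<in> W" using m MW by auto
      have eq: "\<rho> a (\<rho> b m) - c *s \<rho> b m
          = (\<rho> a (\<rho> b m) - \<rho> b (\<rho> a m)) + \<rho> b (\<rho> a m - c *s m)"
        using mW endo_on_mem[OF ea mW]
        by (simp add: endo_on_diff[OF eb W] endo_on_scale[OF eb] subspace_scale[OF W])
      have "\<rho> a (\<rho> b m) - c *s \<rho> b m \<in> U"
        unfolding eq using comm[OF a b mW] \<rho>U[OF bL] m by (intro subspace_add[OF U]) auto
      then show "\<rho> b m \<in> ?M" using bm by simp
    qed
    then have "?M = M" by (rule min) auto
    then show ?thesis by blast
  qed
  then obtain \<nu> where "\<forall>a\<in>A. \<forall>m\<in>M. \<rho> a m - \<nu> a *s m \<in> U" by metis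
  then show ?thesis using UM MW by blast
qed

text \<open>Descending induction along a solvable chain of ideals: once \<open>A (i + 1)\<close> acts by scalars,
  these vanish on \<open>[A i, A i]\<close>, so that \<open>A i\<close> acts by commuting operators.\<close>

lemma solvable_acts_by_scalars:
  assumes proper: "U \<noteq> W"
    and irr: "\<And>M. subspace M \<Longrightarrow> U \<subset> M \<Longrightarrow> M \<subseteq> W \<Longrightarrow> (\<And>x m. x \<in> L \<Longrightarrow> m \<in> M \<Longrightarrow> \<rho> x m \<in> M) \<Longrightarrow> M = W"
    and A: "\<And>i. A i \<subseteq> L" and AL: "\<And>i a x. a \<in> A i \<Longrightarrow> x \<in> L \<Longrightarrow> bracket a x \<in> A i"
    and AA: "\<And>i a b. a \<in> A i \<Longrightarrow> b \<in> A i \<Longrightarrow> bracket a b \<in> A (Suc i)"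
    and An: "\<And>a w. a \<in> A n \<Longrightarrow> w \<in> W \<Longrightarrow> \<rho> a w \<in> U"
  shows "\<exists>\<nu>. (\<forall>a\<in>A 0. \<forall>w\<in>W. \<rho> a w - \<nu> a *s w \<in> U) \<and> (\<forall>a\<in>A 0. \<forall>x\<in>L. \<nu> (bracket a x) = 0)"
proof -
  have "\<exists>\<nu>. (\<forall>a\<in>A i. \<forall>w\<in>W. \<rho> a w - \<nu> a *s w \<in> U) \<and> (\<forall>a\<in>A i. \<forall>x\<in>L. \<nu> (bracket a x) = 0)"
    if "i \<le> n" for i
    using that
  proof (induction rule: inc_induct)
    case base
    show ?case by (rule exI[of _ "\<lambda>_. 0"]) (use An in simp)
  next
    case (step i)
    from step.IH obtain \<mu> where \<mu>: "\<And>a w. a \<in> A (Suc i) \<Longrightarrow> w \<in> W \<Longrightarrow> \<rho> a w - \<mu> a *s w \<in> U"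
      by blast
    have comm: "\<rho> a (\<rho> b w) - \<rho> b (\<rho> a w) \<in> U" if ab: "a \<in> A i" "b \<in> A i" and w: "w \<in> W" for a b w
    proof -
      have aL: "a \<in> L" and bL: "b \<in> L" using ab A by auto
      obtain v c where v: "v \<in> W" "v \<notin> U" "\<rho> a v - c *s v \<in> U"
        using eigenvector_mod[OF \<rho>W[OF aL] W F(2,1) U] UW proper by blast
      \<comment> \<open>The weight lemma needs a single vector on which a whole set acts by scalars
        and which absorbs brackets with \<open>b\<close>. By induction \<open>A (Suc i)\<close> acts
        by scalars on every vector, \<open>a\<close> does so on its eigenvector \<open>v\<close>,
        and all brackets with \<open>b\<close> land in \<open>A (Suc i)\<close>.\<close>
      let ?I = "insert a (A (Suc i))"
      let ?l = "\<lambda>y. if y \<in> A (Suc i) then \<mu> y else c"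
      have "?l (bracket a b) = 0"
        by (rule weight_vanishes_on_bracket[OF bL, of ?I v])
           (use ab aL A bL AL AA \<mu> v in auto)
      then have "\<mu> (bracket a b) = 0" using AA[OF ab] by simp
      then have "\<rho> (bracket a b) w \<in> U" using \<mu>[OF AA[OF ab] w] by simp
      then show ?thesis using \<rho>_bracket[OF aL bL w] by simp
    qed
    obtain w \<nu> where w: "w \<in> W" "w \<notin> U" and \<nu>: "\<And>a. a \<in> A i \<Longrightarrow> \<rho> a w - \<nu> a *s w \<in> U"
      using common_eigenvector_mod[OF A proper comm] by blast
    have van: "\<nu> (bracket a x) = 0" if "a \<in> A i" "x \<in> L" for a x
      by (rule weight_vanishes_on_bracket[OF that(2) A[of i] _ w]) (use AL that \<nu> in auto)
    \<comment> \<open>The weight space of \<open>\<nu>\<close> modulo \<open>U\<close>. It is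
      invariant under \<open>L\<close> because moving \<open>a\<close> past \<open>x\<close> costs a
      bracket, on which \<open>\<nu>\<close> vanishes; irreducibility then makes it all of
      \<open>W\<close>.\<close>
    let ?M = "{m \<in> W. \<forall>a\<in>A i. \<rho> a m - \<nu> a *s m \<in> U}"
    have UM: "U \<subseteq> ?M"
    proof -
      have "\<rho> a u - \<nu> a *s u \<in> U" if "a \<in> A i" "u \<in> U" for a u
        using \<rho>U[of a u] that A by (auto intro!: subspace_diff[OF U] subspace_scale[OF U])
      then show ?thesis using UW by auto
    qed
    have ea: "endo_on W (\<rho> a)" if "a \<in> A i" for a using \<rho>W that A by blast
    have "?M = W"
    proof (rule irr)
      show "subspace ?M"
      proof (rule subspaceI)
        show "0 \<in> ?M" by (rule subsetD[OF UM subspace_0[OF U]])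
      next
        fix m n assume mn: "m \<in> ?M" "n \<in> ?M"
        have "\<rho> a (m + n) - \<nu> a *s (m + n) = (\<rho> a m - \<nu> a *s m) + (\<rho> a n - \<nu> a *s n)" if "a \<in> A i" for a
          using mn by (auto simp: endo_on_add[OF ea[OF that]] algebra_simps)
        then show "m + n \<in> ?M" using mn subspace_add[OF U] subspace_add[OF W] by auto
      next
        fix d m assume m: "m \<in> ?M"
        then have "\<rho> a (d *s m) - \<nu> a *s (d *s m) = d *s (\<rho> a m - \<nu> a *s m)" if "a \<in> A i" for a
          using m by (auto simp: endo_on_scale[OF ea[OF that]] algebra_simps)
        then show "d *s m \<in> ?M" using m subspace_scale[OF U] subspace_scale[OF W] by auto
      qed
      show "U \<subset> ?M" using UM w \<nu> by blast
      show "?M \<subseteq> W" by auto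
    next
      fix x m assume x: "x \<in> L" and m: "m \<in> ?M"
      note ex = \<rho>W[OF x]
      have mW: "m \<in> W" using m by auto
      have "\<rho> a (\<rho> x m) - \<nu> a *s \<rho> x m \<in> U" if a: "a \<in> A i" for a
      proof -
        have aL: "a \<in> L" using a A by auto
        have eq: "\<rho> a (\<rho> x m) - \<nu> a *s \<rho> x m = \<rho> (bracket a x) m + \<rho> x (\<rho> a m - \<nu> a *s m)"
          using \<rho>_bracket[OF aL x mW] endo_on_mem[OF ea[OF a] mW] mW
          by (simp add: endo_on_diff[OF ex W] endo_on_scale[OF ex] subspace_scale[OF W])
        have "\<rho> (bracket a x) m - \<nu> (bracket a x) *s m \<in> U"
          using m AL[OF a x] by blast
        then have "\<rho> (bracket a x) m \<in> U" using van[OF a x] by simp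
        then show ?thesis unfolding eq using \<rho>U[OF x] m a by (intro subspace_add[OF U]) auto
      qed
      then show "\<rho> x m \<in> ?M" using endo_on_mem[OF ex mW] by auto
    qed
    then show ?case using van by blast
  qed
  then show ?thesis by blast
qed

end

section \<open>Derivations and the solvable radical\<close>

locale fin_dim_lie_algebra = lie_algebra sg br + alg_closed_vector_space sg
  for sg :: "'k::{alg_closed_field, field_char_0} \<Rightarrow> 'g::ab_group_add \<Rightarrow> 'g"
    and br :: "'g \<Rightarrow> 'g \<Rightarrow> 'g" +
  assumes finite_dimensional: "finite_dim sg (UNIV :: 'g set)"
begin

lemma linear_br: "Vector_Spaces.linear sg sg (br x)"
  by (simp add: Vector_Spaces.linear_iff vector_space_axioms br_add_right br_scale_right)

lemma br_0_right [simp]: "br x 0 = 0"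
  using br_scale_right[of x 0 0] by simp

lemma br_0_left [simp]: "br 0 x = 0"
  using br_scale_left[of 0 0 x] by simp

lemma br_minus_right: "br x (- y) = - br x y"
  using br_scale_right[of x "-1" y] by simp

lemma br_minus_left: "br (- x) y = - br x y"
  using br_scale_left[of "-1" x y] by simp

lemma br_diff_right: "br x (y - z) = br x y - br x z"
  using br_add_right[of x y "- z"] by (simp add: br_minus_right)

lemma br_diff_left: "br (x - y) z = br x z - br y z"
  using br_add_left[of x "- y" z] by (simp add: br_minus_left)

lemma br_anti: "br x y = - br y x"
proof -
  have "br (x + y) (x + y) = br x y + br y x"
    unfolding br_add_left br_add_right by (simp add: br_self)
  then show ?thesis by (simp add: br_self eq_neg_iff_add_eq_0)
qed

lemma br_br: "br x (br y z) = br (br x y) z + br y (br x z)"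
proof -
  have "br x (br y z) - br y (br x z) - br (br x y) z = 0"
    using jacobi[of x y z] br_anti[of z x] br_anti[of z "br x y"] by (simp add: br_minus_right)
  then show ?thesis by (simp add: algebra_simps)
qed

lemma ex_finite_span: "\<exists>F. finite F \<and> span F = UNIV"
  using finite_dimensional by (simp add: finite_dim_def)

lemma Der_linear: "D \<in> Der sg br \<Longrightarrow> Vector_Spaces.linear sg sg D"
  by (simp add: Der_def)

lemma Der_br: "D \<in> Der sg br \<Longrightarrow> D (br x y) = br (D x) y + br x (D y)"
  by (simp add: Der_def)

lemma linear_add: "Vector_Spaces.linear sg sg D \<Longrightarrow> D (x + y) = D x + D y"
  by (simp add: Vector_Spaces.linear_iff)

lemma linear_scale: "Vector_Spaces.linear sg sg D \<Longrightarrow> D (sg c x) = sg c (D x)"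
  by (simp add: Vector_Spaces.linear_iff)

lemma linear_0: "Vector_Spaces.linear sg sg D \<Longrightarrow> D 0 = 0"
  using linear_scale[of D 0 0] by simp

lemma linear_sum: "Vector_Spaces.linear sg sg D \<Longrightarrow> D (sum f I) = (\<Sum>i\<in>I. D (f i))"
  by (induction I rule: infinite_finite_induct) (simp_all add: linear_0 linear_add)

lemma Der_br_diff:
  assumes D: "D \<in> Der sg br"
  shows "(\<lambda>y. D y - br x y) \<in> Der sg br"
proof -
  have "Vector_Spaces.linear sg sg (\<lambda>y. D y - br x y)"
    using D linear_br by (simp add: Vector_Spaces.linear_iff vector_space_axioms Der_def br_add_right br_scale_right scale_right_diff_distrib)
  moreover have "D (br y z) - br x (br y z) = br (D y - br x y) z + br y (D z - br x z)" for y z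
    by (simp add: Der_br[OF D] br_diff_left br_diff_right br_br[of x y z])
  ultimately show ?thesis by (simp add: Der_def)
qed

lemma br_Der: "br x \<in> Der sg br"
  unfolding Der_def using linear_br br_br by blast

section \<open>The derived series, solvability and derivations\<close>

lemma derived_algebra_mono: "I \<subseteq> J \<Longrightarrow> derived_algebra sg br I \<subseteq> derived_algebra sg br J"
  unfolding derived_algebra_def by (rule span_mono) blast

lemma derived_funpow_mono:
  "I \<subseteq> J \<Longrightarrow> (derived_algebra sg br ^^ n) I \<subseteq> (derived_algebra sg br ^^ n) J"
  by (induction n) (auto intro: derived_algebra_mono[THEN subsetD])

lemma subspace_derived_funpow: "subspace I \<Longrightarrow> subspace ((derived_algebra sg br ^^ n) I)"
  by (cases n) (auto simp: derived_algebra_def)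

lemma br_mem_derived: "x \<in> I \<Longrightarrow> y \<in> I \<Longrightarrow> br x y \<in> derived_algebra sg br I"
  unfolding derived_algebra_def by (rule span_base) blast

lemma lie_solvableI:
  assumes "subspace I" "(derived_algebra sg br ^^ n) I \<subseteq> {0}"
  shows "lie_solvable sg br I"
  using assms subspace_0[OF subspace_derived_funpow[OF assms(1)], of n]
  unfolding lie_solvable_def by blast

text \<open>After one step the derived series of \<open>J\<close> runs inside that of
  \<open>S\<close>.\<close>

lemma lie_solvable_extension:
  assumes J: "subspace J" and br: "\<And>x y. x \<in> J \<Longrightarrow> y \<in> J \<Longrightarrow> br x y \<in> S"
    and S: "subspace S" "lie_solvable sg br S"
  shows "lie_solvable sg br J"
proof -
  obtain n where n: "(derived_algebra sg br ^^ n) S = {0}" using S(2) by (auto simp: lie_solvable_def)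
  have "derived_algebra sg br J \<subseteq> S"
    unfolding derived_algebra_def using br by (intro span_minimal S(1)) blast
  then have "(derived_algebra sg br ^^ Suc n) J \<subseteq> {0}"
    using derived_funpow_mono[of _ S n] n by (metis funpow_Suc_right comp_apply)
  with J show ?thesis by (rule lie_solvableI)
qed

lemma derived_algebra_Der:
  assumes D: "D \<in> Der sg br" and I: "D ` I \<subseteq> I"
  shows "D ` derived_algebra sg br I \<subseteq> derived_algebra sg br I"
proof
  fix z assume "z \<in> D ` derived_algebra sg br I"
  then obtain x where x: "x \<in> derived_algebra sg br I" "z = D x" by blast
  have "D x \<in> derived_algebra sg br I"
    using x(1) unfolding derived_algebra_def
  proof (induction rule: span_induct_alt)
    case base
    then show ?case by (simp add: linear_0[OF Der_linear[OF D]] span_zero)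
  next
    case (step c v y)
    then obtain a b where "a \<in> I" "b \<in> I" "v = br a b" by blast
    moreover then have "D a \<in> I" "D b \<in> I" using I by auto
    ultimately have "D v \<in> derived_algebra sg br I"
      using br_mem_derived unfolding derived_algebra_def by (simp add: Der_br[OF D] span_add)
    then show ?case
      using step(2) unfolding derived_algebra_def
      by (simp add: linear_add[OF Der_linear[OF D]] linear_scale[OF Der_linear[OF D]] span_add span_scale)
  qed
  then show "z \<in> derived_algebra sg br I" by (simp add: x)
qed

lemma derived_funpow_Der:
  assumes "D \<in> Der sg br" "D ` I \<subseteq> I"
  shows "D ` (derived_algebra sg br ^^ n) I \<subseteq> (derived_algebra sg br ^^ n) I"
  by (induction n) (use assms derived_algebra_Der in auto)

lemma lie_ideal_UNIV_br:
  "lie_ideal sg br I UNIV \<Longrightarrow> y \<in> I \<Longrightarrow> br x y \<in> I"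
  "lie_ideal sg br I UNIV \<Longrightarrow> y \<in> I \<Longrightarrow> br y x \<in> I"
  unfolding lie_ideal_def using br_anti[of y x] subspace_neg by auto

text \<open>Each \<open>br x\<close> is a derivation that preserves \<open>I\<close>, hence
  preserves every term of its derived series.\<close>

lemma br_derived_funpow:
  assumes "lie_ideal sg br I UNIV" "y \<in> (derived_algebra sg br ^^ n) I"
  shows "br x y \<in> (derived_algebra sg br ^^ n) I" "br y x \<in> (derived_algebra sg br ^^ n) I"
proof -
  have "br x ` I \<subseteq> I" using lie_ideal_UNIV_br(1)[OF assms(1)] by blast
  then show *: "br x y \<in> (derived_algebra sg br ^^ n) I"
    using derived_funpow_Der[OF br_Der, of x I n] assms(2) by blast
  have "subspace I" using assms(1) by (simp add: lie_ideal_def)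
  from subspace_neg[OF subspace_derived_funpow[OF this] *]
  show "br y x \<in> (derived_algebra sg br ^^ n) I" using br_anti[of y x] by simp
qed

lemma derived_funpow_subset:
  assumes "lie_ideal sg br I UNIV"
  shows "(derived_algebra sg br ^^ n) I \<subseteq> I"
proof (induction n)
  case (Suc n)
  have "br x y \<in> I" if "x \<in> (derived_algebra sg br ^^ n) I" for x y
    using Suc that lie_ideal_UNIV_br(2)[OF assms] by blast
  moreover have "subspace I" using assms by (simp add: lie_ideal_def)
  ultimately have "derived_algebra sg br ((derived_algebra sg br ^^ n) I) \<subseteq> I"
    unfolding derived_algebra_def[of _ _ "(_ ^^ n) I"] by (intro span_minimal) blast
  then show ?case by simp
qed simp

lemma leibniz:
  assumes D: "D \<in> Der sg br"
  shows "(D ^^ n) (br x y) = (\<Sum>i\<le>n. sg (of_nat (n choose i)) (br ((D ^^ i) x) ((D ^^ (n - i)) y)))"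
proof (induction n)
  case (Suc n)
  let ?t = "\<lambda>i j. br ((D ^^ i) x) ((D ^^ j) y)"
  have lin: "Vector_Spaces.linear sg sg D" by (rule Der_linear[OF D])
  have "(D ^^ Suc n) (br x y) = (\<Sum>i\<le>n. sg (of_nat (n choose i)) (?t (Suc i) (n - i) + ?t i (Suc (n - i))))"
    by (simp add: Suc linear_sum[OF lin] linear_scale[OF lin] Der_br[OF D])
  also have "\<dots> = (\<Sum>i\<le>n. sg (of_nat (n choose i)) (?t (Suc i) (n - i)))
      + (\<Sum>i\<le>n. sg (of_nat (n choose i)) (?t i (Suc n - i)))"
    by (simp add: scale_right_distrib sum.distrib Suc_diff_le)
  also have "(\<Sum>i\<le>n. sg (of_nat (n choose i)) (?t i (Suc n - i)))
      = (\<Sum>i\<le>Suc n. sg (of_nat (n choose i)) (?t i (Suc n - i)))"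
    by simp
  also have "\<dots> = ?t 0 (Suc n) + (\<Sum>i\<le>n. sg (of_nat (n choose Suc i)) (?t (Suc i) (n - i)))"
    by (subst sum.atMost_Suc_shift) simp
  also have "(\<Sum>i\<le>n. sg (of_nat (n choose i)) (?t (Suc i) (n - i))) + \<dots>
      = ?t 0 (Suc n) + (\<Sum>i\<le>n. sg (of_nat (Suc n choose Suc i)) (?t (Suc i) (n - i)))"
    by (simp add: sum.distrib scale_left_distrib algebra_simps)
  also have "\<dots> = (\<Sum>i\<le>Suc n. sg (of_nat (Suc n choose i)) (?t i (Suc n - i)))"
    by (subst sum.atMost_Suc_shift) simp
  finally show ?case .
qed simp

text \<open>Suppose some iterate of \<open>D\<close> leaves \<open>S\<close>. In the derived series
  of \<open>S\<close> choose the last term \<open>A k\<close> that does not stay in \<open>S\<close>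
  under all iterates; its brackets do stay. Adding the images of \<open>A k\<close> under successive
  powers of \<open>D\<close> gives ideals \<open>J m\<close>. The Leibniz rule shows that the
  brackets of each new ideal fall into \<open>S\<close>, so it is solvable and lies in
  \<open>S\<close> by maximality, contradicting the choice of \<open>A k\<close>.\<close>

lemma solvable_radical_Der:
  assumes D: "D \<in> Der sg br" and S: "solvable_radical sg br S"
  shows "D ` S \<subseteq> S"
proof -
  have lin: "Vector_Spaces.linear sg sg D" by (rule Der_linear[OF D])
  have idS: "lie_ideal sg br S UNIV" and solS: "lie_solvable sg br S"
    and maxS: "\<And>I. lie_ideal sg br I UNIV \<Longrightarrow> lie_solvable sg br I \<Longrightarrow> I \<subseteq> S"
    using S by (auto simp: solvable_radical_def)
  have sS: "subspace S" using idS by (simp add: lie_ideal_def)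
  define A where "A j = (derived_algebra sg br ^^ j) S" for j
  define T where "T = {x. \<forall>n. (D ^^ n) x \<in> S}"
  have TD: "(D ^^ n) x \<in> S" if "x \<in> T" for x n using that by (simp add: T_def)
  have "S \<subseteq> T"
  proof (rule ccontr)
    assume "\<not> S \<subseteq> T"
    obtain n where "A n = {0}" using solS by (auto simp: lie_solvable_def A_def)
    moreover have "(D ^^ k) 0 = 0" for k by (induction k) (simp_all add: linear_0[OF lin])
    ultimately have "A n \<subseteq> T" using subspace_0[OF sS] by (simp add: T_def)
    then obtain j where j: "A j \<subseteq> T" and least: "\<And>i. i < j \<Longrightarrow> \<not> A i \<subseteq> T"
      using exists_least_iff[of "\<lambda>n. A n \<subseteq> T"] by blast
    have "j \<noteq> 0" using j \<open>\<not> S \<subseteq> T\<close> by (metis A_def funpow_0)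
    then obtain k where k: "j = Suc k" using not0_implies_Suc by blast
    have AA: "br x y \<in> T" if "x \<in> A k" "y \<in> A k" for x y
      using br_mem_derived[OF that] j by (auto simp: A_def k)
    have Abr: "br x y \<in> A k" if "y \<in> A k" for x y
      using br_derived_funpow(1)[OF idS] that by (simp add: A_def)
    have AS: "A k \<subseteq> S" unfolding A_def by (rule derived_funpow_subset[OF idS])
    have "\<forall>i\<le>n. \<forall>a\<in>A k. (D ^^ i) a \<in> S" for n
    proof (induction n)
      case 0
      then show ?case using AS by auto
    next
      case (Suc n)
      define J where "J m = span (\<Union>i\<le>m. (D ^^ i) ` A k)" for m
      have subJ: "subspace (J m)" for m by (simp add: J_def)
      have inJ: "(D ^^ i) a \<in> J m" if "i \<le> m" "a \<in> A k" for i m a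
        unfolding J_def using that by (intro span_base) blast
      have Jmono: "J i \<subseteq> J m" if "i \<le> m" for i m
        unfolding J_def using that by (intro span_mono UN_mono) auto
      have DJ: "D x \<in> J (Suc m)" if "x \<in> J m" for x m
        using that unfolding J_def[of m]
      proof (induction rule: span_induct_alt)
        case base
        then show ?case by (simp add: linear_0[OF lin] subspace_0[OF subJ])
      next
        case (step c v y)
        then obtain i a where i: "i \<le> m" "a \<in> A k" "v = (D ^^ i) a" by blast
        then have "D v \<in> J (Suc m)" using inJ[of "Suc i" "Suc m" a] by simp
        then show ?case using step(2)
          by (simp add: linear_add[OF lin] linear_scale[OF lin] subspace_add[OF subJ] subspace_scale[OF subJ])
      qed
      \<comment> \<open>By the product rule \<open>[z, D y] = D [z, y] - [D z, y]\<close>. The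
        second term changes \<open>z\<close>, so the induction has to be for all \<open>z\<close> at
        once.\<close>
      have brgen: "br z ((D ^^ i) a) \<in> J i" if "a \<in> A k" for i z a
      proof (induction i arbitrary: z)
        case 0
        then show ?case using inJ[of 0 0] Abr[OF that] by simp
      next
        case (Suc i)
        have "br z ((D ^^ Suc i) a) = D (br z ((D ^^ i) a)) - br (D z) ((D ^^ i) a)"
          by (simp add: Der_br[OF D])
        moreover have "br (D z) ((D ^^ i) a) \<in> J (Suc i)"
          using Suc[of "D z"] Jmono[of i "Suc i"] by auto
        ultimately show ?case using DJ[OF Suc[of z]] subspace_diff[OF subJ] by simp
      qed
      have Jid: "lie_ideal sg br (J m) UNIV" for m
        unfolding lie_ideal_def
      proof (intro conjI ballI subJ subset_UNIV)
        fix z x assume "x \<in> J m"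
        then show "br z x \<in> J m"
          unfolding J_def
        proof (induction rule: span_induct_alt)
          case base
          then show ?case by (simp add: span_zero)
        next
          case (step c v y)
          then obtain i a where i: "i \<le> m" "a \<in> A k" "v = (D ^^ i) a" by blast
          have "br z v \<in> J m" using brgen[OF i(2), of z i] Jmono[OF i(1)] i(3) by auto
          then show ?case using step(2) by (simp add: J_def br_add_right br_scale_right span_add span_scale)
        qed
      qed
      have gens: "br ((D ^^ i) a) ((D ^^ l) b) \<in> S" if "a \<in> A k" "b \<in> A k" "i \<le> Suc n" "l \<le> Suc n" for a b i l
      proof (cases "i \<le> n \<or> l \<le> n")
        case True
        then show ?thesis using Suc that lie_ideal_UNIV_br[OF idS] by blast
      next
        case False
        then have il: "i = Suc n" "l = Suc n" using that by auto
        \<comment> \<open>In the expansion of \<open>D^(2n+2) [a, b]\<close>, which is in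
          \<open>S\<close> because \<open>[a, b]\<close> lies in \<open>T\<close>, every term but
          the middle one has an exponent at most \<open>n\<close> and lies in the ideal
          \<open>S\<close> by induction. So the middle term lies there too, and its binomial
          coefficient is nonzero in the field.\<close>
        let ?N = "2 * Suc n"
        let ?f = "\<lambda>i. sg (of_nat (?N choose i)) (br ((D ^^ i) a) ((D ^^ (?N - i)) b))"
        have "(\<Sum>i\<le>?N. ?f i) \<in> S"
          using leibniz[OF D, of ?N a b] TD[OF AA[OF that(1,2)], of ?N] by simp
        also have "(\<Sum>i\<le>?N. ?f i) = ?f (Suc n) + (\<Sum>i\<in>{..?N} - {Suc n}. ?f i)"
          by (rule sum.remove) auto
        finally have *: "?f (Suc n) + (\<Sum>i\<in>{..?N} - {Suc n}. ?f i) \<in> S" .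
        have "(\<Sum>i\<in>{..?N} - {Suc n}. ?f i) \<in> S"
        proof (intro subspace_sum[OF sS] subspace_scale[OF sS])
          fix m assume "m \<in> {..?N} - {Suc n}"
          then have "m \<le> n \<or> ?N - m \<le> n" by auto
          then show "br ((D ^^ m) a) ((D ^^ (?N - m)) b) \<in> S"
            using Suc that lie_ideal_UNIV_br[OF idS] by blast
        qed
        from subspace_diff[OF sS * this] have "?f (Suc n) \<in> S" by simp
        from subspace_scale[OF sS this, of "inverse (of_nat (?N choose Suc n))"]
        have "sg (inverse (of_nat (?N choose Suc n)) * of_nat (?N choose Suc n))
            (br ((D ^^ Suc n) a) ((D ^^ (?N - Suc n)) b)) \<in> S"
          by (simp only: scale_scale)
        moreover have "0 < ?N choose Suc n" by (rule zero_less_binomial) simp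
        then have "(of_nat (?N choose Suc n) :: 'k) \<noteq> 0" unfolding of_nat_eq_0_iff by linarith
        moreover have "?N - Suc n = Suc n" by simp
        ultimately show ?thesis by (simp only: left_inverse scale_one il not_False_eq_True)
      qed
      have JJ1: "br x ((D ^^ l) b) \<in> S" if "x \<in> J (Suc n)" "b \<in> A k" "l \<le> Suc n" for x b l
        using that(1) unfolding J_def
      proof (induction rule: span_induct_alt)
        case base
        then show ?case by (simp add: subspace_0[OF sS])
      next
        case (step c v y)
        then have "br v ((D ^^ l) b) \<in> S" using gens that by blast
        then show ?case using step(2)
          by (simp add: br_add_left br_scale_left subspace_add[OF sS] subspace_scale[OF sS])
      qed
      have JJ: "br x y \<in> S" if "x \<in> J (Suc n)" "y \<in> J (Suc n)" for x y
        using that(2) unfolding J_def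
      proof (induction rule: span_induct_alt)
        case base
        then show ?case by (simp add: subspace_0[OF sS])
      next
        case (step c v y)
        then have "br x v \<in> S" using JJ1 that(1) by blast
        then show ?case using step(2)
          by (simp add: br_add_right br_scale_right subspace_add[OF sS] subspace_scale[OF sS])
      qed
      \<comment> \<open>An ideal whose brackets lie in the solvable \<open>S\<close> is solvable,
        hence contained in the radical. It contains the next image of \<open>A k\<close>, which
        completes the induction.\<close>
      have "J (Suc n) \<subseteq> S"
        by (rule maxS[OF Jid lie_solvable_extension[OF subJ JJ sS solS]])
      then show ?case using inJ by blast
    qed
    then have "A k \<subseteq> T" unfolding T_def by blast
    with least[of k] k show False by simp
  qed
  then show ?thesis using TD[of _ 1] by auto
qed

text \<open>Up to sign, \<open>br (D u)\<close> is the commutator of \<open>br u\<close> with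
  \<open>D\<close>. On an irreducible subquotient of g under \<open>D\<close> and all
  \<open>br x\<close> with \<open>x\<close> in \<open>S\<close>, the operators from \<open>S\<close>
  act by scalars, and the scalar of such a commutator is 0. So \<open>br (D u)\<close> pushes each
  subquotient into the next lower one. A maximal invariant subspace on which some power of it
  vanishes must then be everything.\<close>

lemma ad_Der_nilpotent:
  assumes D: "D \<in> Der sg br" and S: "lie_ideal sg br S UNIV" "lie_solvable sg br S"
    and DS: "D ` S \<subseteq> S" and u: "u \<in> S"
  shows "\<exists>n. \<forall>y. (br (D u) ^^ n) y = 0"
proof -
  obtain F where F: "finite F" "span F = UNIV" using ex_finite_span by blast
  \<comment> \<open>The derivation joins the operators as an equal partner. Bracketing with it keeps
    each \<open>A i\<close> inside itself, since the derived series of a \<open>D\<close>-stable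
    ideal is \<open>D\<close>-stable.\<close>
  define L where "L = insert D (br ` S)"
  define P where "P U \<longleftrightarrow> subspace U \<and> (\<forall>f\<in>L. \<forall>u\<in>U. f u \<in> U) \<and> (\<exists>n. \<forall>y\<in>U. (br (D u) ^^ n) y = 0)" for U
  define A where "A i = br ` (derived_algebra sg br ^^ i) S" for i
  have linL: "Vector_Spaces.linear sg sg f" if "f \<in> L" for f
    using that linear_br Der_linear[OF D] by (auto simp: L_def)
  have AL: "A i \<subseteq> L" for i
    unfolding A_def L_def using derived_funpow_subset[OF S(1)] by blast
  have com_br: "commutator (br y) (br x) = br (br y x)" for x y
    by (auto simp: commutator_def br_br[of y x])
  have com_D: "commutator (br y) D = br (- D y)" for y
    by (auto simp: commutator_def Der_br[OF D] br_minus_left)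
  have subS: "subspace S" using S(1) by (simp add: lie_ideal_def)
  have brL: "commutator a f \<in> A i" if a: "a \<in> A i" and f: "f \<in> L" for a f i
  proof -
    obtain y where y: "y \<in> (derived_algebra sg br ^^ i) S" "a = br y" using a by (auto simp: A_def)
    show ?thesis
    proof (cases "f = D")
      case True
      have "- D y \<in> (derived_algebra sg br ^^ i) S"
        using derived_funpow_Der[OF D DS, of i] y(1)
        by (intro subspace_neg[OF subspace_derived_funpow[OF subS]]) blast
      then show ?thesis unfolding A_def True y(2) com_D by blast
    next
      case False
      then obtain x where "f = br x" using f by (auto simp: L_def)
      then show ?thesis
        unfolding A_def y(2) using br_derived_funpow(2)[OF S(1) y(1), of x] com_br by blast
    qed
  qed
  have AA: "commutator a b \<in> A (Suc i)" if "a \<in> A i" "b \<in> A i" for a b i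
    using that br_mem_derived unfolding A_def by (auto simp: com_br)
  have P0: "P {0}" using linear_0[OF linL] unfolding P_def by (auto intro!: exI[of _ 0])
  have Ps: "subspace U \<and> U \<subseteq> span F" if "P U" for U using that F(2) by (simp add: P_def)
  obtain U where U: "P U" and max: "\<And>U'. P U' \<Longrightarrow> U \<subseteq> U' \<Longrightarrow> U' = U"
    using ex_maximal_subspace[of P, OF P0 Ps F(1)] by blast
  have "U = UNIV"
  proof (rule ccontr)
    assume "U \<noteq> UNIV"
    define Q where "Q W \<longleftrightarrow> subspace W \<and> U \<subset> W \<and> (\<forall>f\<in>L. \<forall>u\<in>W. f u \<in> W)" for W
    have Q1: "Q UNIV" using \<open>U \<noteq> UNIV\<close> by (auto simp: Q_def)
    have Qs: "subspace W \<and> W \<subseteq> span F" if "Q W" for W using that F(2) by (simp add: Q_def)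
    obtain W where W: "Q W" and min: "\<And>W'. Q W' \<Longrightarrow> W' \<subseteq> W \<Longrightarrow> W' = W"
      using ex_minimal_subspace[of Q, OF Q1 Qs F(1)] by blast
    have sW: "subspace W" and UW: "U \<subset> W" and LW: "\<And>f w. f \<in> L \<Longrightarrow> w \<in> W \<Longrightarrow> f w \<in> W"
      using W by (auto simp: Q_def)
    have sU: "subspace U" and LU: "\<And>f w. f \<in> L \<Longrightarrow> w \<in> U \<Longrightarrow> f w \<in> U"
      using U by (auto simp: P_def)
    \<comment> \<open>The operators serve as their own labels, so the representation is
      \<open>id\<close> and the bracket is the commutator. Irreducibility of \<open>W / U\<close>
      comes from the minimality of \<open>W\<close>.\<close>
    interpret R: rep_subquotient sg U W F L id commutator
    proof (unfold_locales, goal_cases)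
      case (6 x)
      then show ?case using LW by (auto intro!: linear_imp_endo_on linL)
    qed (use sW sU UW F LU in \<open>auto simp: commutator_def\<close>)
    obtain m where m: "(derived_algebra sg br ^^ m) S = {0}" using S(2) by (auto simp: lie_solvable_def)
    have Am: "id a w \<in> U" if "a \<in> A m" for a w using that by (simp add: A_def m subspace_0[OF sU])
    have irr: "M = W" if "subspace M" "U \<subset> M" "M \<subseteq> W" "\<And>x m. x \<in> L \<Longrightarrow> m \<in> M \<Longrightarrow> id x m \<in> M" for M
      using that by (intro min) (auto simp: Q_def)
    obtain \<nu> where \<nu>: "\<And>a w. a \<in> A 0 \<Longrightarrow> w \<in> W \<Longrightarrow> id a w - sg (\<nu> a) w \<in> U"
      and van: "\<And>a x. a \<in> A 0 \<Longrightarrow> x \<in> L \<Longrightarrow> \<nu> (commutator a x) = 0"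
      using R.solvable_acts_by_scalars[of A m, OF _ irr AL brL AA Am] UW by blast
    have uA: "br u \<in> A 0" using u by (simp add: A_def)
    have DL: "D \<in> L" by (simp add: L_def)
    have "br (D u) w \<in> U" if "w \<in> W" for w
    proof -
      have "br (- D u) w \<in> U"
        using \<nu>[OF brL[OF uA DL] that] van[OF uA DL] by (simp add: com_D)
      then show ?thesis using subspace_neg[OF sU, of "br (- D u) w"] by (simp add: br_minus_left)
    qed
    moreover obtain n where n: "\<And>y. y \<in> U \<Longrightarrow> (br (D u) ^^ n) y = 0" using U by (auto simp: P_def)
    ultimately have "\<forall>y\<in>W. (br (D u) ^^ Suc n) y = 0" by (auto simp: funpow_Suc_right simp del: funpow.simps)
    then have "P W" using sW LW by (auto simp: P_def simp del: funpow.simps)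
    then have "W = U" using UW by (intro max) auto
    with UW show False by simp
  qed
  with U show ?thesis by (simp add: P_def)
qed

text \<open>Lie's theorem for an irreducible module: the scalar lemma with lower space
  \<open>{0}\<close>, upper space \<open>V\<close> and the derived series of \<open>S\<close> as
  chain of ideals.\<close>

lemma irreducible_rep_solvable_ideal:
  assumes "vector_space sv" and irr: "irreducible_rep sg br sv V \<pi>"
    and S: "lie_ideal sg br S UNIV" "lie_solvable sg br S"
  shows "\<exists>\<nu>. \<forall>u\<in>S. \<forall>v\<in>V. \<pi> u v = sv (\<nu> u) v"
proof -
  interpret V: alg_closed_vector_space sv using assms(1) by (rule alg_closed_vector_space.intro)
  have sV: "V.subspace V" and V0: "V \<noteq> {0}" and act: "lie_action sg br UNIV sv V \<pi>"
    and irred: "\<And>U. V.subspace U \<Longrightarrow> U \<subseteq> V \<Longrightarrow> (\<And>x u. u \<in> U \<Longrightarrow> \<pi> x u \<in> U) \<Longrightarrow> U = {0} \<or> U = V"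
    using irr by (auto simp: irreducible_rep_def)
  obtain F where F: "finite F" "V.span F = V" using irr by (auto simp: irreducible_rep_def finite_dim_def)
  have endo: "V.endo_on V (\<pi> x)" for x using act by (auto simp: lie_action_def V.endo_on_def)
  have brk: "\<pi> (br x y) w = \<pi> x (\<pi> y w) - \<pi> y (\<pi> x w)" if "w \<in> V" for x y w
    using act that by (simp add: lie_action_def eq_diff_eq)
  interpret R: rep_subquotient sv "{0}" V F UNIV \<pi> br
  proof (unfold_locales, goal_cases)
    case (7 x u)
    then show ?case using V.endo_on_0[OF endo sV] by simp
  qed (use sV V.subspace_0 F endo brk in auto)
  define A where "A i = (derived_algebra sg br ^^ i) S" for i
  obtain m where m: "A m = {0}" using S(2) by (auto simp: lie_solvable_def A_def)
  have "\<pi> 0 w = 0" if "w \<in> V" for w using brk[OF that, of 0 0] by simp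
  then have Am: "\<pi> a w \<in> {0}" if "a \<in> A m" "w \<in> V" for a w using that by (simp add: m)
  have "\<exists>\<nu>. (\<forall>a\<in>A 0. \<forall>w\<in>V. \<pi> a w - sv (\<nu> a) w \<in> {0}) \<and> (\<forall>a\<in>A 0. \<forall>x\<in>UNIV. \<nu> (br a x) = 0)"
  proof (rule R.solvable_acts_by_scalars[of A m, OF _ _ _ _ _ Am])
    show "M = V" if "V.subspace M" "{0} \<subset> M" "M \<subseteq> V" "\<And>x m. x \<in> UNIV \<Longrightarrow> m \<in> M \<Longrightarrow> \<pi> x m \<in> M" for M
      using irred[OF that(1,3)] that(2,4) by auto
    show "br a x \<in> A i" if "a \<in> A i" for a x i
      using br_derived_funpow(2)[OF S(1)] that by (simp add: A_def)
    show "br a b \<in> A (Suc i)" if "a \<in> A i" "b \<in> A i" for a b i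
      using br_mem_derived[OF that[unfolded A_def]] by (simp add: A_def)
  qed (use V0 in auto)
  then show ?thesis unfolding A_def by (simp, blast)
qed

end

section \<open>Traces and triangular bases\<close>

context alg_closed_vector_space
begin

section \<open>Coordinates and traces on a subspace\<close>

lemma linear_mem_span:
  assumes "Vector_Spaces.linear scale scale T" "T ` B \<subseteq> span C" "x \<in> span B"
  shows "T x \<in> span C"
proof -
  interpret T: Vector_Spaces.linear scale scale T by fact
  have "span (T ` B) \<subseteq> span C" using assms(2) by (rule span_minimal) simp
  then show ?thesis using assms(3) T.span_image[of B] by blast
qed

lemma representation_linear:
  assumes T: "Vector_Spaces.linear scale scale T" and B: "independent B" "finite B"
    and C: "independent C" and TB: "T ` B \<subseteq> span C" and x: "x \<in> span B"
  shows "representation C (T x) c = (\<Sum>b\<in>B. representation B x b * representation C (T b) c)"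
proof -
  interpret T: Vector_Spaces.linear scale scale T by fact
  have mem: "T b \<in> span C" if "b \<in> B" for b using TB that by blast
  have "T x = T (\<Sum>b\<in>B. representation B x b *s b)"
    using sum_representation_eq[OF B(1) x B(2)] by simp
  also have "\<dots> = (\<Sum>b\<in>B. representation B x b *s T b)" by (simp add: T.sum T.scale)
  finally show ?thesis
    using mem by (simp add: representation_sum[OF C] representation_scale[OF C] span_scale)
qed

lemma representation_subset_eq_0:
  assumes "independent B" "B' \<subseteq> B" "x \<in> span B'" "b \<notin> B'"
  shows "representation B x b = 0"
  using representation_extend[OF assms(1,3,2)] representation_ne_zero[of B' x b] assms(4) by metis

definition trace_on :: "'b set \<Rightarrow> ('b \<Rightarrow> 'b) \<Rightarrow> 'a" where
  "trace_on B T = (\<Sum>b\<in>B. representation B (T b) b)"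

lemma trace_on_cong: "(\<And>b. b \<in> B \<Longrightarrow> S b = T b) \<Longrightarrow> trace_on B S = trace_on B T"
  by (simp add: trace_on_def)

lemma trace_on_add:
  assumes "independent B" "S ` B \<subseteq> span B" "T ` B \<subseteq> span B"
  shows "trace_on B (\<lambda>x. S x + T x) = trace_on B S + trace_on B T"
  using assms by (simp add: trace_on_def representation_add image_subset_iff sum.distrib)

lemma trace_on_diff:
  assumes "independent B" "S ` B \<subseteq> span B" "T ` B \<subseteq> span B"
  shows "trace_on B (\<lambda>x. S x - T x) = trace_on B S - trace_on B T"
  using assms by (simp add: trace_on_def representation_diff image_subset_iff sum_subtractf)

lemma trace_on_scale:
  assumes "independent B" "S ` B \<subseteq> span B"
  shows "trace_on B (\<lambda>x. c *s S x) = c * trace_on B S"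
  using assms by (simp add: trace_on_def representation_scale image_subset_iff sum_distrib_left)

lemma trace_on_commute:
  assumes S: "Vector_Spaces.linear scale scale S" and T: "Vector_Spaces.linear scale scale T"
    and B: "independent B" "finite B" and SB: "S ` B \<subseteq> span B" and TB: "T ` B \<subseteq> span B"
  shows "trace_on B (\<lambda>x. S (T x)) = trace_on B (\<lambda>x. T (S x))"
proof -
  have "trace_on B (\<lambda>x. S (T x))
      = (\<Sum>b\<in>B. \<Sum>c\<in>B. representation B (T b) c * representation B (S c) b)"
    unfolding trace_on_def using TB
    by (intro sum.cong refl representation_linear[OF S B B(1) SB]) auto
  also have "\<dots> = (\<Sum>c\<in>B. \<Sum>b\<in>B. representation B (S c) b * representation B (T b) c)"
    by (subst sum.swap) (simp add: mult.commute)
  also have "\<dots> = trace_on B (\<lambda>x. T (S x))"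
    unfolding trace_on_def using SB
    by (intro sum.cong refl representation_linear[OF T B B(1) TB, symmetric]) auto
  finally show ?thesis .
qed

text \<open>This is \<open>tr (P Q) = tr (Q P)\<close> for two matrices: the coordinates of the
  vectors of \<open>B\<close> in \<open>C\<close>, and the coordinates of the images of the vectors
  of \<open>C\<close> in \<open>B\<close>.\<close>

lemma trace_on_basis_change:
  assumes S: "Vector_Spaces.linear scale scale S" and B: "independent B" "finite B"
    and C: "independent C" "finite C" and BC: "span B = span C" and SB: "S ` B \<subseteq> span B"
  shows "trace_on B S = trace_on C S"
proof -
  have Ssp: "S x \<in> span B" if "x \<in> span B" for x by (rule linear_mem_span[OF S SB that])
  have SC: "S ` C \<subseteq> span B" using Ssp BC span_superset[of C] by blast
  have "Vector_Spaces.linear scale scale (\<lambda>x. x)"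
    by (simp add: Vector_Spaces.linear_iff vector_space_axioms)
  note rep_id = representation_linear[OF this B C(1)]
  have "trace_on B S = (\<Sum>b\<in>B. \<Sum>c\<in>C. representation C b c * representation B (S c) b)"
    unfolding trace_on_def
    by (intro sum.cong refl representation_linear[OF S C B(1) SC]) (metis BC span_base)
  also have "\<dots> = (\<Sum>c\<in>C. \<Sum>b\<in>B. representation B (S c) b * representation C b c)"
    by (subst sum.swap) (simp add: mult.commute)
  also have "\<dots> = trace_on C S"
    unfolding trace_on_def using SC span_superset[of B] BC
    by (intro sum.cong refl rep_id[symmetric]) auto
  finally show ?thesis .
qed

lemma linear_inj_on_surj:
  assumes T: "Vector_Spaces.linear scale scale T" and B: "independent B" "finite B"
    and TB: "T ` B \<subseteq> span B" and inj: "\<And>x. x \<in> span B \<Longrightarrow> T x = 0 \<Longrightarrow> x = 0"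
  shows "T ` span B = span B"
proof (rule ccontr)
  assume neq: "T ` span B \<noteq> span B"
  interpret T: Vector_Spaces.linear scale scale T by fact
  have inj': "inj_on T (span B)"
  proof (rule inj_onI)
    fix x y assume "x \<in> span B" "y \<in> span B" "T x = T y"
    then show "x = y" using inj[of "x - y"] by (simp add: span_diff T.diff)
  qed
  have TspB: "T ` span B = span (T ` B)" by (rule T.span_image[symmetric])
  have "span (T ` B) \<subset> span B" using span_minimal[OF TB] neq TspB by auto
  then have "dim (span (T ` B)) < dim (span B)"
    by (intro dim_strict_mono[of _ _ B]) (use B in auto)
  moreover have "independent (T ` B)"
    by (rule T.independent_injective_image[OF B(1) inj'])
  ultimately have "card (T ` B) < card B"
    using B(1) by (simp add: dim_eq_card_independent)
  moreover have "inj_on T B" using inj' span_superset by (rule inj_on_subset)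
  ultimately show False by (simp add: card_image)
qed

text \<open>An upper triangular form that is also block diagonal by eigenvalue:
  \<open>\<mu> b\<close> is the diagonal entry, and the rank \<open>r b\<close> takes the place of
  an ordering of the basis. It gives the generalized eigenspaces without a Jordan normal
  form.\<close>

definition triangular_basis :: "('b \<Rightarrow> 'b) \<Rightarrow> 'b set \<Rightarrow> ('b \<Rightarrow> 'a) \<Rightarrow> ('b \<Rightarrow> nat) \<Rightarrow> bool" where
  "triangular_basis T B \<mu> r \<longleftrightarrow> finite B \<and> independent B \<and>
     (\<forall>b\<in>B. T b - \<mu> b *s b \<in> span {c \<in> B. \<mu> c = \<mu> b \<and> r c < r b})"

lemma linear_shift:
  assumes "Vector_Spaces.linear scale scale T"
  shows "Vector_Spaces.linear scale scale (\<lambda>v. T v - a *s v)"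
  using assms by (simp add: Vector_Spaces.linear_iff vector_space_axioms algebra_simps)

text \<open>Off the block of \<open>a\<close> the shifted operator has nonzero diagonal entries. By
  induction on the rank, each such \<open>b\<close> is reached because \<open>(T - a) b\<close> and
  \<open>(T - \<mu> b) b\<close> differ by \<open>(\<mu> b - a) b\<close>.\<close>

lemma triangular_shift_surj:
  assumes T: "Vector_Spaces.linear scale scale T" and tri: "triangular_basis T B \<mu> r"
    and u: "u \<in> span {b \<in> B. \<mu> b \<noteq> a}"
  shows "\<exists>v\<in>span {b \<in> B. \<mu> b \<noteq> a}. T v - a *s v = u"
proof -
  interpret S: Vector_Spaces.linear scale scale "\<lambda>v. T v - a *s v" using linear_shift[OF T] .
  let ?M = "{b \<in> B. \<mu> b \<noteq> a}"
  let ?R = "(\<lambda>v. T v - a *s v) ` span ?M"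
  have sR: "subspace ?R" by (rule S.subspace_image) simp
  have "b \<in> ?M \<longrightarrow> b \<in> ?R" for b
  proof (induction b rule: measure_induct_rule[of r])
    case (less b)
    show ?case
    proof
      assume b: "b \<in> ?M"
      have "span {c \<in> B. \<mu> c = \<mu> b \<and> r c < r b} \<subseteq> ?R"
        using less b by (intro span_minimal sR) auto
      then have "T b - \<mu> b *s b \<in> ?R" using tri b by (auto simp: triangular_basis_def)
      moreover have "T b - a *s b \<in> ?R" using b span_base[of b ?M] by blast
      ultimately have "(T b - a *s b) - (T b - \<mu> b *s b) \<in> ?R" using subspace_diff[OF sR] by blast
      then have "(\<mu> b - a) *s b \<in> ?R" by (simp add: algebra_simps)
      then have "inverse (\<mu> b - a) *s (\<mu> b - a) *s b \<in> ?R" by (rule subspace_scale[OF sR])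
      moreover have "\<mu> b - a \<noteq> 0" using b by simp
      ultimately show "b \<in> ?R" unfolding scale_scale by (simp only: left_inverse scale_one not_False_eq_True)
    qed
  qed
  then have "span ?M \<subseteq> ?R" by (intro span_minimal sR) blast
  then show ?thesis using u by blast
qed

text \<open>Look at a basis vector \<open>b\<close> of highest rank in the support of
  \<open>v\<close>. Triangular remainders cannot reach it, so \<open>T v - a v\<close> has the
  coefficient of \<open>v\<close> at \<open>b\<close> times \<open>\<mu> b - a\<close> there, which
  is nonzero although \<open>b\<close> lies off the block of \<open>a\<close>.\<close>

lemma triangular_shift_inj:
  assumes T: "Vector_Spaces.linear scale scale T" and tri: "triangular_basis T B \<mu> r"
    and v: "v \<in> span {b \<in> B. \<mu> b \<noteq> a}" and Tv: "T v - a *s v \<in> span {b \<in> B. \<mu> b = a}"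
  shows "v = 0"
proof (rule ccontr)
  assume "v \<noteq> 0"
  let ?M = "{b \<in> B. \<mu> b \<noteq> a}"
  have B: "independent B" "finite B" using tri by (auto simp: triangular_basis_def)
  have vB: "v \<in> span B" using v span_mono[of ?M B] by auto
  define K where "K = {b \<in> B. representation B v b \<noteq> 0}"
  have "K \<noteq> {}"
  proof
    assume "K = {}"
    then have "(\<Sum>b\<in>B. representation B v b *s b) = 0" by (intro sum.neutral) (auto simp: K_def)
    then show False using sum_representation_eq[OF B(1) vB B(2)] \<open>v \<noteq> 0\<close> by simp
  qed
  moreover have "finite K" using B by (simp add: K_def)
  ultimately obtain b where b: "b \<in> K" and max: "\<And>c. c \<in> K \<Longrightarrow> r c \<le> r b"
    using Max_in[of "r ` K"] Max_ge[of "r ` K"] by fastforce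
  have bB: "b \<in> B" and vb: "representation B v b \<noteq> 0" using b by (auto simp: K_def)
  have ba: "\<mu> b \<noteq> a" using representation_subset_eq_0[OF B(1) _ v, of b] vb bB by auto
  have low: "T c - \<mu> c *s c \<in> span {d \<in> B. \<mu> d = \<mu> c \<and> r d < r c}" if "c \<in> B" for c
    using tri that by (auto simp: triangular_basis_def)
  have lowB: "T c - \<mu> c *s c \<in> span B" if "c \<in> B" for c
    using low[OF that] span_mono[of "{d \<in> B. \<mu> d = \<mu> c \<and> r d < r c}" B] by auto
  have shift: "T c - a *s c = (T c - \<mu> c *s c) + (\<mu> c - a) *s c" for c by (simp add: algebra_simps)
  have img: "(\<lambda>c. T c - a *s c) ` B \<subseteq> span B"
    unfolding shift image_subset_iff by (intro ballI span_add[OF lowB] span_scale span_base)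
  have rep: "representation B (T c - a *s c) b = (if c = b then \<mu> b - a else 0)" if c: "c \<in> K" for c
  proof -
    have cB: "c \<in> B" using c by (simp add: K_def)
    have "representation B (T c - \<mu> c *s c) b = 0"
      using max[OF c] by (intro representation_subset_eq_0[OF B(1) _ low[OF cB]]) auto
    then show ?thesis
      unfolding shift using B(1) cB lowB[OF cB]
      by (simp add: representation_add representation_scale representation_basis span_scale span_base)
  qed
  have "representation B (T v - a *s v) b
      = (\<Sum>c\<in>B. representation B v c * representation B (T c - a *s c) b)"
    by (rule representation_linear[OF linear_shift[OF T] B B(1) img vB])
  also have "\<dots> = (\<Sum>c\<in>K. representation B v c * representation B (T c - a *s c) b)"
    using B(2) by (intro sum.mono_neutral_right) (auto simp: K_def)
  also have "\<dots> = (\<Sum>c\<in>K. if c = b then representation B v b * (\<mu> b - a) else 0)"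
    by (intro sum.cong) (auto simp: rep)
  also have "\<dots> = representation B v b * (\<mu> b - a)" using b \<open>finite K\<close> by simp
  finally have "representation B (T v - a *s v) b \<noteq> 0" using vb ba by simp
  moreover have "representation B (T v - a *s v) b = 0"
    by (rule representation_subset_eq_0[OF B(1) _ Tv]) (use ba in auto)
  ultimately show False by simp
qed

lemma triangular_split:
  assumes "x \<in> span B"
  shows "\<exists>p\<in>span {b \<in> B. \<mu> b = a}. \<exists>q\<in>span {b \<in> B. \<mu> b \<noteq> a}. x = p + q"
proof -
  have "B = {b \<in> B. \<mu> b = a} \<union> {b \<in> B. \<mu> b \<noteq> a}" by blast
  then have "x \<in> span ({b \<in> B. \<mu> b = a} \<union> {b \<in> B. \<mu> b \<noteq> a})" using assms by simp
  then show ?thesis unfolding span_Un by blast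
qed

lemma triangular_span_invariant:
  assumes T: "Vector_Spaces.linear scale scale T" and tri: "triangular_basis T B \<mu> r"
    and u: "u \<in> span B"
  shows "T u \<in> span B"
proof (rule linear_mem_span[OF T _ u])
  have "T b \<in> span B" if b: "b \<in> B" for b
  proof -
    have "T b - \<mu> b *s b \<in> span B"
      using tri b span_mono[of "{c \<in> B. \<mu> c = \<mu> b \<and> r c < r b}" B] by (auto simp: triangular_basis_def)
    from span_add[OF this span_scale[OF span_base[OF b], of "\<mu> b"]] show ?thesis by simp
  qed
  then show "T ` B \<subseteq> span B" by blast
qed

text \<open>A triangular basis of maximal size must span. Otherwise there is an eigenvector
  \<open>w\<close> modulo its span, and \<open>(T - a) w\<close> splits into a part in the block of
  \<open>a\<close> and a rest. The rest has a preimage \<open>v\<close> under \<open>T - a\<close>,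
  and \<open>w - v\<close> extends the basis inside the block of \<open>a\<close>.\<close>

lemma triangular_basis_exists:
  assumes T: "Vector_Spaces.linear scale scale T" and W: "subspace W" "W \<subseteq> span F" "finite F"
    and TW: "T ` W \<subseteq> W"
  shows "\<exists>B \<mu> r. triangular_basis T B \<mu> r \<and> span B = W"
proof -
  interpret T: Vector_Spaces.linear scale scale T by fact
  define P where "P = (\<lambda>(B, \<mu>, r). triangular_basis T B \<mu> r \<and> B \<subseteq> W)"
  have P0: "P ({}, \<lambda>_. 0, \<lambda>_. 0)" by (simp add: P_def triangular_basis_def independent_empty)
  have bound: "card (fst x) \<le> card F" if "P x" for x
    using that independent_span_bound[OF W(3), of "fst x"] W(2)
    by (auto simp: P_def triangular_basis_def)
  have "\<exists>x. P x \<and> (\<forall>y. P y \<longrightarrow> card (fst y) \<le> card (fst x))"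
    by (rule ex_has_greatest_nat[where P = P and b = "Suc (card F)", OF P0]) (simp add: bound less_Suc_eq_le)
  then obtain x where x: "P x" "\<And>y. P y \<Longrightarrow> card (fst y) \<le> card (fst x)"
    by blast
  obtain B \<mu> r where "x = (B, \<mu>, r)" by (cases x)
  then have tri: "triangular_basis T B \<mu> r" and BW: "B \<subseteq> W"
    and max: "\<And>B' \<mu>' r'. triangular_basis T B' \<mu>' r' \<Longrightarrow> B' \<subseteq> W \<Longrightarrow> card B' \<le> card B"
    using x by (auto simp: P_def)
  have B: "independent B" "finite B" using tri by (auto simp: triangular_basis_def)
  have "span B = W"
  proof (rule ccontr)
    assume neq: "span B \<noteq> W"
    have spW: "span B \<subset> W" using span_minimal[OF BW W(1)] neq by blast
    obtain w a where w: "w \<in> W" "w \<notin> span B" "T w - a *s w \<in> span B"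
      using eigenvector_mod[OF linear_imp_endo_on[OF T TW] W subspace_span spW] by blast
    obtain p q where p: "p \<in> span {b \<in> B. \<mu> b = a}" and q: "q \<in> span {b \<in> B. \<mu> b \<noteq> a}"
      and pq: "T w - a *s w = p + q" using triangular_split[OF w(3), of \<mu> a] by blast
    obtain v where v: "v \<in> span {b \<in> B. \<mu> b \<noteq> a}" "T v - a *s v = q"
      using triangular_shift_surj[OF T tri q] by blast
    have vB: "v \<in> span B" using v(1) span_mono[of "{b \<in> B. \<mu> b \<noteq> a}" B] by blast
    define w' where "w' = w - v"
    have w'W: "w' \<in> W" using w(1) vB spW by (auto simp: w'_def intro: subspace_diff[OF W(1)])
    have w'B: "w' \<notin> span B" using w(2) span_add[OF _ vB, of w'] by (auto simp: w'_def)
    have Tw': "T w' - a *s w' = p" using pq v(2) by (simp add: w'_def T.diff algebra_simps)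
    have w'nB: "w' \<notin> B" using w'B span_base by blast
    define \<mu>' where "\<mu>' = \<mu>(w' := a)"
    \<comment> \<open>Any number above all ranks in \<open>B\<close> would do; one more than their
      sum is such a number.\<close>
    define r' where "r' = r(w' := Suc (sum r B))"
    have rB: "r b < Suc (sum r B)" if "b \<in> B" for b using B(2) that by (simp add: member_le_sum less_Suc_eq_le)
    have "triangular_basis T (insert w' B) \<mu>' r'"
      unfolding triangular_basis_def
    proof (intro conjI ballI)
      show "finite (insert w' B)" using B by simp
      show "independent (insert w' B)" by (rule independent_insertI[OF w'B B(1)])
      fix b assume b: "b \<in> insert w' B"
      show "T b - \<mu>' b *s b \<in> span {c \<in> insert w' B. \<mu>' c = \<mu>' b \<and> r' c < r' b}"
      proof (cases "b = w'")
        case True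
        have sub: "{b \<in> B. \<mu> b = a} \<subseteq> {c \<in> insert w' B. \<mu>' c = \<mu>' b \<and> r' c < r' b}"
          using True w'nB rB by (auto simp: \<mu>'_def r'_def)
        have eq: "T b - \<mu>' b *s b = p" using Tw' True by (simp add: \<mu>'_def)
        show ?thesis unfolding eq by (rule subsetD[OF span_mono[OF sub] p])
      next
        case False
        have sub: "{c \<in> B. \<mu> c = \<mu> b \<and> r c < r b} \<subseteq> {c \<in> insert w' B. \<mu>' c = \<mu>' b \<and> r' c < r' b}"
          using False w'nB by (auto simp: \<mu>'_def r'_def)
        have eq: "T b - \<mu>' b *s b = T b - \<mu> b *s b" using False by (simp add: \<mu>'_def)
        have "T b - \<mu> b *s b \<in> span {c \<in> B. \<mu> c = \<mu> b \<and> r c < r b}"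
          using tri False b by (simp add: triangular_basis_def)
        from subsetD[OF span_mono[OF sub] this] show ?thesis unfolding eq .
      qed
    qed
    then have "card (insert w' B) \<le> card B" by (rule max) (use BW w'W in auto)
    then show False using w'nB B(2) by simp
  qed
  with tri show ?thesis by blast
qed

section \<open>Generalized eigenspaces\<close>

definition generalized_eigenspace :: "('b \<Rightarrow> 'b) \<Rightarrow> 'a \<Rightarrow> 'b set" where
  "generalized_eigenspace T a = {v. \<exists>n. ((\<lambda>v. T v - a *s v) ^^ n) v = 0}"

lemma generalized_eigenspace_step:
  assumes "T v - a *s v \<in> generalized_eigenspace T a"
  shows "v \<in> generalized_eigenspace T a"
proof -
  obtain n where "((\<lambda>v. T v - a *s v) ^^ n) (T v - a *s v) = 0"
    using assms by (auto simp: generalized_eigenspace_def)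
  then have "((\<lambda>v. T v - a *s v) ^^ Suc n) v = 0" by (simp add: funpow_Suc_right del: funpow.simps)
  then show ?thesis unfolding generalized_eigenspace_def by blast
qed

lemma linear_funpow:
  assumes "Vector_Spaces.linear scale scale T"
  shows "Vector_Spaces.linear scale scale (T ^^ n)"
proof (induction n)
  case 0
  then show ?case by (simp add: Vector_Spaces.linear_iff vector_space_axioms)
next
  case (Suc n)
  with assms show ?case by (simp add: Vector_Spaces.linear_iff vector_space_axioms)
qed

lemma subspace_generalized_eigenspace:
  assumes T: "Vector_Spaces.linear scale scale T"
  shows "subspace (generalized_eigenspace T a)"
proof -
  define S where "S = (\<lambda>v. T v - a *s v)"
  have lin: "Vector_Spaces.linear scale scale (S ^^ n)" for n
    unfolding S_def by (rule linear_funpow[OF linear_shift[OF T]])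
  have add: "(S ^^ n) (x + y) = (S ^^ n) x + (S ^^ n) y" and sc: "(S ^^ n) (c *s x) = c *s (S ^^ n) x" for n x y c
    using lin by (auto simp: Vector_Spaces.linear_iff)
  have z: "(S ^^ n) 0 = 0" for n using sc[of n 0 0] by simp
  have up: "(S ^^ (m + n)) x = 0" if "(S ^^ n) x = 0" for m n x using that z by (simp add: funpow_add)
  have "\<exists>n. (S ^^ n) (x + y) = 0" if "(S ^^ n) x = 0" "(S ^^ m) y = 0" for x y n m
    using up[OF that(1), of m] up[OF that(2), of n] by (auto simp: add add.commute intro!: exI[of _ "m + n"])
  moreover have "\<exists>n. (S ^^ n) (c *s x) = 0" if "(S ^^ n) x = 0" for x c n
    using that by (auto simp: sc)
  ultimately show ?thesis
    unfolding generalized_eigenspace_def S_def[symmetric] using z by (intro subspaceI) auto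
qed

lemma triangular_span_subset_generalized_eigenspace:
  assumes T: "Vector_Spaces.linear scale scale T" and tri: "triangular_basis T B \<mu> r"
  shows "span {b \<in> B. \<mu> b = a} \<subseteq> generalized_eigenspace T a"
proof -
  have "b \<in> B \<and> \<mu> b = a \<longrightarrow> b \<in> generalized_eigenspace T a" for b
  proof (induction b rule: measure_induct_rule[of r])
    case (less b)
    show ?case
    proof
      assume b: "b \<in> B \<and> \<mu> b = a"
      have low: "span {c \<in> B. \<mu> c = \<mu> b \<and> r c < r b} \<subseteq> generalized_eigenspace T a"
        using less b by (intro span_minimal subspace_generalized_eigenspace[OF T]) auto
      have "T b - a *s b \<in> span {c \<in> B. \<mu> c = \<mu> b \<and> r c < r b}"
        using tri b by (auto simp: triangular_basis_def)
      from subsetD[OF low this] show "b \<in> generalized_eigenspace T a"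
        by (rule generalized_eigenspace_step)
    qed
  qed
  then show ?thesis by (intro span_minimal subspace_generalized_eigenspace[OF T]) blast
qed

text \<open>Induction on the exponent puts \<open>(T - a) w\<close> into the block of
  \<open>a\<close>. The component \<open>q\<close> of \<open>w\<close> in the other blocks is then
  also mapped into that block, and \<open>triangular_shift_inj\<close> makes it 0.\<close>

lemma generalized_eigenspace_subset_triangular_span:
  assumes T: "Vector_Spaces.linear scale scale T" and tri: "triangular_basis T B \<mu> r"
    and w: "w \<in> span B" "w \<in> generalized_eigenspace T a"
  shows "w \<in> span {b \<in> B. \<mu> b = a}"
proof -
  interpret T: Vector_Spaces.linear scale scale T by fact
  obtain n where "((\<lambda>v. T v - a *s v) ^^ n) w = 0" using w(2) by (auto simp: generalized_eigenspace_def)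
  then show ?thesis using w(1)
  proof (induction n arbitrary: w)
    case 0
    then show ?case by (simp add: span_zero)
  next
    case (Suc n)
    let ?G = "span {b \<in> B. \<mu> b = a}"
    let ?N = "span {b \<in> B. \<mu> b \<noteq> a}"
    have TB: "T w - a *s w \<in> span B"
      using triangular_span_invariant[OF T tri Suc.prems(2)] Suc.prems(2) by (intro span_diff span_scale)
    have "((\<lambda>v. T v - a *s v) ^^ n) (T w - a *s w) = 0"
      using Suc.prems(1) by (simp add: funpow_Suc_right del: funpow.simps)
    then have TwG: "T w - a *s w \<in> ?G" using Suc.IH TB by blast
    obtain p q where p: "p \<in> ?G" and q: "q \<in> ?N" and w: "w = p + q"
      using triangular_split[OF Suc.prems(2), of \<mu> a] by blast
    \<comment> \<open>A single block is again a triangular basis, hence its span is invariant under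
      \<open>T\<close>.\<close>
    have sub: "triangular_basis T {b \<in> B. \<mu> b = a} \<mu> r"
      unfolding triangular_basis_def
    proof (intro conjI ballI)
      show "finite {b \<in> B. \<mu> b = a}" using tri by (simp add: triangular_basis_def)
      show "independent {b \<in> B. \<mu> b = a}"
        using tri independent_mono[of B] by (simp add: triangular_basis_def)
      fix b assume b: "b \<in> {b \<in> B. \<mu> b = a}"
      then have eq: "{c \<in> {b \<in> B. \<mu> b = a}. \<mu> c = \<mu> b \<and> r c < r b} = {c \<in> B. \<mu> c = \<mu> b \<and> r c < r b}"
        by auto
      show "T b - \<mu> b *s b \<in> span {c \<in> {b \<in> B. \<mu> b = a}. \<mu> c = \<mu> b \<and> r c < r b}"
        unfolding eq using tri b unfolding triangular_basis_def by blast
    qed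
    have "T p - a *s p \<in> ?G"
      using triangular_span_invariant[OF T sub p] p by (intro span_diff span_scale)
    then have "(T w - a *s w) - (T p - a *s p) \<in> ?G" by (rule span_diff[OF TwG])
    then have "T q - a *s q \<in> ?G" by (simp add: w T.add algebra_simps)
    then have "q = 0" by (rule triangular_shift_inj[OF T tri q])
    then show ?case using p w by simp
  qed
qed

end

text \<open>View the field as a rational vector space and extend the nonzero \<open>a\<close> to a
  basis. Rational values are wanted because a sum of squares there vanishes only termwise, whereas
  an algebraically closed field has no such positivity.\<close>

lemma ex_rat_functional:
  fixes a :: "'k::field_char_0"
  assumes "a \<noteq> 0"
  shows "\<exists>g :: 'k \<Rightarrow> rat. (\<forall>x y. g (x + y) = g x + g y) \<and> (\<forall>q x. g (of_rat q * x) = q * g x) \<and> g a = 1"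
proof -
  interpret K: vector_space "\<lambda>(q::rat) (x::'k). of_rat q * x"
    by unfold_locales (simp_all add: algebra_simps of_rat_add of_rat_mult)
  interpret Q: vector_space "(*) :: rat \<Rightarrow> rat \<Rightarrow> rat"
    by unfold_locales (simp_all add: algebra_simps)
  interpret KQ: vector_space_pair "\<lambda>(q::rat) (x::'k). of_rat q * x" "(*) :: rat \<Rightarrow> rat \<Rightarrow> rat"
    by unfold_locales
  have "K.independent {a}" using assms by simp
  then obtain g where g: "Vector_Spaces.linear (\<lambda>(q::rat) (x::'k). of_rat q * x) (*) g" "g a = 1"
    using KQ.linear_independent_extend[of "{a}" "\<lambda>_. 1"] by auto
  then show ?thesis by (auto simp: Vector_Spaces.linear_iff)
qed

section \<open>Derivations of semisimple Lie algebras\<close>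

context fin_dim_lie_algebra
begin

text \<open>Since \<open>(D - a - b) [u, v] = [(D - a) u, v] + [u, (D - b) v]\<close>, induction on
  the sum of the two exponents applies.\<close>

lemma br_generalized_eigenspace:
  assumes D: "D \<in> Der sg br"
    and "u \<in> generalized_eigenspace D a" "v \<in> generalized_eigenspace D b"
  shows "br u v \<in> generalized_eigenspace D (a + b)"
proof -
  let ?S = "\<lambda>a v. D v - sg a v"
  have lin: "Vector_Spaces.linear sg sg D" by (rule Der_linear[OF D])
  have "br u v \<in> generalized_eigenspace D (a + b)" if "(?S a ^^ n) u = 0" "(?S b ^^ m) v = 0" for n m u v
    using that
  proof (induction "n + m" arbitrary: n m u v rule: less_induct)
    case less
    note sub = subspace_generalized_eigenspace[OF lin, of "a + b"]
    show ?case
    proof (cases "n = 0 \<or> m = 0")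
      case True
      then have "br u v = 0" using less.prems by auto
      then show ?thesis using subspace_0[OF sub] by simp
    next
      case False
      then obtain n' m' where nm: "n = Suc n'" "m = Suc m'" by (meson not0_implies_Suc)
      have "br (?S a u) v \<in> generalized_eigenspace D (a + b)"
        using less.hyps[of n' m "?S a u" v] less.prems nm by (simp add: funpow_Suc_right del: funpow.simps)
      moreover have "br u (?S b v) \<in> generalized_eigenspace D (a + b)"
        using less.hyps[of n m' u "?S b v"] less.prems nm by (simp add: funpow_Suc_right del: funpow.simps)
      ultimately have "br (?S a u) v + br u (?S b v) \<in> generalized_eigenspace D (a + b)"
        by (rule subspace_add[OF sub])
      also have "br (?S a u) v + br u (?S b v) = D (br u v) - sg (a + b) (br u v)"
        by (simp add: Der_br[OF D] br_diff_left br_diff_right br_scale_left br_scale_right scale_left_distrib)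
      finally show ?thesis by (rule generalized_eigenspace_step)
    qed
  qed
  then show ?thesis using assms(2,3) by (auto simp: generalized_eigenspace_def)
qed

lemma linear_extend_basis:
  assumes "independent B"
  shows "\<exists>T. Vector_Spaces.linear sg sg T \<and> (\<forall>b\<in>B. T b = f b)"
proof -
  interpret P: vector_space_pair sg sg by unfold_locales
  show ?thesis using P.linear_independent_extend[OF assms] by blast
qed

text \<open>With a \<open>\<rat>\<close>-linear functional \<open>g\<close> that does not vanish on some eigenvalue of \<open>ad x\<close>, the operator
  \<open>T\<close> with eigenvalue \<open>g(a)\<close> on the generalized eigenspace of \<open>a\<close> is a derivation, and \<open>g\<close> maps
  \<open>tr(ad x \<circ> T)\<close> to a sum of squares of rational numbers.\<close>

lemma ad_nilpotent_if_trace_Der_zero: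
  assumes S: "lie_subalgebra sg br S" and x: "x \<in> S"
    and tr: "\<And>T B. Vector_Spaces.linear sg sg T \<Longrightarrow> T ` S \<subseteq> S \<Longrightarrow>
      (\<And>u v. u \<in> S \<Longrightarrow> v \<in> S \<Longrightarrow> T (br u v) = br (T u) v + br u (T v)) \<Longrightarrow>
      finite B \<Longrightarrow> independent B \<Longrightarrow> span B = S \<Longrightarrow> trace_on B (\<lambda>y. br x (T y)) = 0"
    and y: "y \<in> S"
  shows "\<exists>n. (br x ^^ n) y = 0"
proof -
  have sS: "subspace S" and SS: "\<And>u v. u \<in> S \<Longrightarrow> v \<in> S \<Longrightarrow> br u v \<in> S"
    using S by (auto simp: lie_subalgebra_def)
  obtain F where F: "finite F" "span F = UNIV" using ex_finite_span by blast
  have "br x ` S \<subseteq> S" using SS x by blast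
  then obtain B \<mu> r where tri: "triangular_basis (br x) B \<mu> r" and spB: "span B = S"
    using triangular_basis_exists[OF linear_br sS _ F(1)] F(2) by blast
  have B: "finite B" "independent B" using tri by (auto simp: triangular_basis_def)
  have BS: "B \<subseteq> S" using spB span_superset by blast
  have "\<mu> b = 0" if b: "b \<in> B" for b
  proof (rule ccontr)
    assume "\<mu> b \<noteq> 0"
    then obtain g :: "'k \<Rightarrow> rat" where g_add: "\<And>x y. g (x + y) = g x + g y"
      and g_scale: "\<And>q x. g (of_rat q * x) = q * g x" and gb: "g (\<mu> b) = 1"
      using ex_rat_functional[of "\<mu> b"] by blast
    obtain T where T: "Vector_Spaces.linear sg sg T" and TB: "\<And>c. c \<in> B \<Longrightarrow> T c = sg (of_rat (g (\<mu> c))) c"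
      using linear_extend_basis[OF B(2), of "\<lambda>c. sg (of_rat (g (\<mu> c))) c"] by blast
    have Teig: "T v = sg (of_rat (g a)) v" if "v \<in> span {c \<in> B. \<mu> c = a}" for v a
      using that
    proof (induction rule: span_induct_alt)
      case base
      then show ?case by (simp add: linear_0[OF T])
    next
      case (step c v y)
      then have "T v = sg (of_rat (g a)) v" using TB by auto
      then show ?case using step(2)
        by (simp add: linear_add[OF T] linear_scale[OF T] scale_right_distrib mult.commute)
    qed
    have TSB: "T ` B \<subseteq> span B" using TB by (auto intro!: span_scale[OF span_base])
    have TS: "T ` S \<subseteq> S" using linear_mem_span[OF T TSB] by (simp add: spB image_subset_iff)
    have eig: "c \<in> generalized_eigenspace (br x) (\<mu> c)" if "c \<in> B" for c
      using triangular_span_subset_generalized_eigenspace[OF linear_br tri, of "\<mu> c"] that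
        span_base[of c "{d \<in> B. \<mu> d = \<mu> c}"] by blast
    \<comment> \<open>The bracket lies in the block of \<open>\<mu> c + \<mu> d\<close>, where
      \<open>T\<close> acts by \<open>g (\<mu> c) + g (\<mu> d)\<close>; this is where additivity of
      \<open>g\<close> turns \<open>T\<close> into a derivation.\<close>
    have der0: "T (br c d) = br (T c) d + br c (T d)" if "c \<in> B" "d \<in> B" for c d
    proof -
      have "br c d \<in> span B" using SS that BS spB by blast
      then have "br c d \<in> span {e \<in> B. \<mu> e = \<mu> c + \<mu> d}"
        using br_generalized_eigenspace[OF br_Der eig[OF that(1)] eig[OF that(2)]]
        by (intro generalized_eigenspace_subset_triangular_span[OF linear_br tri])
      then show ?thesis
        using that by (simp add: Teig TB br_scale_left br_scale_right g_add of_rat_add scale_left_distrib)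
    qed
    have der1: "T (br c v) = br (T c) v + br c (T v)" if "c \<in> B" "v \<in> span B" for c v
      using that(2)
    proof (induction rule: span_induct_alt)
      case base
      then show ?case by (simp add: linear_0[OF T])
    next
      case (step a v y)
      then show ?case using der0[OF that(1)]
        by (simp add: linear_add[OF T] linear_scale[OF T] br_add_right br_scale_right scale_right_distrib)
    qed
    have der: "T (br u v) = br (T u) v + br u (T v)" if "u \<in> span B" "v \<in> span B" for u v
      using that(1)
    proof (induction rule: span_induct_alt)
      case base
      then show ?case by (simp add: linear_0[OF T])
    next
      case (step a w y)
      then show ?case using der1[OF _ that(2)]
        by (simp add: linear_add[OF T] linear_scale[OF T] br_add_left br_scale_left scale_right_distrib)
    qed
    have diag: "representation B (br x (T c)) c = of_rat (g (\<mu> c)) * \<mu> c" if c: "c \<in> B" for c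
    proof -
      let ?low = "br x c - sg (\<mu> c) c"
      have low: "?low \<in> span {d \<in> B. \<mu> d = \<mu> c \<and> r d < r c}"
        using tri c by (simp add: triangular_basis_def)
      then have lowB: "?low \<in> span B" using span_mono[of "{d \<in> B. \<mu> d = \<mu> c \<and> r d < r c}" B] by auto
      have "representation B ?low c = 0"
        by (rule representation_subset_eq_0[OF B(2) _ low]) auto
      moreover have "br x c = ?low + sg (\<mu> c) c" by simp
      ultimately have "representation B (br x c) c = \<mu> c"
        using lowB c B(2)
        by (metis (no_types, lifting) representation_add representation_scale representation_basis
            span_base span_scale add_0 mult.right_neutral)
      moreover have "br x c \<in> span B" using SS[OF x] BS c spB by blast
      ultimately show ?thesis using c B(2) by (simp add: TB br_scale_right representation_scale)
    qed
    have "0 = trace_on B (\<lambda>y. br x (T y))"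
      using tr[OF T TS _ B spB] der by (simp add: spB)
    also have "\<dots> = (\<Sum>c\<in>B. of_rat (g (\<mu> c)) * \<mu> c)" by (simp add: trace_on_def diag)
    finally have "g 0 = g (\<Sum>c\<in>B. of_rat (g (\<mu> c)) * \<mu> c)" by simp
    moreover have g0: "g 0 = 0" using g_add[of 0 0] by simp
    moreover have "g (sum f A) = (\<Sum>a\<in>A. g (f a))" for f :: "'g \<Rightarrow> 'k" and A
      by (induction A rule: infinite_finite_induct) (simp_all add: g0 g_add)
    ultimately have "(\<Sum>c\<in>B. g (\<mu> c) * g (\<mu> c)) = 0" by (simp add: g_scale)
    then have "g (\<mu> b) * g (\<mu> b) = 0" using b B(1) by (simp add: sum_nonneg_eq_0_iff)
    then show False by (simp add: gb)
  qed
  then have "{b \<in> B. \<mu> b = 0} = B" by blast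
  then have "y \<in> generalized_eigenspace (br x) 0"
    using triangular_span_subset_generalized_eigenspace[OF linear_br tri, of 0] y spB by auto
  then show ?thesis by (simp add: generalized_eigenspace_def)
qed

lemma lie_solvable_abelian:
  assumes I: "subspace I" and ab: "\<And>x y. x \<in> I \<Longrightarrow> y \<in> I \<Longrightarrow> br x y = 0"
  shows "lie_solvable sg br I"
proof (rule lie_solvableI[OF I])
  have "derived_algebra sg br I \<subseteq> {0}"
    unfolding derived_algebra_def by (rule span_minimal) (use ab in auto)
  then show "(derived_algebra sg br ^^ 1) I \<subseteq> {0}" by simp
qed

text \<open>Engel's theorem for the adjoint action. A maximal subalgebra \<open>H\<close> with the
  Engel property for subquotients of \<open>P\<close> normalizes some \<open>y\<close> outside it
  into itself, if it is proper; adjoining \<open>y\<close> keeps the property because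
  \<open>br y\<close> is nilpotent. So \<open>H = P\<close>, and the subquotient
  \<open>P / {0}\<close> yields the central vector.\<close>

lemma engel_center:
  assumes P: "lie_subalgebra sg br P" and P0: "P \<noteq> {0}"
    and nil: "\<And>x y. x \<in> P \<Longrightarrow> y \<in> P \<Longrightarrow> \<exists>n. (br x ^^ n) y = 0"
  shows "\<exists>w\<in>P. w \<noteq> 0 \<and> (\<forall>p\<in>P. br p w = 0)"
proof -
  have sP: "subspace P" and PP: "\<And>u v. u \<in> P \<Longrightarrow> v \<in> P \<Longrightarrow> br u v \<in> P"
    using P by (auto simp: lie_subalgebra_def)
  obtain F where F: "finite F" "span F = UNIV" using ex_finite_span by blast
  \<comment> \<open>Quantifying over all invariant subquotients \<open>M / U\<close> lets the
    property be applied to \<open>P / H\<close> itself, in order to enlarge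
    \<open>H\<close>.\<close>
  define N where "N H \<longleftrightarrow> subspace H \<and> H \<subseteq> P \<and> (\<forall>x\<in>H. \<forall>y\<in>H. br x y \<in> H) \<and>
    (\<forall>U M. subspace U \<and> subspace M \<and> U \<subset> M \<and> M \<subseteq> P \<and> (\<forall>h\<in>H. \<forall>u\<in>U. br h u \<in> U) \<and>
       (\<forall>h\<in>H. \<forall>m\<in>M. br h m \<in> M) \<longrightarrow> (\<exists>w\<in>M - U. \<forall>h\<in>H. br h w \<in> U))" for H
  have N0: "N {0}"
    unfolding N_def using subspace_0[OF sP] subspace_0 by auto
  have Ns: "subspace H \<and> H \<subseteq> span F" if "N H" for H using that F(2) by (simp add: N_def)
  obtain H where H: "N H" and max: "\<And>H'. N H' \<Longrightarrow> H \<subseteq> H' \<Longrightarrow> H' = H"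
    using ex_maximal_subspace[of N, OF N0 Ns F(1)] by blast
  have sH: "subspace H" and HP: "H \<subseteq> P" and HH: "\<And>x y. x \<in> H \<Longrightarrow> y \<in> H \<Longrightarrow> br x y \<in> H"
    using H by (auto simp: N_def)
  have HN: "\<exists>w\<in>M - U. \<forall>h\<in>H. br h w \<in> U"
    if "subspace U" "subspace M" "U \<subset> M" "M \<subseteq> P" "\<forall>h\<in>H. \<forall>u\<in>U. br h u \<in> U" "\<forall>h\<in>H. \<forall>m\<in>M. br h m \<in> M" for U M
    using H that unfolding N_def by blast
  have "H = P"
  proof (rule ccontr)
    assume "H \<noteq> P"
    \<comment> \<open>A vector of \<open>P / H\<close> killed by \<open>H\<close> is an element
      outside \<open>H\<close> that normalizes \<open>H\<close>.\<close>
    have "\<exists>w\<in>P - H. \<forall>h\<in>H. br h w \<in> H"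
      by (rule HN[OF sH sP]) (use HP HH PP \<open>H \<noteq> P\<close> in auto)
    then obtain y where y: "y \<in> P" "y \<notin> H" and Hy: "\<And>h. h \<in> H \<Longrightarrow> br h y \<in> H" by blast
    have yH: "br y h \<in> H" if "h \<in> H" for h
      using subspace_neg[OF sH Hy[OF that]] br_anti[of y h] by simp
    define H' where "H' = span (insert y H)"
    have H'D: "\<exists>k. \<exists>h\<in>H. x = sg k y + h" if "x \<in> H'" for x
    proof -
      obtain k where "x - sg k y \<in> span H" using \<open>x \<in> H'\<close> unfolding H'_def span_breakdown_eq by blast
      then have "x - sg k y \<in> H" using sH span_eq_iff by metis
      then show ?thesis by (intro exI[of _ k] bexI[of _ "x - sg k y"]) auto
    qed
    have HH': "H \<subseteq> H'" and yH': "y \<in> H'" unfolding H'_def using span_superset by blast+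
    have "N H'"
      unfolding N_def
    proof (intro conjI ballI allI impI)
      show sH': "subspace H'" by (simp add: H'_def)
      show "H' \<subseteq> P" unfolding H'_def using y HP by (intro span_minimal sP) auto
      show "br x z \<in> H'" if "x \<in> H'" "z \<in> H'" for x z
      proof -
        obtain k h l h' where x: "h \<in> H" "x = sg k y + h" and z: "h' \<in> H" "z = sg l y + h'"
          using H'D[OF \<open>x \<in> H'\<close>] H'D[OF \<open>z \<in> H'\<close>] by blast
        have "br x z = sg k (br y h') + sg l (br h y) + br h h'"
          by (simp add: x z br_add_left br_add_right br_scale_left br_scale_right br_self)
        moreover have "\<dots> \<in> H" using x z Hy yH HH by (intro subspace_add[OF sH] subspace_scale[OF sH])
        ultimately show ?thesis using HH' by auto
      qed
      fix U M
      assume UM: "subspace U \<and> subspace M \<and> U \<subset> M \<and> M \<subseteq> P \<and> (\<forall>h\<in>H'. \<forall>u\<in>U. br h u \<in> U) \<and>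
        (\<forall>h\<in>H'. \<forall>m\<in>M. br h m \<in> M)"
      then have sU: "subspace U" and HU: "\<And>h u. h \<in> H' \<Longrightarrow> u \<in> U \<Longrightarrow> br h u \<in> U"
        and HM: "\<And>h u. h \<in> H' \<Longrightarrow> u \<in> M \<Longrightarrow> br h u \<in> M" and MP: "M \<subseteq> P" by auto
      have "\<exists>w\<in>M - U. \<forall>h\<in>H. br h w \<in> U" by (rule HN) (use UM HH' in blast)+
      then obtain w where w: "w \<in> M" "w \<notin> U" "\<And>h. h \<in> H \<Longrightarrow> br h w \<in> U" by blast
      \<comment> \<open>Being killed by \<open>H\<close> modulo \<open>U\<close> survives
        \<open>br y\<close>, because \<open>[h, y]\<close> is again in \<open>H\<close>.\<close>
      have iter: "(br y ^^ k) w \<in> M \<and> (\<forall>h\<in>H. br h ((br y ^^ k) w) \<in> U)" for k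
      proof (induction k)
        case 0
        then show ?case using w by simp
      next
        case (Suc k)
        have "br h (br y ((br y ^^ k) w)) \<in> U" if h: "h \<in> H" for h
          unfolding br_br[of h y] using Suc h Hy[OF h] HU[OF yH'] by (intro subspace_add[OF sU]) auto
        then show ?case using Suc HM[OF yH'] by simp
      qed
      obtain n where "(br y ^^ n) w = 0" using nil[OF y(1)] w(1) MP by blast
      then have "\<exists>n. (br y ^^ n) w \<in> U" using subspace_0[OF sU] by metis
      \<comment> \<open>The last iterate outside \<open>U\<close> is killed modulo \<open>U\<close>
        by \<open>y\<close> as well as by \<open>H\<close>, hence by all of
        \<open>H'\<close>.\<close>
      then obtain k where k: "(br y ^^ k) w \<in> U" and least: "\<And>i. i < k \<Longrightarrow> (br y ^^ i) w \<notin> U"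
        using exists_least_iff[of "\<lambda>n. (br y ^^ n) w \<in> U"] by blast
      have "k \<noteq> 0"
      proof
        assume "k = 0"
        with k w(2) show False by simp
      qed
      then obtain j where j: "k = Suc j" using not0_implies_Suc by blast
      define v where "v = (br y ^^ j) w"
      have v: "v \<in> M" "v \<notin> U" "br y v \<in> U" "\<And>h. h \<in> H \<Longrightarrow> br h v \<in> U"
        using iter[of j] least[of j] k j by (auto simp: v_def)
      have "br x v \<in> U" if "x \<in> H'" for x
      proof -
        obtain c h where x: "h \<in> H" "x = sg c y + h" using H'D \<open>x \<in> H'\<close> by blast
        show ?thesis unfolding x(2) br_add_left br_scale_left
          using v x(1) by (intro subspace_add[OF sU] subspace_scale[OF sU])
      qed
      then show "\<exists>w\<in>M - U. \<forall>h\<in>H'. br h w \<in> U" using v by blast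
    qed
    from max[OF this HH'] yH' y(2) show False by simp
  qed
  moreover have "\<exists>w\<in>P - {0}. \<forall>h\<in>H. br h w \<in> {0}"
    by (rule HN) (use sP P0 subspace_0[OF sP] PP HP in auto)
  ultimately show ?thesis by auto
qed

text \<open>Let \<open>\<kappa>\<close> be the Killing form of \<open>S\<close> and \<open>R\<close>
  its radical. For \<open>P = [R, R]\<close> the trace criterion makes the operators
  \<open>br x\<close> nilpotent, so a nonzero \<open>P\<close> would have a nonzero centre by
  \<open>engel_center\<close>, which is an abelian ideal of \<open>S\<close>. Hence
  \<open>R = {0}\<close>, and some \<open>X\<close> satisfies
  \<open>\<kappa>(X, v) = tr (D ad v)\<close> for all \<open>v\<close>. For
  \<open>E = D - ad X\<close> this says \<open>tr (E ad v) = 0\<close>, whence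
  \<open>\<kappa>(E x, v) = tr (E ad [x, v]) = 0\<close> and \<open>E x = 0\<close>.\<close>

lemma derivation_semisimple_inner:
  assumes ss: "lie_semisimple sg br S" and D: "D \<in> Der sg br" and DS: "D ` S \<subseteq> S"
  shows "\<exists>X\<in>S. \<forall>y\<in>S. D y = br X y"
proof -
  have subalg: "lie_subalgebra sg br S"
    and no_ideal: "\<And>I. lie_ideal sg br I S \<Longrightarrow> lie_solvable sg br I \<Longrightarrow> I = {0}"
    using ss by (auto simp: lie_semisimple_def)
  have sS: "subspace S" and SS: "\<And>u v. u \<in> S \<Longrightarrow> v \<in> S \<Longrightarrow> br u v \<in> S"
    using subalg by (auto simp: lie_subalgebra_def)
  obtain F where F: "finite F" "span F = UNIV" using ex_finite_span by blast
  obtain B where B: "B \<subseteq> S" "independent B" "S \<subseteq> span B" using maximal_independent_subset[of S] .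
  have finB: "finite B" using independent_span_bound[OF F(1) B(2)] F(2) by simp
  have spB: "span B = S" using B sS by (intro span_subspace)
  note linD = Der_linear[OF D]
  have DSm: "D x \<in> S" if "x \<in> S" for x using DS that by blast
  have mem: "br u ` B \<subseteq> span B" if "u \<in> S" for u using SS that B(1) spB by blast
  have mem2: "(\<lambda>y. f (br u y)) ` B \<subseteq> span B" "(\<lambda>y. br u (f y)) ` B \<subseteq> span B"
    if "u \<in> S" "\<And>x. x \<in> S \<Longrightarrow> f x \<in> S" for u f
    using SS that B(1) spB by auto
  have lin2: "Vector_Spaces.linear sg sg (\<lambda>y. f (h y))"
    if "Vector_Spaces.linear sg sg f" "Vector_Spaces.linear sg sg h" for f h
    using that by (simp add: Vector_Spaces.linear_iff)
  define \<kappa> where "\<kappa> u v = trace_on B (\<lambda>y. br u (br v y))" for u v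
  have \<kappa>_add: "\<kappa> (u + u') v = \<kappa> u v + \<kappa> u' v" if "u \<in> S" "u' \<in> S" "v \<in> S" for u u' v
    unfolding \<kappa>_def br_add_left[of u u'] using that SS by (intro trace_on_add[OF B(2)] mem2) auto
  have \<kappa>_scale: "\<kappa> (sg c u) v = c * \<kappa> u v" if "u \<in> S" "v \<in> S" for u v c
    unfolding \<kappa>_def br_scale_left using that SS by (intro trace_on_scale[OF B(2)] mem2) auto
  define R where "R = {u \<in> S. \<forall>v\<in>S. \<kappa> u v = 0}"
  \<comment> \<open>Trace invariance \<open>tr (ad [u, v] f) = tr (ad u [ad v, f])\<close> for a
    general \<open>f\<close>. With \<open>f\<close> an adjoint operator it makes \<open>R\<close> an
    ideal; with \<open>f\<close> a derivation it feeds the nilpotency criterion.\<close>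
  have trace_br: "trace_on B (\<lambda>y. br (br u v) (f y)) = trace_on B (\<lambda>y. br u (br v (f y) - f (br v y)))"
    if u: "u \<in> S" and v: "v \<in> S" and f: "Vector_Spaces.linear sg sg f" "\<And>x. x \<in> S \<Longrightarrow> f x \<in> S" for u v f
  proof -
    have "trace_on B (\<lambda>y. br (br u v) (f y)) = trace_on B (\<lambda>y. br u (br v (f y)) - br v (br u (f y)))"
      by (rule trace_on_cong) (simp add: br_br[of u v])
    also have "\<dots> = trace_on B (\<lambda>y. br u (br v (f y))) - trace_on B (\<lambda>y. br v (br u (f y)))"
      using u v f SS by (intro trace_on_diff[OF B(2)] mem2) auto
    also have "trace_on B (\<lambda>y. br v (br u (f y))) = trace_on B (\<lambda>y. br u (f (br v y)))"
      using u v f SS by (intro trace_on_commute[OF linear_br lin2[OF linear_br] B(2) finB] mem mem2) auto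
    also have "trace_on B (\<lambda>y. br u (br v (f y))) - \<dots> = trace_on B (\<lambda>y. br u (br v (f y) - f (br v y)))"
      unfolding br_diff_right using u v f SS by (intro trace_on_diff[OF B(2), symmetric] mem2) auto
    finally show ?thesis .
  qed
  have idR: "lie_ideal sg br R S"
    unfolding lie_ideal_def
  proof (intro conjI ballI)
    have "\<kappa> 0 v = 0" if "v \<in> S" for v using \<kappa>_scale[OF subspace_0[OF sS] that, of 0] by simp
    then show "subspace R"
      unfolding R_def using \<kappa>_add \<kappa>_scale sS
      by (intro subspaceI) (auto simp: subspace_0 subspace_add subspace_scale)
    show "R \<subseteq> S" by (auto simp: R_def)
    fix z u assume z: "z \<in> S" and u: "u \<in> R"
    then have uS: "u \<in> S" and u0: "\<And>v. v \<in> S \<Longrightarrow> \<kappa> u v = 0" by (auto simp: R_def)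
    have "\<kappa> (br u z) v = 0" if v: "v \<in> S" for v
    proof -
      have "\<kappa> (br u z) v = trace_on B (\<lambda>y. br u (br z (br v y) - br v (br z y)))"
        unfolding \<kappa>_def by (rule trace_br[OF uS z linear_br]) (use SS v in auto)
      also have "\<dots> = \<kappa> u (br z v)" unfolding \<kappa>_def by (rule trace_on_cong) (simp add: br_br[of z v])
      finally show ?thesis using u0 SS z v by simp
    qed
    then have "br u z \<in> R" using SS uS z by (simp add: R_def)
    moreover have "br z u = sg (-1) (br u z)" using br_anti[of z u] by simp
    ultimately show "br z u \<in> R" using \<open>subspace R\<close> subspace_scale by metis
  qed
  then have sR: "subspace R" and RS: "R \<subseteq> S" and SR: "\<And>z u. z \<in> S \<Longrightarrow> u \<in> R \<Longrightarrow> br z u \<in> R"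
    by (auto simp: lie_ideal_def)
  have abelian: "I = {0}" if I: "lie_ideal sg br I S" and ab: "\<And>x y. x \<in> I \<Longrightarrow> y \<in> I \<Longrightarrow> br x y = 0" for I
    by (rule no_ideal[OF I lie_solvable_abelian[OF _ ab]]) (use I in \<open>simp_all add: lie_ideal_def\<close>)
  have "R = {0}"
  proof (rule ccontr)
    assume R0: "R \<noteq> {0}"
    define P where "P = derived_algebra sg br R"
    have sP: "subspace P" by (simp add: P_def derived_algebra_def)
    have PR: "P \<subseteq> R" unfolding P_def derived_algebra_def using SR RS by (intro span_minimal sR) blast
    have idP: "lie_ideal sg br P S"
      unfolding lie_ideal_def
    proof (intro conjI ballI)
      show "P \<subseteq> S" using PR RS by blast
      fix z u assume "z \<in> S" "u \<in> P"
      then show "br z u \<in> P"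
        using derived_algebra_Der[OF br_Der, of z R] SR unfolding P_def by blast
    qed (rule sP)
    have "P \<noteq> {0}"
      using R0 abelian[OF idR] br_mem_derived[of _ R] unfolding P_def by blast
    moreover have "lie_subalgebra sg br P"
      using idP unfolding lie_subalgebra_def lie_ideal_def by blast
    moreover have "\<exists>n. (br x ^^ n) y = 0" if x: "x \<in> P" and y: "y \<in> P" for x y
    proof (rule ad_nilpotent_if_trace_Der_zero[OF subalg])
      show "x \<in> S" "y \<in> S" using x y PR RS by auto
      fix T C assume T: "Vector_Spaces.linear sg sg T" "T ` S \<subseteq> S"
        and der: "\<And>u v. u \<in> S \<Longrightarrow> v \<in> S \<Longrightarrow> T (br u v) = br (T u) v + br u (T v)"
        and C: "finite C" "independent C" "span C = S"
      have TS: "T z \<in> S" if "z \<in> S" for z using T(2) that by blast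
      have "x \<in> S \<and> trace_on B (\<lambda>y. br x (T y)) = 0"
        using x unfolding P_def derived_algebra_def
      proof (induction rule: span_induct_alt)
        case base
        then show ?case using subspace_0[OF sS]
          by (simp add: trace_on_def representation_zero)
      next
        case (step c x z)
        then obtain u v where uv: "u \<in> R" "v \<in> R" "x = br u v" by blast
        then have uS: "u \<in> S" and vS: "v \<in> S" and u0: "\<And>v. v \<in> S \<Longrightarrow> \<kappa> u v = 0"
          by (auto simp: R_def)
        have "trace_on B (\<lambda>y. br x (T y)) = trace_on B (\<lambda>y. br u (br v (T y) - T (br v y)))"
          unfolding uv(3) by (rule trace_br[OF uS vS T(1) TS])
        \<comment> \<open>The commutator of \<open>ad v\<close> with the derivation \<open>T\<close>
          is \<open>- ad (T v)\<close>, so the trace becomes a value of the Killing form at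
          \<open>u\<close>, which lies in its radical.\<close>
        also have "\<dots> = trace_on B (\<lambda>y. sg (-1) (br u (br (T v) y)))"
          using der[OF vS] B(1) by (intro trace_on_cong) (auto simp: br_diff_right br_add_right)
        also have "\<dots> = - \<kappa> u (T v)"
          unfolding \<kappa>_def using uS TS[OF vS] SS by (subst trace_on_scale[OF B(2) mem2(2)]) auto
        finally have 0: "trace_on B (\<lambda>y. br x (T y)) = 0" using u0[OF TS[OF vS]] by simp
        have xS: "x \<in> S" using uv SS uS vS by simp
        have "trace_on B (\<lambda>y. br (sg c x + z) (T y))
            = c * trace_on B (\<lambda>y. br x (T y)) + trace_on B (\<lambda>y. br z (T y))"
          unfolding br_add_left br_scale_left
          using xS step(2) TS SS sS
          by (subst trace_on_add[OF B(2) _ mem2(2)])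
             (auto simp: trace_on_scale[OF B(2) mem2(2)] image_subset_iff spB B(1)[THEN subsetD] subspace_scale)
        then show ?case using 0 step(2) xS subspace_add[OF sS] subspace_scale[OF sS] by simp
      qed
      moreover have "trace_on B (\<lambda>y. br x (T y)) = trace_on C (\<lambda>y. br x (T y))"
        using x PR RS TS C spB
        by (intro trace_on_basis_change[OF lin2[OF linear_br T(1)] B(2) finB C(2,1)] mem2) auto
      ultimately show "trace_on C (\<lambda>y. br x (T y)) = 0" by simp
    qed
    ultimately obtain w where w: "w \<in> P" "w \<noteq> 0" "\<forall>p\<in>P. br p w = 0"
      using engel_center by blast
    have "{w \<in> P. \<forall>p\<in>P. br p w = 0} = {0}"
    proof (rule abelian)
      have PSP: "br p z \<in> P" if "p \<in> P" "z \<in> S" for p z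
        using idP that br_anti[of p z] subspace_neg[OF sP] by (simp add: lie_ideal_def)
      show "lie_ideal sg br {w \<in> P. \<forall>p\<in>P. br p w = 0} S"
        unfolding lie_ideal_def
      proof (intro conjI ballI)
        show "subspace {w \<in> P. \<forall>p\<in>P. br p w = 0}"
          by (rule subspaceI)
             (auto simp: subspace_0[OF sP] subspace_add[OF sP] subspace_scale[OF sP] br_add_right br_scale_right)
        show "{w \<in> P. \<forall>p\<in>P. br p w = 0} \<subseteq> S" using PR RS by blast
        fix z u assume "z \<in> S" "u \<in> {w \<in> P. \<forall>p\<in>P. br p w = 0}"
        then show "br z u \<in> {w \<in> P. \<forall>p\<in>P. br p w = 0}"
          using idP PSP by (auto simp: lie_ideal_def br_br[of _ z u])
      qed
    qed auto
    with w show False by blast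
  qed
  \<comment> \<open>The functional \<open>\<kappa>(u, -)\<close> stored as a vector, with its values
    on \<open>B\<close> as coordinates. This keeps the map from \<open>S\<close> to its dual inside
    \<open>S\<close>, where injectivity, that is nondegeneracy, gives surjectivity by
    dimension.\<close>
  define \<Phi> where "\<Phi> u = (\<Sum>b\<in>B. sg (\<kappa> u b) b)" for u
  have coeffs: "\<forall>b\<in>B. f b = h b" if "(\<Sum>b\<in>B. sg (f b) b) = (\<Sum>b\<in>B. sg (h b) b)" for f h
  proof -
    have "(\<Sum>b\<in>B. sg (f b - h b) b) = 0" using that by (simp add: scale_left_diff_distrib sum_subtractf)
    then show ?thesis using independentD[OF B(2) finB subset_refl, of "\<lambda>b. f b - h b"] by auto
  qed
  have B_suffices: "\<forall>v\<in>S. trace_on B (\<lambda>y. f (br v y)) = 0"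
    if f: "Vector_Spaces.linear sg sg f" "\<And>x. x \<in> S \<Longrightarrow> f x \<in> S" and fB: "\<forall>b\<in>B. trace_on B (\<lambda>y. f (br b y)) = 0" for f
  proof
    fix v assume "v \<in> S"
    then have "v \<in> span B" by (simp add: spB)
    then have "v \<in> S \<and> trace_on B (\<lambda>y. f (br v y)) = 0"
    proof (induction rule: span_induct_alt)
      case base
      then show ?case using subspace_0[OF sS] by (simp add: trace_on_def representation_zero linear_0[OF f(1)])
    next
      case (step c x z)
      have xS: "x \<in> S" using step(1) B(1) by blast
      have "trace_on B (\<lambda>y. f (br (sg c x + z) y))
          = c * trace_on B (\<lambda>y. f (br x y)) + trace_on B (\<lambda>y. f (br z y))"
        unfolding br_add_left br_scale_left linear_add[OF f(1)] linear_scale[OF f(1)]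
        using xS step(2) f(2) SS sS
        by (subst trace_on_add[OF B(2) _ mem2(1)])
           (auto simp: trace_on_scale[OF B(2) mem2(1)] image_subset_iff spB B(1)[THEN subsetD] subspace_scale)
      then show ?case using fB step xS subspace_add[OF sS] subspace_scale[OF sS] by simp
    qed
    then show "trace_on B (\<lambda>y. f (br v y)) = 0" by simp
  qed
  obtain T where T: "Vector_Spaces.linear sg sg T" and TB: "\<And>b. b \<in> B \<Longrightarrow> T b = \<Phi> b"
    using linear_extend_basis[OF B(2), of \<Phi>] by blast
  have T\<Phi>: "T u = \<Phi> u" if "u \<in> S" for u
  proof -
    have "u \<in> span B" using that by (simp add: spB)
    then have "u \<in> S \<and> T u = \<Phi> u"
    proof (induction rule: span_induct_alt)
      case base
      have "\<kappa> 0 v = 0" if "v \<in> S" for v using \<kappa>_scale[OF subspace_0[OF sS] that, of 0] by simp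
      then have "\<Phi> 0 = 0" unfolding \<Phi>_def using B(1) by (intro sum.neutral) auto
      then show ?case using subspace_0[OF sS] linear_0[OF T] by simp
    next
      case (step c x z)
      have xS: "x \<in> S" using step(1) B(1) by blast
      have "\<Phi> (sg c x + z) = (\<Sum>b\<in>B. sg (c * \<kappa> x b + \<kappa> z b) b)"
        unfolding \<Phi>_def using xS step(2) B(1) subspace_scale[OF sS]
        by (intro sum.cong refl) (auto simp: \<kappa>_add \<kappa>_scale subsetD)
      then have "\<Phi> (sg c x + z) = sg c (\<Phi> x) + \<Phi> z"
        by (simp add: \<Phi>_def scale_left_distrib sum.distrib scale_sum_right)
      then show ?case using step TB xS subspace_add[OF sS] subspace_scale[OF sS]
        by (simp add: linear_add[OF T] linear_scale[OF T])
    qed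
    then show ?thesis by simp
  qed
  have "T ` span B = span B"
  proof (rule linear_inj_on_surj[OF T B(2) finB])
    show "T ` B \<subseteq> span B" using TB by (auto simp: \<Phi>_def intro!: span_sum span_scale[OF span_base])
    fix x assume "x \<in> span B" "T x = 0"
    then have x: "x \<in> S" and "(\<Sum>b\<in>B. sg (\<kappa> x b) b) = (\<Sum>b\<in>B. sg 0 b)"
      using T\<Phi>[of x] by (simp_all add: spB \<Phi>_def)
    from coeffs[OF this(2)] have "\<forall>b\<in>B. trace_on B (\<lambda>y. br x (br b y)) = 0" by (simp add: \<kappa>_def)
    then have "\<forall>v\<in>S. \<kappa> x v = 0"
      unfolding \<kappa>_def using x SS by (intro B_suffices[OF linear_br]) auto
    then have "x \<in> R" using x by (simp add: R_def)
    then show "x = 0" using \<open>R = {0}\<close> by simp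
  qed
  moreover have "(\<Sum>b\<in>B. sg (trace_on B (\<lambda>y. D (br b y))) b) \<in> span B"
    by (intro span_sum span_scale span_base)
  \<comment> \<open>The prescribed coordinates are the values of the functional
    \<open>v |-> tr (D ad v)\<close> on the basis.\<close>
  ultimately obtain X where X: "X \<in> S" "T X = (\<Sum>b\<in>B. sg (trace_on B (\<lambda>y. D (br b y))) b)"
    using spB by (metis (no_types, lifting) imageE)
  have \<kappa>X: "\<kappa> X b = trace_on B (\<lambda>y. D (br b y))" if "b \<in> B" for b
    using X coeffs[of "\<kappa> X" "\<lambda>b. trace_on B (\<lambda>y. D (br b y))"] that by (simp add: T\<Phi> \<Phi>_def)
  define E where "E y = D y - br X y" for y
  have E: "E \<in> Der sg br" unfolding E_def by (rule Der_br_diff[OF D])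
  note linE = Der_linear[OF E]
  have ES: "E y \<in> S" if "y \<in> S" for y
    unfolding E_def using that X(1) SS DSm by (intro subspace_diff[OF sS]) auto
  have "trace_on B (\<lambda>y. E (br b y)) = 0" if "b \<in> B" for b
  proof -
    have bS: "b \<in> S" using that B(1) by blast
    have "trace_on B (\<lambda>y. E (br b y)) = trace_on B (\<lambda>y. D (br b y)) - trace_on B (\<lambda>y. br X (br b y))"
      unfolding E_def using bS X(1) SS DSm by (intro trace_on_diff[OF B(2)] mem2) auto
    then show ?thesis using \<kappa>X[OF that] by (simp add: \<kappa>_def)
  qed
  then have E0: "trace_on B (\<lambda>y. E (br v y)) = 0" if "v \<in> S" for v
    using B_suffices[OF linE ES] that by blast
  have "E x = 0" if x: "x \<in> S" for x
  proof -
    have "\<kappa> (E x) v = 0" if v: "v \<in> S" for v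
    proof -
      have "\<kappa> (E x) v = trace_on B (\<lambda>y. E (br x (br v y)) - br x (E (br v y)))"
        unfolding \<kappa>_def by (rule trace_on_cong) (simp add: Der_br[OF E])
      also have "\<dots> = trace_on B (\<lambda>y. E (br x (br v y))) - trace_on B (\<lambda>y. br x (E (br v y)))"
        using x v SS ES spB B(1) by (intro trace_on_diff[OF B(2)]) auto
      also have "trace_on B (\<lambda>y. br x (E (br v y))) = trace_on B (\<lambda>y. E (br v (br x y)))"
        using x v SS ES by (intro trace_on_commute[OF linear_br lin2[OF linE linear_br] B(2) finB] mem mem2) auto
      also have "trace_on B (\<lambda>y. E (br x (br v y))) - \<dots>
          = trace_on B (\<lambda>y. E (br x (br v y)) - E (br v (br x y)))"
        using x v SS ES spB B(1) by (intro trace_on_diff[OF B(2), symmetric]) auto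
      also have "\<dots> = trace_on B (\<lambda>y. E (br (br x v) y))"
        by (rule trace_on_cong) (simp add: br_br[of x v] linear_add[OF linE])
      finally show ?thesis using E0 SS x v by simp
    qed
    then have "E x \<in> R" using ES x by (simp add: R_def)
    then show ?thesis using \<open>R = {0}\<close> by simp
  qed
  then show ?thesis using X(1) by (auto simp: E_def)
qed

text \<open>The centre of \<open>S\<close> is an abelian ideal. This is what makes the element
  inducing a derivation on the Levi factor unique.\<close>

lemma semisimple_centralizer:
  assumes ss: "lie_semisimple sg br S" and X: "X \<in> S" "\<And>y. y \<in> S \<Longrightarrow> br X y = 0"
  shows "X = 0"
proof -
  let ?Z = "{X \<in> S. \<forall>y\<in>S. br X y = 0}"
  have sub: "lie_subalgebra sg br S"
    and no_ideal: "\<And>I. lie_ideal sg br I S \<Longrightarrow> lie_solvable sg br I \<Longrightarrow> I = {0}"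
    using ss by (auto simp: lie_semisimple_def)
  have sS: "subspace S" using sub by (simp add: lie_subalgebra_def)
  have sZ: "subspace ?Z"
    using sS by (intro subspaceI) (auto simp: subspace_0 subspace_add subspace_scale br_add_left br_scale_left)
  have "br x y \<in> ?Z" if "x \<in> S" "y \<in> ?Z" for x y
  proof -
    have "br x y = 0" using that br_anti[of x y] by simp
    then show ?thesis using subspace_0[OF sZ] by simp
  qed
  then have "lie_ideal sg br ?Z S" using sZ by (auto simp: lie_ideal_def)
  moreover have "lie_solvable sg br ?Z"
    by (rule lie_solvable_abelian[OF sZ]) auto
  ultimately have "?Z = {0}" by (rule no_ideal)
  then show ?thesis using X by blast
qed

end

section \<open>Alternating forms\<close>

text \<open>The conditions of \<open>exterior_dual\<close> with values in any vector space, so that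
  scalar functionals and \<open>V\<close>-valued cochains share one theory.\<close>

definition alternating ::
    "('k::field \<Rightarrow> 'g::ab_group_add \<Rightarrow> 'g) \<Rightarrow> ('k \<Rightarrow> 'w::ab_group_add \<Rightarrow> 'w) \<Rightarrow> ('g list \<Rightarrow> 'w) set" where
  "alternating sg sw = {f.
     (\<forall>us x y ws. f (us @ (x + y) # ws) = f (us @ x # ws) + f (us @ y # ws)) \<and>
     (\<forall>us c x ws. f (us @ sg c x # ws) = sw c (f (us @ x # ws))) \<and>
     (\<forall>xs. \<not> distinct xs \<longrightarrow> f xs = 0)}"

lemma exterior_dual_eq_alternating: "exterior_dual sg = alternating sg (*)"
  by (simp add: exterior_dual_def alternating_def)

lemma delete_nth_0 [simp]: "delete_nth 0 (x # xs) = xs"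
  by (simp add: delete_nth_def)

lemma delete_nth_Suc [simp]: "delete_nth (Suc i) (x # xs) = x # delete_nth i xs"
  by (simp add: delete_nth_def)

lemma length_delete_nth: "i < length xs \<Longrightarrow> length (delete_nth i xs) = length xs - 1"
  by (simp add: delete_nth_def)

lemma nth_delete_nth: "i < j \<Longrightarrow> j < length xs \<Longrightarrow> delete_nth j xs ! i = xs ! i"
  by (simp add: delete_nth_def nth_append)

lemma derivation_transpose_Nil [simp]: "derivation_transpose D f [] = 0"
  by (simp add: derivation_transpose_def)

lemma derivation_transpose_Cons:
  "derivation_transpose D f (x # xs) = f (D x # xs) + derivation_transpose D (\<lambda>ys. f (x # ys)) xs"
  unfolding derivation_transpose_def by (simp add: sum.lessThan_Suc_shift del: sum.lessThan_Suc)

lemma derivation_transpose_append: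
  "derivation_transpose D f (us @ ws) =
    derivation_transpose D (\<lambda>vs. f (vs @ ws)) us + derivation_transpose D (\<lambda>vs. f (us @ vs)) ws"
  by (induction us arbitrary: f) (simp_all add: derivation_transpose_Cons add.assoc)

lemma derivation_transpose_add:
  "derivation_transpose D (\<lambda>xs. f xs + h xs) xs = derivation_transpose D f xs + derivation_transpose D h xs"
  by (simp add: derivation_transpose_def sum.distrib)

lemma derivation_transpose_sum:
  "derivation_transpose D (\<lambda>xs. \<Sum>i\<in>I. f i xs) xs = (\<Sum>i\<in>I. derivation_transpose D (f i) xs)"
  unfolding derivation_transpose_def by (rule sum.swap)

lemma derivation_transpose_0: "derivation_transpose D (\<lambda>xs. 0) xs = 0"
  by (simp add: derivation_transpose_def)

text \<open>\<open>G\<close> takes the entry at position \<open>i\<close> and the remaining list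
  separately, so the sum over positions splits into the term at \<open>i\<close> and the derivation
  of the rest. This is the product rule on which the comparison with the differential rests.\<close>

lemma derivation_transpose_delete_nth:
  assumes "i < length xs"
  shows "derivation_transpose D (\<lambda>ys. G (ys ! i) (delete_nth i ys)) xs =
    G (D (xs ! i)) (delete_nth i xs) + derivation_transpose D (G (xs ! i)) (delete_nth i xs)"
  using assms
proof (induction xs arbitrary: i G)
  case (Cons x xs)
  show ?case
  proof (cases i)
    case 0
    then show ?thesis by (simp add: derivation_transpose_Cons)
  next
    case (Suc j)
    then show ?thesis
      using Cons.IH[of j "\<lambda>y l. G y (x # l)"] Cons.prems
      by (simp add: derivation_transpose_Cons add.left_commute)
  qed
qed simp

locale alternating_forms = G: vector_space sg + W: vector_space sw
  for sg :: "'k::field \<Rightarrow> 'g::ab_group_add \<Rightarrow> 'g" and sw :: "'k \<Rightarrow> 'w::ab_group_add \<Rightarrow> 'w"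
begin

lemma alternating_add: "f \<in> alternating sg sw \<Longrightarrow> f (us @ (x + y) # ws) = f (us @ x # ws) + f (us @ y # ws)"
  by (simp add: alternating_def)

lemma alternating_scale: "f \<in> alternating sg sw \<Longrightarrow> f (us @ sg c x # ws) = sw c (f (us @ x # ws))"
  by (simp add: alternating_def)

lemma alternating_eq_0: "f \<in> alternating sg sw \<Longrightarrow> \<not> distinct xs \<Longrightarrow> f xs = 0"
  by (simp add: alternating_def)

lemma alternating_zero_entry: "f \<in> alternating sg sw \<Longrightarrow> f (us @ 0 # ws) = 0"
  using alternating_scale[of f us 0 0 ws] by simp

lemma alternating_Cons:
  assumes f: "f \<in> alternating sg sw"
  shows "(\<lambda>xs. f (z # xs)) \<in> alternating sg sw"
proof -
  have "f (z # us @ (x + y) # ws) = f (z # us @ x # ws) + f (z # us @ y # ws)" for us x y ws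
    using alternating_add[OF f, of "z # us"] by simp
  moreover have "f (z # us @ sg c x # ws) = sw c (f (z # us @ x # ws))" for us c x ws
    using alternating_scale[OF f, of "z # us"] by simp
  moreover have "f (z # xs) = 0" if "\<not> distinct xs" for xs
    using alternating_eq_0[OF f, of "z # xs"] that by simp
  ultimately show ?thesis by (simp add: alternating_def)
qed

lemma alternating_swap:
  assumes f: "f \<in> alternating sg sw"
  shows "f (us @ x # vs @ y # ws) = - f (us @ y # vs @ x # ws)"
proof -
  have "f (us @ (x + y) # vs @ (x + y) # ws) = 0" by (rule alternating_eq_0[OF f]) simp
  moreover have "f (us @ z # vs @ (x + y) # ws) = f (us @ z # vs @ x # ws) + f (us @ z # vs @ y # ws)" for z
    using alternating_add[OF f, of "us @ z # vs"] by simp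
  moreover have "f (us @ z # vs @ z # ws) = 0" for z by (rule alternating_eq_0[OF f]) simp
  ultimately show ?thesis by (simp add: alternating_add[OF f] eq_neg_iff_add_eq_0)
qed

lemma alternating_move:
  assumes f: "f \<in> alternating sg sw"
  shows "f (us @ y # as @ bs) = sw ((-1) ^ length as) (f (us @ as @ y # bs))"
proof (induction as arbitrary: us)
  case (Cons a as)
  have "f (us @ y # a # as @ bs) = - f (us @ a # y # as @ bs)"
    using alternating_swap[OF f, of us y "[]" a] by simp
  then show ?case using Cons[of "us @ [a]"] by simp
qed simp

lemma alternating_delete_nth:
  assumes f: "f \<in> alternating sg sw" and j: "j < length xs"
  shows "f (y # delete_nth j xs) = sw ((-1) ^ j) (f (xs[j := y]))"
  using alternating_move[OF f, of "[]" y "take j xs" "drop (Suc j) xs"] j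
  by (simp add: delete_nth_def upd_conv_take_nth_drop)

lemma alternating_derivation_transpose:
  assumes f: "f \<in> alternating sg sw" and D: "Vector_Spaces.linear sg sg D"
  shows "derivation_transpose D f \<in> alternating sg sw"
proof -
  let ?d = "derivation_transpose D"
  have D_add: "D (x + y) = D x + D y" and D_scale: "D (sg c x) = sg c (D x)" for x y c
    using D by (auto simp: Vector_Spaces.linear_iff)
  have split: "?d f (us @ x # ws) = ?d (\<lambda>vs. f (vs @ x # ws)) us + f (us @ D x # ws)
      + ?d (\<lambda>vs. f (us @ x # vs)) ws" for us x ws
    by (simp add: derivation_transpose_append derivation_transpose_Cons add.assoc)
  have d_scale: "?d (\<lambda>vs. sw c (h vs)) us = sw c (?d h us)" for c h us
    by (simp add: derivation_transpose_def W.scale_sum_right)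
  have "?d f (us @ (x + y) # ws) = ?d f (us @ x # ws) + ?d f (us @ y # ws)" for us x y ws
    by (simp add: split D_add alternating_add[OF f] derivation_transpose_add)
  moreover have "?d f (us @ sg c x # ws) = sw c (?d f (us @ x # ws))" for us c x ws
    by (simp add: split D_scale alternating_scale[OF f] d_scale W.scale_right_distrib)
  moreover have "?d f xs = 0" if xs: "\<not> distinct xs" for xs
  proof -
    obtain us x vs ws where eq: "xs = us @ x # vs @ x # ws"
      using not_distinct_decomp[OF xs] by auto
    have z: "f (us @ x # vs @ x # ws) = 0" for us vs ws by (rule alternating_eq_0[OF f]) simp
    \<comment> \<open>With a repeated entry \<open>x\<close>, a term survives only if
      \<open>D\<close> hits one of the two copies; the two survivors are swaps of each
      other.\<close>
    have "?d f xs = f (us @ D x # vs @ x # ws) + f (us @ x # vs @ D x # ws)"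
      using z[of us _ ws] z[of us vs] z[of _ vs ws]
      by (simp add: eq split derivation_transpose_append derivation_transpose_Cons derivation_transpose_0)
    then show ?thesis using alternating_swap[OF f, of us x vs "D x" ws] by simp
  qed
  ultimately show ?thesis by (simp add: alternating_def)
qed

text \<open>Terms where \<open>D\<close> and \<open>E\<close> hit different entries cancel, and what
  remains is both hitting the same one. The order is reversed, as for any transpose; the minus sign
  in \<open>psi\<close> compensates for this.\<close>

lemma derivation_transpose_commutator:
  assumes f: "f \<in> alternating sg sw"
  shows "derivation_transpose (commutator D E) f xs =
    derivation_transpose E (derivation_transpose D f) xs - derivation_transpose D (derivation_transpose E f) xs"
  using f
proof (induction xs arbitrary: f)
  case (Cons x xs)
  have comm: "f (commutator D E x # xs) = f (D (E x) # xs) - f (E (D x) # xs)"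
    using alternating_add[OF Cons.prems, of "[]" "D (E x) - E (D x)" "E (D x)" xs] by (simp add: commutator_def)
  have nested: "derivation_transpose A (derivation_transpose B f) (x # xs) =
      f (B (A x) # xs) + derivation_transpose B (\<lambda>ys. f (A x # ys)) xs
      + (derivation_transpose A (\<lambda>ys. f (B x # ys)) xs
         + derivation_transpose A (derivation_transpose B (\<lambda>ys. f (x # ys))) xs)" for A B :: "'g \<Rightarrow> 'g"
    by (simp add: derivation_transpose_Cons derivation_transpose_add)
  show ?case
    using Cons.IH[OF alternating_Cons[OF Cons.prems, of x]]
    by (simp add: nested derivation_transpose_Cons[of "commutator D E"] comm)
qed simp

end

section \<open>The Chevalley-Eilenberg complex\<close>

locale lie_module = fin_dim_lie_algebra sg br + md: alg_closed_vector_space sv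
  for sg :: "'k::{alg_closed_field, field_char_0} \<Rightarrow> 'g::ab_group_add \<Rightarrow> 'g"
    and br :: "'g \<Rightarrow> 'g \<Rightarrow> 'g"
    and sv :: "'k \<Rightarrow> 'v::ab_group_add \<Rightarrow> 'v" +
  fixes V :: "'v set" and \<pi> :: "'g \<Rightarrow> 'v \<Rightarrow> 'v"
  assumes subspace_V: "md.subspace V"
    and action: "lie_action sg br UNIV sv V \<pi>"
begin

sublocale dual: alternating_forms sg "(*)"
  by unfold_locales (simp_all add: algebra_simps)

sublocale forms: alternating_forms sg sv
  by unfold_locales

sublocale fn: vector_space "fscale sv :: 'k \<Rightarrow> ('g list \<Rightarrow> 'v) \<Rightarrow> ('g list \<Rightarrow> 'v)"
  by unfold_locales
     (simp_all add: fscale_def fun_eq_iff md.scale_right_distrib md.scale_left_distrib)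

section \<open>Operators on \<open>V\<close>-valued forms and their behaviour under the
  differential\<close>

lemma act_mem: "v \<in> V \<Longrightarrow> \<pi> x v \<in> V"
  and act_add: "v \<in> V \<Longrightarrow> w \<in> V \<Longrightarrow> \<pi> x (v + w) = \<pi> x v + \<pi> x w"
  and act_scale: "v \<in> V \<Longrightarrow> \<pi> x (sv c v) = sv c (\<pi> x v)"
  and act_add_left: "v \<in> V \<Longrightarrow> \<pi> (x + y) v = \<pi> x v + \<pi> y v"
  and act_scale_left: "v \<in> V \<Longrightarrow> \<pi> (sg c x) v = sv c (\<pi> x v)"
  and act_br: "v \<in> V \<Longrightarrow> \<pi> (br x y) v = \<pi> x (\<pi> y v) - \<pi> y (\<pi> x v)"
  using action by (simp_all add: lie_action_def eq_diff_eq)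

lemma endo_act: "md.endo_on V (\<pi> x)"
  by (simp add: md.endo_on_def act_mem act_add act_scale)

lemmas act_0 = md.endo_on_0[OF endo_act subspace_V]
lemmas act_diff = md.endo_on_diff[OF endo_act subspace_V]
lemmas act_sum = md.endo_on_sum[OF endo_act subspace_V]

lemma subspace_exterior_tensor: "fn.subspace (exterior_tensor sg sv V)"
  by (simp add: exterior_tensor_def)

lemma exterior_tensorD:
  assumes "\<omega> \<in> exterior_tensor sg sv V"
  shows "\<omega> \<in> alternating sg sv" "\<omega> xs \<in> V"
proof -
  have "\<omega> \<in> alternating sg sv \<and> (\<forall>xs. \<omega> xs \<in> V)"
    using assms unfolding exterior_tensor_def
  proof (induction rule: fn.span_induct_alt)
    case base
    show ?case by (simp add: alternating_def md.subspace_0[OF subspace_V])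
  next
    case (step c t \<omega>)
    then obtain f v where f: "f \<in> alternating sg (*)" "v \<in> V" "t = tensor sv f v"
      by (auto simp: exterior_dual_eq_alternating)
    have "t \<in> alternating sg sv" "\<forall>xs. t xs \<in> V"
      using f md.subspace_scale[OF subspace_V]
      by (auto simp: tensor_def alternating_def md.scale_left_distrib)
    then show ?case
      using step(2) md.subspace_add[OF subspace_V] md.subspace_scale[OF subspace_V]
      by (simp add: fscale_def alternating_def md.scale_right_distrib add_ac mult.commute)
  qed
  then show "\<omega> \<in> alternating sg sv" "\<omega> xs \<in> V" by auto
qed

lemma tensor_mem: "f \<in> exterior_dual sg \<Longrightarrow> v \<in> V \<Longrightarrow> tensor sv f v \<in> exterior_tensor sg sv V"
  unfolding exterior_tensor_def by (rule fn.span_base) blast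

text \<open>Since the tensor product is a span, an operator has to be checked on pure tensors only.
  Its linearity is required just for functions with values in \<open>V\<close>, as
  \<open>\<pi>\<close> is linear only there.\<close>

lemma exterior_tensor_closed:
  assumes \<omega>: "\<omega> \<in> exterior_tensor sg sv V"
    and \<Phi>0: "\<Phi> 0 = 0"
    and \<Phi>: "\<And>c \<omega> \<eta>. (\<And>xs. \<omega> xs \<in> V) \<Longrightarrow> (\<And>xs. \<eta> xs \<in> V) \<Longrightarrow> \<Phi> (fscale sv c \<omega> + \<eta>) = fscale sv c (\<Phi> \<omega>) + \<Phi> \<eta>"
    and tensor: "\<And>f v. f \<in> exterior_dual sg \<Longrightarrow> v \<in> V \<Longrightarrow> \<Phi> (tensor sv f v) \<in> exterior_tensor sg sv V"
  shows "\<Phi> \<omega> \<in> exterior_tensor sg sv V"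
proof -
  let ?E = "exterior_tensor sg sv V"
  note sub = fn.subspace_0[OF subspace_exterior_tensor] fn.subspace_add[OF subspace_exterior_tensor]
    fn.subspace_scale[OF subspace_exterior_tensor]
  have lin: "\<Phi> (fscale sv c \<omega> + \<eta>) = fscale sv c (\<Phi> \<omega>) + \<Phi> \<eta>" if "\<omega> \<in> ?E" "\<eta> \<in> ?E" for c \<omega> \<eta>
    using that by (intro \<Phi> exterior_tensorD(2))
  have "fn.subspace {\<omega> \<in> ?E. \<Phi> \<omega> \<in> ?E}"
  proof (rule fn.subspaceI)
    show "0 \<in> {\<omega> \<in> ?E. \<Phi> \<omega> \<in> ?E}" using sub(1) \<Phi>0 by simp
  next
    fix \<omega> \<eta> assume *: "\<omega> \<in> {\<omega> \<in> ?E. \<Phi> \<omega> \<in> ?E}" "\<eta> \<in> {\<omega> \<in> ?E. \<Phi> \<omega> \<in> ?E}"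
    then have "\<Phi> (\<omega> + \<eta>) = \<Phi> \<omega> + \<Phi> \<eta>" using lin[of \<omega> \<eta> 1] by simp
    then show "\<omega> + \<eta> \<in> {\<omega> \<in> ?E. \<Phi> \<omega> \<in> ?E}" using * sub(2) by simp
  next
    fix c \<omega> assume *: "\<omega> \<in> {\<omega> \<in> ?E. \<Phi> \<omega> \<in> ?E}"
    then have "\<Phi> (fscale sv c \<omega>) = fscale sv c (\<Phi> \<omega>)" using lin[of \<omega> 0 c] sub(1) \<Phi>0 by simp
    then show "fscale sv c \<omega> \<in> {\<omega> \<in> ?E. \<Phi> \<omega> \<in> ?E}" using * sub(3) by simp
  qed
  then have "?E \<subseteq> {\<omega> \<in> ?E. \<Phi> \<omega> \<in> ?E}"
    using fn.span_minimal[of "{tensor sv f v |f v. f \<in> exterior_dual sg \<and> v \<in> V}" "{\<omega> \<in> ?E. \<Phi> \<omega> \<in> ?E}"]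
      tensor_mem tensor by (auto simp: exterior_tensor_def[symmetric])
  then show ?thesis using \<omega> by blast
qed

lemma derivation_transpose_tensor:
  "derivation_transpose D (tensor sv f v) = tensor sv (derivation_transpose D f) v"
  by (simp add: derivation_transpose_def tensor_def fun_eq_iff md.scale_sum_left)

lemma derivation_transpose_exterior_tensor:
  assumes "\<omega> \<in> exterior_tensor sg sv V" "Vector_Spaces.linear sg sg D"
  shows "derivation_transpose D \<omega> \<in> exterior_tensor sg sv V"
proof (rule exterior_tensor_closed[OF assms(1)])
  show "derivation_transpose D (tensor sv f v) \<in> exterior_tensor sg sv V"
    if "f \<in> exterior_dual sg" "v \<in> V" for f v
    unfolding derivation_transpose_tensor
    using that dual.alternating_derivation_transpose[OF _ assms(2)]
    by (intro tensor_mem) (simp_all add: exterior_dual_eq_alternating)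
qed (simp_all add: derivation_transpose_def fscale_def fun_eq_iff sum.distrib md.scale_sum_right)

lemma Cons_exterior_tensor:
  assumes "\<omega> \<in> exterior_tensor sg sv V"
  shows "(\<lambda>xs. \<omega> (z # xs)) \<in> exterior_tensor sg sv V"
proof (rule exterior_tensor_closed[OF assms, where \<Phi> = "\<lambda>\<omega> xs. \<omega> (z # xs)"])
  show "(\<lambda>xs. tensor sv f v (z # xs)) \<in> exterior_tensor sg sv V"
    if "f \<in> exterior_dual sg" "v \<in> V" for f v
    using tensor_mem[of "\<lambda>xs. f (z # xs)" v] that dual.alternating_Cons
    by (simp add: exterior_dual_eq_alternating tensor_def)
qed (simp_all add: fscale_def fun_eq_iff)

lemma act_exterior_tensor:
  assumes "\<omega> \<in> exterior_tensor sg sv V"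
  shows "(\<lambda>xs. \<pi> x (\<omega> xs)) \<in> exterior_tensor sg sv V"
proof (rule exterior_tensor_closed[OF assms, where \<Phi> = "\<lambda>\<omega> xs. \<pi> x (\<omega> xs)"])
  show "(\<lambda>xs. \<pi> x (tensor sv f v xs)) \<in> exterior_tensor sg sv V"
    if "f \<in> exterior_dual sg" "v \<in> V" for f v
    using tensor_mem[OF that(1) act_mem[OF that(2)], of x] that(2) by (simp add: tensor_def act_scale)
qed (simp_all add: fscale_def fun_eq_iff act_0 act_add act_scale md.subspace_scale[OF subspace_V])

lemma ce_differential_linear:
  assumes "\<And>xs. \<omega> xs \<in> V" "\<And>xs. \<eta> xs \<in> V"
  shows "ce_differential br sv \<pi> (fscale sv c \<omega> + \<eta>) =
    fscale sv c (ce_differential br sv \<pi> \<omega>) + ce_differential br sv \<pi> \<eta>"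
  using assms
  by (simp add: ce_differential_def fscale_def fun_eq_iff act_add act_scale md.subspace_scale[OF subspace_V]
      md.scale_right_distrib sum.distrib md.scale_sum_right mult.commute add_ac)

lemma ce_differential_zero: "ce_differential br sv \<pi> 0 = 0"
  by (rule ext) (simp add: ce_differential_def act_0)

text \<open>The bracket sum commutes with the transpose because \<open>D\<close> is a derivation. In
  the first sum \<open>D\<close> also hits the argument \<open>xs ! i\<close> that acts through
  \<open>\<pi>\<close>, and these terms make up the defect.\<close>

lemma ce_differential_derivation_transpose:
  assumes \<omega>: "\<omega> \<in> exterior_tensor sg sv V" and D: "D \<in> Der sg br"
  shows "derivation_transpose D (ce_differential br sv \<pi> \<omega>) xs =
    ce_differential br sv \<pi> (derivation_transpose D \<omega>) xs
    + (\<Sum>i<length xs. sv ((-1) ^ i) (\<pi> (D (xs ! i)) (\<omega> (delete_nth i xs))))"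
proof -
  let ?d = "derivation_transpose D"
  let ?n = "length xs"
  note \<omega>V = exterior_tensorD(2)[OF \<omega>]
  have d_scale: "?d (\<lambda>ys. sv c (h ys)) xs = sv c (?d h xs)" for c h
    by (simp add: derivation_transpose_def md.scale_sum_right)
  have d_act: "?d (\<lambda>ys. \<pi> x (\<omega> ys)) ys = \<pi> x (?d \<omega> ys)" for x ys
    by (simp add: derivation_transpose_def act_sum \<omega>V)
  have first: "?d (\<lambda>ys. \<pi> (ys ! i) (\<omega> (delete_nth i ys))) xs
      = \<pi> (D (xs ! i)) (\<omega> (delete_nth i xs)) + \<pi> (xs ! i) (?d \<omega> (delete_nth i xs))" if "i < ?n" for i
    using derivation_transpose_delete_nth[OF that, of D "\<lambda>y l. \<pi> y (\<omega> l)"] by (simp add: d_act)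
  have second: "?d (\<lambda>ys. \<omega> (br (ys ! i) (ys ! j) # delete_nth i (delete_nth j ys))) xs
      = ?d \<omega> (br (xs ! i) (xs ! j) # delete_nth i (delete_nth j xs))" if ij: "i < j" and j: "j < ?n" for i j
  proof -
    let ?l = "delete_nth j xs"
    have i: "i < length ?l" using ij j by (simp add: length_delete_nth)
    \<comment> \<open>As \<open>i < j\<close>, the entry \<open>i\<close> can be read off after
      deleting position \<open>j\<close>. The product rule then applies twice, first at
      \<open>j\<close> and then at \<open>i\<close> in the shortened list.\<close>
    have "?d (\<lambda>ys. \<omega> (br (ys ! i) (ys ! j) # delete_nth i (delete_nth j ys))) xs
        = ?d (\<lambda>ys. \<omega> (br (delete_nth j ys ! i) (ys ! j) # delete_nth i (delete_nth j ys))) xs"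
      unfolding derivation_transpose_def using ij j by (intro sum.cong refl) (simp add: nth_delete_nth)
    also have "\<dots> = \<omega> (br (?l ! i) (D (xs ! j)) # delete_nth i ?l)
        + (\<omega> (br (D (?l ! i)) (xs ! j) # delete_nth i ?l)
           + ?d (\<lambda>m. \<omega> (br (?l ! i) (xs ! j) # m)) (delete_nth i ?l))"
      using derivation_transpose_delete_nth[OF j, of D "\<lambda>y l. \<omega> (br (l ! i) y # delete_nth i l)"]
        derivation_transpose_delete_nth[OF i, of D "\<lambda>y l. \<omega> (br y (xs ! j) # l)"]
      by simp
    also have "\<dots> = ?d \<omega> (br (?l ! i) (xs ! j) # delete_nth i ?l)"
      using forms.alternating_add[OF exterior_tensorD(1)[OF \<omega>], of "[]"]
      by (simp add: derivation_transpose_Cons Der_br[OF D] add_ac)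
    finally show ?thesis using ij j by (simp add: nth_delete_nth)
  qed
  have "?d (ce_differential br sv \<pi> \<omega>) xs = ?d (\<lambda>ys.
      (\<Sum>i<?n. sv ((-1) ^ i) (\<pi> (ys ! i) (\<omega> (delete_nth i ys)))) +
      (\<Sum>j<?n. \<Sum>i<j. sv ((-1) ^ (i + j)) (\<omega> (br (ys ! i) (ys ! j) # delete_nth i (delete_nth j ys))))) xs"
    by (simp add: derivation_transpose_def ce_differential_def)
  also have "\<dots> = (\<Sum>i<?n. sv ((-1) ^ i) (?d (\<lambda>ys. \<pi> (ys ! i) (\<omega> (delete_nth i ys))) xs))
      + (\<Sum>j<?n. \<Sum>i<j. sv ((-1) ^ (i + j)) (?d (\<lambda>ys. \<omega> (br (ys ! i) (ys ! j) # delete_nth i (delete_nth j ys))) xs))"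
    by (simp only: derivation_transpose_add derivation_transpose_sum d_scale)
  also have "\<dots> = (\<Sum>i<?n. sv ((-1) ^ i) (\<pi> (D (xs ! i)) (\<omega> (delete_nth i xs)) + \<pi> (xs ! i) (?d \<omega> (delete_nth i xs))))
      + (\<Sum>j<?n. \<Sum>i<j. sv ((-1) ^ (i + j)) (?d \<omega> (br (xs ! i) (xs ! j) # delete_nth i (delete_nth j xs))))"
    by (intro arg_cong2[where f = "(+)"] sum.cong refl) (simp_all add: first second)
  finally show ?thesis
    by (simp add: ce_differential_def md.scale_right_distrib sum.distrib add_ac)
qed

text \<open>The hypothesis on \<open>X\<close> turns the defect into the commutator of
  \<open>\<pi> X\<close> with the first sum of the differential. Leaving \<open>X\<close> free
  covers both \<open>psi\<close> and the Lie derivative along \<open>z\<close>, where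
  \<open>D = br z\<close> and \<open>X = z\<close>.\<close>

lemma ce_differential_commutes:
  assumes \<omega>: "\<omega> \<in> exterior_tensor sg sv V" and D: "D \<in> Der sg br"
    and X: "\<And>x v. v \<in> V \<Longrightarrow> \<pi> (D x) v = \<pi> X (\<pi> x v) - \<pi> x (\<pi> X v)"
  shows "ce_differential br sv \<pi> (- derivation_transpose D \<omega> + (\<lambda>xs. \<pi> X (\<omega> xs))) =
    - derivation_transpose D (ce_differential br sv \<pi> \<omega>) + (\<lambda>xs. \<pi> X (ce_differential br sv \<pi> \<omega> xs))"
proof
  fix xs :: "'g list"
  let ?n = "length xs"
  let ?ce = "ce_differential br sv \<pi>"
  note \<omega>V = exterior_tensorD(2)[OF \<omega>]
  note dV = exterior_tensorD(2)[OF derivation_transpose_exterior_tensor[OF \<omega> Der_linear[OF D]]]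
  have "?ce (- derivation_transpose D \<omega> + (\<lambda>xs. \<pi> X (\<omega> xs))) xs
      = - ?ce (derivation_transpose D \<omega>) xs + ?ce (\<lambda>xs. \<pi> X (\<omega> xs)) xs"
    using fun_cong[OF ce_differential_linear[of "derivation_transpose D \<omega>" "\<lambda>xs. \<pi> X (\<omega> xs)" "-1"], of xs]
      dV \<omega>V act_mem by (simp add: fscale_def fun_Compl_def)
  moreover have "\<pi> X (?ce \<omega> xs) = (\<Sum>i<?n. sv ((-1) ^ i) (\<pi> X (\<pi> (xs ! i) (\<omega> (delete_nth i xs))))) +
     (\<Sum>j<?n. \<Sum>i<j. sv ((-1) ^ (i + j)) (\<pi> X (\<omega> (br (xs ! i) (xs ! j) # delete_nth i (delete_nth j xs)))))"
    by (simp add: ce_differential_def act_add act_sum act_scale \<omega>V act_mem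
        md.subspace_scale[OF subspace_V] md.subspace_sum[OF subspace_V])
  moreover have "?ce (\<lambda>xs. \<pi> X (\<omega> xs)) xs = (\<Sum>i<?n. sv ((-1) ^ i) (\<pi> (xs ! i) (\<pi> X (\<omega> (delete_nth i xs))))) +
     (\<Sum>j<?n. \<Sum>i<j. sv ((-1) ^ (i + j)) (\<pi> X (\<omega> (br (xs ! i) (xs ! j) # delete_nth i (delete_nth j xs)))))"
    by (simp add: ce_differential_def)
  moreover have "(\<Sum>i<?n. sv ((-1) ^ i) (\<pi> (D (xs ! i)) (\<omega> (delete_nth i xs))))
      = (\<Sum>i<?n. sv ((-1) ^ i) (\<pi> X (\<pi> (xs ! i) (\<omega> (delete_nth i xs)))))
        - (\<Sum>i<?n. sv ((-1) ^ i) (\<pi> (xs ! i) (\<pi> X (\<omega> (delete_nth i xs)))))"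
    using \<omega>V by (simp add: X md.scale_right_diff_distrib sum_subtractf)
  ultimately show "?ce (- derivation_transpose D \<omega> + (\<lambda>xs. \<pi> X (\<omega> xs))) xs =
      (- derivation_transpose D (?ce \<omega>) + (\<lambda>xs. \<pi> X (?ce \<omega> xs))) xs"
    using ce_differential_derivation_transpose[OF \<omega> D, of xs] by simp
qed

text \<open>Inserting \<open>z\<close> as first argument is the contraction, and the right-hand side
  is the Lie derivative. Terms not involving \<open>z\<close> in a bracket or as the acting element
  occur in both differentials with opposite signs.\<close>

lemma cartan_formula:
  assumes \<omega>: "\<omega> \<in> exterior_tensor sg sv V"
  shows "ce_differential br sv \<pi> \<omega> (z # xs) + ce_differential br sv \<pi> (\<lambda>ys. \<omega> (z # ys)) xs =
    \<pi> z (\<omega> xs) - derivation_transpose (br z) \<omega> xs"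
proof -
  let ?n = "length xs"
  note alt = exterior_tensorD(1)[OF \<omega>]
  let ?A = "\<Sum>i<?n. sv ((-1) ^ i) (\<pi> (xs ! i) (\<omega> (z # delete_nth i xs)))"
  let ?B = "\<Sum>j<?n. \<Sum>i<j. sv ((-1) ^ (i + j)) (\<omega> (z # br (xs ! i) (xs ! j) # delete_nth i (delete_nth j xs)))"
  have swap: "\<omega> (br x y # z # l) = - \<omega> (z # br x y # l)" for x y l
    using forms.alternating_swap[OF alt, of "[]" "br x y" "[]" z l] by simp
  \<comment> \<open>In \<open>z # xs\<close> the pair formed by \<open>z\<close> and
    \<open>xs ! j\<close> has indices 0 and \<open>Suc j\<close>. Moving the bracket back to
    position \<open>j\<close> costs another \<open>(-1)^j\<close>, so a single minus sign is
    left.\<close>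
  have move: "sv ((-1) ^ Suc j) (\<omega> (br z (xs ! j) # delete_nth j xs)) = - \<omega> (xs[j := br z (xs ! j)])"
    if "j < ?n" for j
    by (simp add: forms.alternating_delete_nth[OF alt that] flip: power_mult_distrib)
  have "(\<Sum>i<length (z # xs). sv ((-1) ^ i) (\<pi> ((z # xs) ! i) (\<omega> (delete_nth i (z # xs))))) = \<pi> z (\<omega> xs) - ?A"
    by (simp add: sum.lessThan_Suc_shift sum_negf del: sum.lessThan_Suc)
  moreover have "(\<Sum>j<length (z # xs). \<Sum>i<j. sv ((-1) ^ (i + j))
      (\<omega> (br ((z # xs) ! i) ((z # xs) ! j) # delete_nth i (delete_nth j (z # xs)))))
      = (\<Sum>j<?n. sv ((-1) ^ Suc j) (\<omega> (br z (xs ! j) # delete_nth j xs))) - ?B"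
    by (simp add: sum.lessThan_Suc_shift swap sum.distrib sum_negf del: sum.lessThan_Suc power_Suc)
       (simp add: sum_negf sum_subtractf)
  moreover have "(\<Sum>j<?n. sv ((-1) ^ Suc j) (\<omega> (br z (xs ! j) # delete_nth j xs))) = - derivation_transpose (br z) \<omega> xs"
    unfolding derivation_transpose_def sum_negf[symmetric] by (intro sum.cong refl move) simp
  ultimately have "ce_differential br sv \<pi> \<omega> (z # xs) = \<pi> z (\<omega> xs) - ?A - derivation_transpose (br z) \<omega> xs - ?B"
    unfolding ce_differential_def by simp
  moreover have "ce_differential br sv \<pi> (\<lambda>ys. \<omega> (z # ys)) xs = ?A + ?B"
    unfolding ce_differential_def by simp
  ultimately show ?thesis by simp
qed

section \<open>Cochains of one degree and vanishing of cohomology\<close>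

lemma cochainsD:
  assumes "\<omega> \<in> cochains sg sv p V"
  shows "\<omega> \<in> exterior_tensor sg sv V" "length xs \<noteq> p \<Longrightarrow> \<omega> xs = 0"
  using assms by (auto simp: cochains_def)

lemma cochains_mem: "\<omega> \<in> cochains sg sv p V \<Longrightarrow> \<omega> xs \<in> V"
  by (rule exterior_tensorD(2)[OF cochainsD(1)])

lemma subspace_cochains: "fn.subspace (cochains sg sv p V)"
  using subspace_exterior_tensor
  by (auto simp: cochains_def fscale_def fn.subspace_def)

lemma derivation_transpose_cochains:
  assumes "\<omega> \<in> cochains sg sv p V" "Vector_Spaces.linear sg sg D"
  shows "derivation_transpose D \<omega> \<in> cochains sg sv p V"
  using derivation_transpose_exterior_tensor[OF cochainsD(1)[OF assms(1)] assms(2)] cochainsD(2)[OF assms(1)]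
  by (simp add: cochains_def derivation_transpose_def)

lemma act_cochains:
  assumes "\<omega> \<in> cochains sg sv p V"
  shows "(\<lambda>xs. \<pi> x (\<omega> xs)) \<in> cochains sg sv p V"
  using act_exterior_tensor[OF cochainsD(1)[OF assms]] cochainsD(2)[OF assms]
  by (simp add: cochains_def act_0)

lemma Cons_cochains:
  assumes "\<omega> \<in> cochains sg sv (Suc q) V"
  shows "(\<lambda>xs. \<omega> (z # xs)) \<in> cochains sg sv q V"
  using Cons_exterior_tensor[OF cochainsD(1)[OF assms]] cochainsD(2)[OF assms]
  by (simp add: cochains_def)

lemma subspace_cocycles: "fn.subspace (cocycles sg br sv p V \<pi>)"
proof (rule fn.subspaceI)
  show "0 \<in> cocycles sg br sv p V \<pi>"
    using fn.subspace_0[OF subspace_cochains] ce_differential_zero by (simp add: cocycles_def)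
next
  fix \<omega> \<eta> assume "\<omega> \<in> cocycles sg br sv p V \<pi>" "\<eta> \<in> cocycles sg br sv p V \<pi>"
  then have *: "\<omega> \<in> cochains sg sv p V" "\<eta> \<in> cochains sg sv p V"
    "ce_differential br sv \<pi> \<omega> = 0" "ce_differential br sv \<pi> \<eta> = 0" by (auto simp: cocycles_def)
  have "ce_differential br sv \<pi> (\<omega> + \<eta>) = 0"
    using ce_differential_linear[OF cochains_mem[OF *(1)] cochains_mem[OF *(2)], of 1] * by simp
  then show "\<omega> + \<eta> \<in> cocycles sg br sv p V \<pi>"
    using fn.subspace_add[OF subspace_cochains *(1,2)] by (simp add: cocycles_def)
next
  fix c \<omega> assume "\<omega> \<in> cocycles sg br sv p V \<pi>"
  then have *: "\<omega> \<in> cochains sg sv p V" "ce_differential br sv \<pi> \<omega> = 0" by (auto simp: cocycles_def)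
  have "ce_differential br sv \<pi> (fscale sv c \<omega>) = 0"
    using ce_differential_linear[OF cochains_mem[OF *(1)], of 0 c] *
    by (simp add: md.subspace_0[OF subspace_V] ce_differential_zero)
  then show "fscale sv c \<omega> \<in> cocycles sg br sv p V \<pi>"
    using fn.subspace_scale[OF subspace_cochains *(1)] by (simp add: cocycles_def)
qed

lemma subspace_coboundaries: "fn.subspace (coboundaries sg br sv p V \<pi>)"
proof (cases p)
  case 0
  then show ?thesis by (simp add: coboundaries_def)
next
  case (Suc q)
  let ?d = "ce_differential br sv \<pi>"
  have lin: "?d (fscale sv c \<omega> + \<eta>) = fscale sv c (?d \<omega>) + ?d \<eta>"
    if "\<omega> \<in> cochains sg sv q V" "\<eta> \<in> cochains sg sv q V" for c \<omega> \<eta>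
    by (rule ce_differential_linear[OF cochains_mem[OF that(1)] cochains_mem[OF that(2)]])
  note sub = fn.subspace_0[OF subspace_cochains] fn.subspace_add[OF subspace_cochains] fn.subspace_scale[OF subspace_cochains]
  have "fn.subspace (?d ` cochains sg sv q V)"
  proof (rule fn.subspaceI)
    show "0 \<in> ?d ` cochains sg sv q V" using ce_differential_zero sub(1) by (metis image_eqI)
  next
    fix x y assume "x \<in> ?d ` cochains sg sv q V" "y \<in> ?d ` cochains sg sv q V"
    then obtain \<omega> \<eta> where *: "\<omega> \<in> cochains sg sv q V" "\<eta> \<in> cochains sg sv q V" "x = ?d \<omega>" "y = ?d \<eta>" by blast
    then have "x + y = ?d (\<omega> + \<eta>)" using lin[of \<omega> \<eta> 1] by simp
    then show "x + y \<in> ?d ` cochains sg sv q V" using * sub(2) by blast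
  next
    fix c x assume "x \<in> ?d ` cochains sg sv q V"
    then obtain \<omega> where *: "\<omega> \<in> cochains sg sv q V" "x = ?d \<omega>" by blast
    then have "fscale sv c x = ?d (fscale sv c \<omega>)" using lin[of \<omega> 0 c] sub(1) by (simp add: ce_differential_zero)
    then show "fscale sv c x \<in> ?d ` cochains sg sv q V" using * sub(3) by blast
  qed
  then show ?thesis by (simp add: coboundaries_def Suc)
qed

text \<open>Each application of the derivation lowers the total height of the arguments by one.\<close>

lemma derivation_transpose_funpow_eq_0:
  assumes \<omega>: "\<omega> \<in> cochains sg sv p V" and nil: "\<And>y. (br z ^^ n) y = 0"
  shows "\<exists>k. (derivation_transpose (br z) ^^ k) \<omega> = 0"
proof -
  let ?d = "derivation_transpose (br z)"
  \<comment> \<open>The height of \<open>y\<close>: it drops strictly under \<open>br z\<close>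
    unless \<open>y = 0\<close>, and in that exceptional case the term vanishes by
    multilinearity.\<close>
  define h where "h y = (LEAST n. (br z ^^ n) y = 0)" for y
  have h0: "(br z ^^ h y) y = 0" for y unfolding h_def using nil by (rule LeastI)
  have hn: "h y \<le> n" for y unfolding h_def using nil by (rule Least_le)
  have h_br: "h (br z y) < h y" if "y \<noteq> 0" for y
  proof -
    have "h y \<noteq> 0" using h0[of y] that by (metis funpow_0)
    then obtain m where m: "h y = Suc m" using not0_implies_Suc by blast
    then have "(br z ^^ m) (br z y) = 0" using h0[of y] by (simp add: funpow_Suc_right del: funpow.simps)
    then have "h (br z y) \<le> m" unfolding h_def by (rule Least_le)
    then show ?thesis using m by simp
  qed
  have coch: "(?d ^^ k) \<omega> \<in> cochains sg sv p V" for k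
    by (induction k) (simp_all add: \<omega> derivation_transpose_cochains[OF _ linear_br])
  have vanish: "(?d ^^ k) \<omega> xs = 0" if "sum_list (map h xs) < k" for k xs
    using that
  proof (induction k arbitrary: xs)
    case (Suc k)
    note alt = exterior_tensorD(1)[OF cochainsD(1)[OF coch[of k]]]
    have "(?d ^^ k) \<omega> (xs[i := br z (xs ! i)]) = 0" if i: "i < length xs" for i
    proof (cases "xs ! i = 0")
      case True
      then have "xs[i := br z (xs ! i)] = take i xs @ 0 # drop (Suc i) xs"
        using i by (simp add: upd_conv_take_nth_drop)
      then show ?thesis using forms.alternating_zero_entry[OF alt] by simp
    next
      case False
      have "xs = take i xs @ xs ! i # drop (Suc i) xs" using i by (simp add: id_take_nth_drop)
      then have "sum_list (map h xs) = sum_list (map h (take i xs)) + (h (xs ! i) + sum_list (map h (drop (Suc i) xs)))"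
        by (metis list.simps(9) map_append sum_list.Cons sum_list_append)
      moreover have "sum_list (map h (xs[i := br z (xs ! i)]))
          = sum_list (map h (take i xs)) + (h (br z (xs ! i)) + sum_list (map h (drop (Suc i) xs)))"
        using i by (simp add: upd_conv_take_nth_drop)
      ultimately have "sum_list (map h (xs[i := br z (xs ! i)])) < k"
        using h_br[OF False] Suc.prems by linarith
      then show ?thesis by (rule Suc.IH)
    qed
    then show ?case by (simp add: derivation_transpose_def[of _ "(_ ^^ k) \<omega>"])
  qed simp
  \<comment> \<open>There are \<open>p\<close> arguments of height at most \<open>n\<close> each, so
    the total height is below \<open>Suc (p * n)\<close>; lists of other lengths give 0
    anyway.\<close>
  have "(?d ^^ Suc (p * n)) \<omega> = 0"
  proof
    fix xs
    show "(?d ^^ Suc (p * n)) \<omega> xs = 0 xs"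
    proof (cases "length xs = p")
      case True
      have "sum_list (map h xs) \<le> length xs * n"
        using hn by (induction xs) (simp_all add: add_mono)
      then show ?thesis using vanish[of xs "Suc (p * n)"] True by (simp del: funpow.simps)
    next
      case False
      then show ?thesis using cochainsD(2)[OF coch] by (simp del: funpow.simps)
    qed
  qed
  then show ?thesis by blast
qed

text \<open>The Lie derivative along \<open>z\<close> is null-homotopic by Cartan's formula, but here it is a nonzero
  scalar plus a nilpotent operator.\<close>

lemma cocycles_subset_coboundaries:
  assumes nil: "\<And>y. (br z ^^ n) y = 0" and z: "\<And>v. v \<in> V \<Longrightarrow> \<pi> z v = sv c v" and c: "c \<noteq> 0"
  shows "cocycles sg br sv p V \<pi> \<subseteq> coboundaries sg br sv p V \<pi>"
proof
  let ?d = "derivation_transpose (br z)"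
  let ?ce = "ce_differential br sv \<pi>"
  let ?B = "coboundaries sg br sv p V \<pi>"
  fix \<omega> assume \<omega>: "\<omega> \<in> cocycles sg br sv p V \<pi>"
  then obtain k where "(?d ^^ k) \<omega> = 0"
    using derivation_transpose_funpow_eq_0[OF _ nil] by (auto simp: cocycles_def)
  then show "\<omega> \<in> ?B" using \<omega>
  proof (induction k arbitrary: \<omega>)
    case 0
    then show ?case using fn.subspace_0[OF subspace_coboundaries] by (simp add: zero_fun_def)
  next
    case (Suc k)
    have coch: "\<omega> \<in> cochains sg sv p V" and ce: "?ce \<omega> = 0" using Suc.prems(2) by (auto simp: cocycles_def)
    note ET = cochainsD(1)[OF coch]
    note \<omega>V = exterior_tensorD(2)[OF ET]
    note dET = derivation_transpose_exterior_tensor[OF ET linear_br]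
    have zw: "(\<lambda>xs. \<pi> z (\<omega> xs)) = fscale sv c \<omega>" using z[OF \<omega>V] by (simp add: fscale_def)
    have z0: "(\<lambda>xs. \<pi> z (0 xs)) = 0" by (simp add: fun_eq_iff act_0)
    \<comment> \<open>The Lie derivative along \<open>z\<close> commutes with the differential. As
      \<open>\<pi> z\<close> is the scalar \<open>c\<close>, it follows that \<open>?d\<close> alone
      maps cocycles to cocycles.\<close>
    have "?ce (- ?d \<omega> + fscale sv c \<omega>) = - ?d 0 + 0"
      using ce_differential_commutes[OF ET br_Der, of z z] act_br unfolding zw ce z0 by simp
    also have "?d 0 = (0 :: 'g list \<Rightarrow> 'v)" by (simp add: fun_eq_iff derivation_transpose_def)
    also have "- 0 + 0 = (0 :: 'g list \<Rightarrow> 'v)" by (simp add: fun_eq_iff)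
    finally have "?ce (- ?d \<omega> + fscale sv c \<omega>) = 0" .
    moreover have "- ?d \<omega> + fscale sv c \<omega> = fscale sv (-1) (?d \<omega>) + fscale sv c \<omega>"
      by (simp add: fscale_def fun_eq_iff)
    moreover have "?ce (fscale sv c \<omega>) = 0"
      using ce_differential_linear[OF \<omega>V, of 0 c] md.subspace_0[OF subspace_V] by (simp add: ce ce_differential_zero)
    ultimately have "fscale sv (-1) (?ce (?d \<omega>)) = 0"
      using ce_differential_linear[of "?d \<omega>" "fscale sv c \<omega>" "-1"] exterior_tensorD(2)[OF dET]
        exterior_tensorD(2)[OF fn.subspace_scale[OF subspace_exterior_tensor ET]] by simp
    then have "?ce (?d \<omega>) = 0" by simp
    then have "?d \<omega> \<in> cocycles sg br sv p V \<pi>"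
      using derivation_transpose_cochains[OF coch linear_br] by (simp add: cocycles_def)
    moreover have "(?d ^^ k) (?d \<omega>) = 0" using Suc.prems(1) unfolding funpow_Suc_right comp_apply .
    ultimately have dB: "?d \<omega> \<in> ?B" using Suc.IH by blast
    \<comment> \<open>Cartan's formula for a cocycle. As \<open>?d \<omega>\<close> is a coboundary
      by induction, so is \<open>c \<omega>\<close>, and \<open>c\<close> is invertible.\<close>
    have "fscale sv c \<omega> - ?d \<omega> = ?ce (\<lambda>ys. \<omega> (z # ys))"
      using cartan_formula[OF ET, of z] fun_cong[OF zw] by (simp add: ce fun_eq_iff)
    moreover have "?ce (\<lambda>ys. \<omega> (z # ys)) \<in> ?B"
    proof (cases p)
      case 0
      \<comment> \<open>In degree 0 there is no lower cochain, but the contraction vanishes since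
        \<open>z # ys\<close> is never empty.\<close>
      then have "(\<lambda>ys. \<omega> (z # ys)) = 0" using cochainsD(2)[OF coch] by (simp add: fun_eq_iff)
      then show ?thesis using fn.subspace_0[OF subspace_coboundaries] ce_differential_zero by simp
    next
      case (Suc q)
      then show ?thesis using Cons_cochains[of \<omega> q z] coch by (simp add: coboundaries_def)
    qed
    ultimately have "fscale sv c \<omega> \<in> ?B"
      using fn.subspace_add[OF subspace_coboundaries dB] by (metis diff_add_cancel add.commute)
    from fn.subspace_scale[OF subspace_coboundaries this, of "inverse c"]
    show ?case using c by simp
  qed
qed

end

section \<open>Actions on quotients\<close>

lemma lie_action_subset:
  assumes "lie_action sL brL L sW W \<rho>" "Z \<subseteq> W" "\<And>x w. x \<in> L \<Longrightarrow> w \<in> Z \<Longrightarrow> \<rho> x w \<in> Z"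
  shows "lie_action sL brL L sW Z \<rho>"
  using assms unfolding lie_action_def by (simp add: subset_iff)

lemma coset_plus_coset:
  fixes B :: "'a::ab_group_add set"
  assumes "B + B = B"
  shows "(v +o B) + (w +o B) = (v + w) +o B"
  by (simp add: set_plus_rearrange assms)

lemma quotient_map_coset:
  fixes B :: "'a::ab_group_add set"
  assumes "B + B = B" "\<phi> ` B \<subseteq> B" "0 \<in> B" "\<phi> 0 = 0" "\<And>b. b \<in> B \<Longrightarrow> \<phi> (z + b) = \<phi> z + \<phi> b"
  shows "quotient_map B \<phi> (z +o B) = \<phi> z +o B"
proof
  show "quotient_map B \<phi> (z +o B) \<subseteq> \<phi> z +o B"
  proof
    fix y assume "y \<in> quotient_map B \<phi> (z +o B)"
    then obtain b b' where b: "b \<in> B" "b' \<in> B" "y = \<phi> (z + b) + b'"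
      by (auto simp: quotient_map_def elt_set_plus_def elim!: set_plus_elim)
    then have "\<phi> b + b' \<in> B" using assms(1,2) by (metis image_subset_iff set_plus_intro)
    then show "y \<in> \<phi> z +o B" using b assms(5) by (auto simp: elt_set_plus_def add.assoc)
  qed
  show "\<phi> z +o B \<subseteq> quotient_map B \<phi> (z +o B)"
  proof
    fix y assume "y \<in> \<phi> z +o B"
    then obtain b where b: "b \<in> B" "y = \<phi> z + b" by (auto simp: elt_set_plus_def)
    have "z \<in> z +o B" using assms(3) by (auto simp: elt_set_plus_def)
    then show "y \<in> quotient_map B \<phi> (z +o B)" using b by (auto simp: quotient_map_def)
  qed
qed

text \<open>Every identity on \<open>Z\<close> is carried to representatives of cosets. Additivity
  between \<open>Z\<close> and \<open>B\<close> is a separate hypothesis because \<open>B\<close> is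
  not assumed to lie in \<open>Z\<close>.\<close>

lemma (in vector_space) lie_action_quotient:
  assumes Z: "subspace Z" and B: "subspace B"
    and L: "\<And>x y. x \<in> L \<Longrightarrow> y \<in> L \<Longrightarrow> x + y \<in> L" "\<And>c x. x \<in> L \<Longrightarrow> sL c x \<in> L"
      "\<And>x y. x \<in> L \<Longrightarrow> y \<in> L \<Longrightarrow> brL x y \<in> L"
    and act: "lie_action sL brL L scale Z \<rho>" and \<rho>B: "\<And>x. x \<in> L \<Longrightarrow> \<rho> x ` B \<subseteq> B"
    and \<rho>_add: "\<And>x z b. x \<in> L \<Longrightarrow> z \<in> Z \<Longrightarrow> b \<in> B \<Longrightarrow> \<rho> x (z + b) = \<rho> x z + \<rho> x b"
  shows "lie_action sL brL L (\<lambda>c. quotient_map B (scale c)) {z +o B |z. z \<in> Z} (\<lambda>x. quotient_map B (\<rho> x))"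
proof -
  \<comment> \<open>Cosets are added elementwise as sets; this identity makes such a sum a coset of
    \<open>B\<close> again.\<close>
  have BB: "B + B = B"
  proof
    show "B + B \<subseteq> B" using subspace_add[OF B] by (auto elim!: set_plus_elim)
    show "B \<subseteq> B + B" using subspace_0[OF B] by (rule set_zero_plus2)
  qed
  have closed: "\<rho> x w \<in> Z" and add: "\<rho> x (v + w) = \<rho> x v + \<rho> x w"
    and sc: "\<rho> x (scale c w) = scale c (\<rho> x w)"
    and ladd: "y \<in> L \<Longrightarrow> \<rho> (x + y) w = \<rho> x w + \<rho> y w"
    and lsc: "\<rho> (sL c x) w = scale c (\<rho> x w)"
    and brk: "y \<in> L \<Longrightarrow> \<rho> (brL x y) w + \<rho> y (\<rho> x w) = \<rho> x (\<rho> y w)"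
    if "x \<in> L" "v \<in> Z" "w \<in> Z" for x y v w c
    using act that unfolding lie_action_def by blast+
  have \<rho>0: "\<rho> x 0 = 0" if "x \<in> L" for x
    using sc[OF that subspace_0[OF Z] subspace_0[OF Z], of 0] by simp
  have coset: "quotient_map B (\<rho> x) (z +o B) = \<rho> x z +o B" if "x \<in> L" "z \<in> Z" for x z
    using that by (intro quotient_map_coset BB \<rho>B subspace_0[OF B] \<rho>0 \<rho>_add)
  have scoset: "quotient_map B (scale c) (z +o B) = scale c z +o B" for c z
    by (rule quotient_map_coset) (use BB subspace_0[OF B] subspace_scale[OF B] in \<open>auto simp: scale_right_distrib\<close>)
  show ?thesis
    unfolding lie_action_def
  proof (intro conjI ballI allI; clarify)
    fix x z assume x: "x \<in> L" and z: "z \<in> Z"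
    show "\<exists>z'. quotient_map B (\<rho> x) (z +o B) = z' +o B \<and> z' \<in> Z"
      using coset[OF x z] closed[OF x z z] by blast
  next
    fix x z w assume x: "x \<in> L" and z: "z \<in> Z" and w: "w \<in> Z"
    show "quotient_map B (\<rho> x) (z +o B + (w +o B)) = quotient_map B (\<rho> x) (z +o B) + quotient_map B (\<rho> x) (w +o B)"
      using coset[OF x] z w subspace_add[OF Z] add[OF x z w] by (simp add: coset_plus_coset[OF BB])
  next
    fix x c z assume x: "x \<in> L" and z: "z \<in> Z"
    show "quotient_map B (\<rho> x) (quotient_map B (scale c) (z +o B)) = quotient_map B (scale c) (quotient_map B (\<rho> x) (z +o B))"
      using coset[OF x] z subspace_scale[OF Z] sc[OF x z z] by (simp add: scoset)
  next
    fix x y z assume x: "x \<in> L" and y: "y \<in> L" and z: "z \<in> Z"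
    show "quotient_map B (\<rho> (x + y)) (z +o B) = quotient_map B (\<rho> x) (z +o B) + quotient_map B (\<rho> y) (z +o B)"
      using ladd[OF x z z y] coset x y z L(1) by (simp add: coset_plus_coset[OF BB])
  next
    fix x c z assume x: "x \<in> L" and z: "z \<in> Z"
    show "quotient_map B (\<rho> (sL c x)) (z +o B) = quotient_map B (scale c) (quotient_map B (\<rho> x) (z +o B))"
      using lsc[OF x z z] coset x z L(2) by (simp add: scoset)
  next
    fix x y z assume x: "x \<in> L" and y: "y \<in> L" and z: "z \<in> Z"
    show "quotient_map B (\<rho> (brL x y)) (z +o B) + quotient_map B (\<rho> y) (quotient_map B (\<rho> x) (z +o B))
        = quotient_map B (\<rho> x) (quotient_map B (\<rho> y) (z +o B))"
      using coset closed[OF x z z] closed[OF y z z] x y z L(3) brk[OF x z z y] by (simp add: coset_plus_coset[OF BB])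
  qed
qed

section \<open>The action of the derivations\<close>

context fin_dim_lie_algebra
begin

section \<open>The inner element of a derivation and the closure of \<open>Der0\<close>\<close>

lemma inner_elem_unique:
  assumes ss: "lie_semisimple sg br g0" and X: "X \<in> g0" "\<And>y. y \<in> g0 \<Longrightarrow> D y = br X y"
  shows "inner_elem br g0 D = X"
  unfolding inner_elem_def
proof (rule the_equality)
  show "X \<in> g0 \<and> (\<forall>y\<in>g0. D y = br X y)" using X by blast
  fix Y assume Y: "Y \<in> g0 \<and> (\<forall>y\<in>g0. D y = br Y y)"
  have "subspace g0" using ss by (simp add: lie_semisimple_def lie_subalgebra_def)
  then have "Y - X \<in> g0" using X Y by (simp add: subspace_diff)
  moreover have "br (Y - X) y = 0" if "y \<in> g0" for y using X(2)[OF that] Y that by (simp add: br_diff_left)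
  ultimately have "Y - X = 0" by (rule semisimple_centralizer[OF ss])
  then show "Y = X" by simp
qed

lemma inner_elem_Der0:
  assumes ss: "lie_semisimple sg br g0" and D: "D \<in> Der0 sg br g0"
  shows "inner_elem br g0 D \<in> g0" "y \<in> g0 \<Longrightarrow> D y = br (inner_elem br g0 D) y"
proof -
  obtain X where "X \<in> g0" "\<And>y. y \<in> g0 \<Longrightarrow> D y = br X y"
    using derivation_semisimple_inner[OF ss, of D] D by (auto simp: Der0_def)
  moreover from this have "inner_elem br g0 D = X" by (rule inner_elem_unique[OF ss])
  ultimately show "inner_elem br g0 D \<in> g0" "y \<in> g0 \<Longrightarrow> D y = br (inner_elem br g0 D) y" by auto
qed

lemma Der0_linear: "D \<in> Der0 sg br g0 \<Longrightarrow> Vector_Spaces.linear sg sg D"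
  using Der_linear by (simp add: Der0_def)

lemma Der0_closed:
  assumes g0: "subspace g0" and D: "D \<in> Der0 sg br g0" and E: "E \<in> Der0 sg br g0"
  shows "D + E \<in> Der0 sg br g0" "fscale sg c D \<in> Der0 sg br g0" "commutator D E \<in> Der0 sg br g0"
proof -
  have D': "Vector_Spaces.linear sg sg D" "\<And>x y. D (br x y) = br (D x) y + br x (D y)" "\<And>y. y \<in> g0 \<Longrightarrow> D y \<in> g0"
    and E': "Vector_Spaces.linear sg sg E" "\<And>x y. E (br x y) = br (E x) y + br x (E y)" "\<And>y. y \<in> g0 \<Longrightarrow> E y \<in> g0"
    using D E by (auto simp: Der0_def Der_def)
  note lin = linear_add[OF D'(1)] linear_scale[OF D'(1)] linear_add[OF E'(1)] linear_scale[OF E'(1)]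
  have "Vector_Spaces.linear sg sg (D + E)" "Vector_Spaces.linear sg sg (fscale sg c D)"
    "Vector_Spaces.linear sg sg (commutator D E)"
    by (simp_all add: Vector_Spaces.linear_iff vector_space_axioms lin fscale_def commutator_def
        scale_right_distrib scale_right_diff_distrib add_ac mult.commute)
  then show "D + E \<in> Der0 sg br g0" "fscale sg c D \<in> Der0 sg br g0" "commutator D E \<in> Der0 sg br g0"
    using D'(2,3) E'(2,3) subspace_add[OF g0] subspace_scale[OF g0] subspace_diff[OF g0]
    by (auto simp: Der0_def Der_def fscale_def commutator_def lin br_add_left br_add_right br_scale_left
        br_scale_right br_diff_left br_diff_right scale_right_distrib add_ac)
qed

lemma Der0_mem: "D \<in> Der0 sg br g0 \<Longrightarrow> y \<in> g0 \<Longrightarrow> D y \<in> g0"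
  by (auto simp: Der0_def)

end

text \<open>The degree \<open>p\<close> is only where nonvanishing is assumed. The resulting
  identity for \<open>\<pi>\<close> is independent of the degree, so the results on
  \<open>psi\<close> hold in every degree \<open>q\<close>.\<close>

locale levi_irrep = lie_module sg br sv V \<pi>
  for sg :: "'k::{alg_closed_field, field_char_0} \<Rightarrow> 'g::ab_group_add \<Rightarrow> 'g"
    and br :: "'g \<Rightarrow> 'g \<Rightarrow> 'g"
    and sv :: "'k \<Rightarrow> 'v::ab_group_add \<Rightarrow> 'v" and V \<pi> +
  fixes g0 s :: "'g set" and p :: nat
  assumes levi: "levi_decomposition sg br g0 s"
    and irreducible: "irreducible_rep sg br sv V \<pi>"
    and nonzero: "cohomology sg br sv p V \<pi> \<noteq> {coboundaries sg br sv p V \<pi>}"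
begin

lemma semisimple: "lie_semisimple sg br g0"
  using levi by (simp add: levi_decomposition_def)

lemma radical: "solvable_radical sg br s" "lie_ideal sg br s UNIV" "lie_solvable sg br s"
  using levi by (auto simp: levi_decomposition_def solvable_radical_def)

lemmas inner_mem = inner_elem_Der0(1)[OF semisimple]
lemmas inner_eq = inner_elem_Der0(2)[OF semisimple]

lemma not_cocycles_subset_coboundaries: "\<not> cocycles sg br sv p V \<pi> \<subseteq> coboundaries sg br sv p V \<pi>"
proof
  let ?B = "coboundaries sg br sv p V \<pi>"
  assume sub: "cocycles sg br sv p V \<pi> \<subseteq> ?B"
  have "z +o ?B = ?B" if z: "z \<in> ?B" for z
  proof
    show "z +o ?B \<subseteq> ?B"
      using fn.subspace_add[OF subspace_coboundaries z] by (auto simp: elt_set_plus_def)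
    show "?B \<subseteq> z +o ?B"
    proof
      fix x assume "x \<in> ?B"
      then have "x - z \<in> ?B" using z by (rule fn.subspace_diff[OF subspace_coboundaries])
      then show "x \<in> z +o ?B" by (rule set_minus_imp_plus)
    qed
  qed
  then have "cohomology sg br sv p V \<pi> = {?B}"
    using sub fn.subspace_0[OF subspace_cocycles] unfolding cohomology_def by blast
  then show False using nonzero by simp
qed

text \<open>Precisely the condition on \<open>D\<close> and \<open>X\<close> in
  \<open>ce_differential_commutes\<close>. It holds for \<open>ad X\<close> because
  \<open>\<pi>\<close> is a representation, so what has to be shown is that
  \<open>E = D - ad X\<close> acts by zero.\<close>

lemma act_Der0:
  assumes D: "D \<in> Der0 sg br g0" and v: "v \<in> V"
  shows "\<pi> (D x) v = \<pi> (inner_elem br g0 D) (\<pi> x v) - \<pi> x (\<pi> (inner_elem br g0 D) v)"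
proof -
  let ?X = "inner_elem br g0 D"
  define E where "E y = D y - br ?X y" for y
  have "D \<in> Der sg br" using D by (simp add: Der0_def)
  then have E: "E \<in> Der sg br" unfolding E_def by (rule Der_br_diff)
  have Es: "E ` s \<subseteq> s" by (rule solvable_radical_Der[OF E radical(1)])
  have Eu: "\<pi> (E u) w = 0" if u: "u \<in> s" and w: "w \<in> V" for u w
  proof -
    obtain n where nil: "\<And>y. (br (E u) ^^ n) y = 0"
      using ad_Der_nilpotent[OF E radical(2,3) Es u] by blast
    obtain \<nu> where \<nu>: "\<And>u v. u \<in> s \<Longrightarrow> v \<in> V \<Longrightarrow> \<pi> u v = sv (\<nu> u) v"
      using irreducible_rep_solvable_ideal[OF md.vector_space_axioms irreducible radical(2,3)] by blast
    have Eus: "E u \<in> s" using Es u by blast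
    have "\<nu> (E u) = 0"
    proof (rule ccontr)
      assume "\<nu> (E u) \<noteq> 0"
      then have "cocycles sg br sv p V \<pi> \<subseteq> coboundaries sg br sv p V \<pi>"
        using cocycles_subset_coboundaries[OF nil \<nu>[OF Eus]] by blast
      then show False using not_cocycles_subset_coboundaries by blast
    qed
    then show ?thesis using \<nu>[OF Eus w] by simp
  qed
  have "x \<in> g0 + s" using levi by (simp add: levi_decomposition_def)
  then obtain y u where y: "y \<in> g0" and u: "u \<in> s" and x: "x = y + u" by (auto elim: set_plus_elim)
  have "E y = 0" using inner_eq[OF D y] by (simp add: E_def)
  then have "E x = E u" by (simp add: x linear_add[OF Der_linear[OF E]])
  moreover have "D x = E x + br ?X x" by (simp add: E_def)
  ultimately have "\<pi> (D x) v = \<pi> (E u) v + \<pi> (br ?X x) v" using v by (simp add: act_add_left)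
  then show ?thesis using Eu[OF u v] act_br[OF v] by simp
qed

section \<open>The operators \<open>psi\<close> on cochains, cocycles and coboundaries\<close>

lemma psi_apply: "psi br g0 \<pi> D \<omega> xs = - derivation_transpose D \<omega> xs + \<pi> (inner_elem br g0 D) (\<omega> xs)"
  by (simp add: psi_def)

lemma psi_tensor:
  assumes "v \<in> V"
  shows "psi br g0 \<pi> D (tensor sv f v) =
    tensor sv (- derivation_transpose D f) v + tensor sv f (\<pi> (inner_elem br g0 D) v)"
  using assms by (simp add: fun_eq_iff psi_apply derivation_transpose_tensor) (simp add: tensor_def act_scale)

lemma psi_exterior_tensor:
  assumes "D \<in> Der0 sg br g0" "\<omega> \<in> exterior_tensor sg sv V"
  shows "psi br g0 \<pi> D \<omega> \<in> exterior_tensor sg sv V"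
  unfolding psi_def
  using assms act_exterior_tensor derivation_transpose_exterior_tensor[OF _ Der0_linear]
  by (intro fn.subspace_add[OF subspace_exterior_tensor] fn.subspace_neg[OF subspace_exterior_tensor]) auto

lemma psi_cochains:
  assumes "D \<in> Der0 sg br g0" "\<omega> \<in> cochains sg sv q V"
  shows "psi br g0 \<pi> D \<omega> \<in> cochains sg sv q V"
  unfolding psi_def
  using assms act_cochains derivation_transpose_cochains[OF _ Der0_linear]
  by (intro fn.subspace_add[OF subspace_cochains] fn.subspace_neg[OF subspace_cochains]) auto

lemma psi_zero: "psi br g0 \<pi> D 0 = 0"
  by (simp add: fun_eq_iff psi_apply derivation_transpose_def act_0)

lemma ce_differential_psi:
  assumes D: "D \<in> Der0 sg br g0" and \<omega>: "\<omega> \<in> exterior_tensor sg sv V"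
  shows "ce_differential br sv \<pi> (psi br g0 \<pi> D \<omega>) = psi br g0 \<pi> D (ce_differential br sv \<pi> \<omega>)"
  unfolding psi_def using D by (intro ce_differential_commutes[OF \<omega>] act_Der0) (simp_all add: Der0_def)

lemma psi_cocycles:
  assumes D: "D \<in> Der0 sg br g0"
  shows "psi br g0 \<pi> D ` cocycles sg br sv q V \<pi> \<subseteq> cocycles sg br sv q V \<pi>"
proof (rule image_subsetI)
  fix \<omega> assume "\<omega> \<in> cocycles sg br sv q V \<pi>"
  then have "\<omega> \<in> cochains sg sv q V" "ce_differential br sv \<pi> \<omega> = 0" by (auto simp: cocycles_def)
  then show "psi br g0 \<pi> D \<omega> \<in> cocycles sg br sv q V \<pi>"
    using ce_differential_psi[OF D cochainsD(1)] psi_cochains[OF D] by (simp add: cocycles_def psi_zero)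
qed

lemma psi_coboundaries:
  assumes D: "D \<in> Der0 sg br g0"
  shows "psi br g0 \<pi> D ` coboundaries sg br sv q V \<pi> \<subseteq> coboundaries sg br sv q V \<pi>"
proof (cases q)
  case 0
  then show ?thesis by (simp add: coboundaries_def psi_zero)
next
  case (Suc m)
  have "psi br g0 \<pi> D (ce_differential br sv \<pi> \<omega>) \<in> ce_differential br sv \<pi> ` cochains sg sv m V"
    if "\<omega> \<in> cochains sg sv m V" for \<omega>
    using ce_differential_psi[OF D cochainsD(1)[OF that]] psi_cochains[OF D that] by (metis image_eqI)
  then show ?thesis by (auto simp: coboundaries_def Suc)
qed

lemma inner_elem_plus:
  assumes "D \<in> Der0 sg br g0" "E \<in> Der0 sg br g0"
  shows "inner_elem br g0 (D + E) = inner_elem br g0 D + inner_elem br g0 E"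
proof (rule inner_elem_unique[OF semisimple])
  have "subspace g0" using semisimple by (simp add: lie_semisimple_def lie_subalgebra_def)
  then show "inner_elem br g0 D + inner_elem br g0 E \<in> g0" using inner_mem assms by (simp add: subspace_add)
  show "(D + E) y = br (inner_elem br g0 D + inner_elem br g0 E) y" if "y \<in> g0" for y
    using inner_eq[OF assms(1) that] inner_eq[OF assms(2) that] by (simp add: br_add_left)
qed

lemma inner_elem_scale:
  assumes "D \<in> Der0 sg br g0"
  shows "inner_elem br g0 (fscale sg c D) = sg c (inner_elem br g0 D)"
proof (rule inner_elem_unique[OF semisimple])
  have "subspace g0" using semisimple by (simp add: lie_semisimple_def lie_subalgebra_def)
  then show "sg c (inner_elem br g0 D) \<in> g0" using inner_mem assms by (simp add: subspace_scale)
  show "fscale sg c D y = br (sg c (inner_elem br g0 D)) y" if "y \<in> g0" for y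
    using inner_eq[OF assms that] by (simp add: br_scale_left fscale_def)
qed

lemma inner_elem_commutator:
  assumes "D \<in> Der0 sg br g0" "E \<in> Der0 sg br g0"
  shows "inner_elem br g0 (commutator D E) = br (inner_elem br g0 D) (inner_elem br g0 E)"
proof (rule inner_elem_unique[OF semisimple])
  show "br (inner_elem br g0 D) (inner_elem br g0 E) \<in> g0"
    using inner_mem assms semisimple by (simp add: lie_semisimple_def lie_subalgebra_def)
  show "commutator D E y = br (br (inner_elem br g0 D) (inner_elem br g0 E)) y" if "y \<in> g0" for y
    using inner_eq[OF assms(1)] inner_eq[OF assms(2)] that Der0_mem[OF assms(1) that] Der0_mem[OF assms(2) that]
    by (simp add: commutator_def br_br[of "inner_elem br g0 D"])
qed

lemma derivation_transpose_psi:
  assumes "\<omega> \<in> exterior_tensor sg sv V"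
  shows "derivation_transpose E (psi br g0 \<pi> D \<omega>) xs =
    - derivation_transpose E (derivation_transpose D \<omega>) xs + \<pi> (inner_elem br g0 D) (derivation_transpose E \<omega> xs)"
  unfolding derivation_transpose_def[of E]
  by (simp add: psi_apply sum_subtractf act_sum exterior_tensorD(2)[OF assms])

lemma psi_plus:
  assumes "\<And>xs. \<omega> xs \<in> V" "\<And>xs. \<eta> xs \<in> V"
  shows "psi br g0 \<pi> D (\<omega> + \<eta>) = psi br g0 \<pi> D \<omega> + psi br g0 \<pi> D \<eta>"
  using assms by (simp add: fun_eq_iff psi_apply act_add) (simp add: derivation_transpose_def sum.distrib)

text \<open>Minus the transpose and \<open>\<pi>\<close> of the inner element are each compatible
  with brackets, the latter because \<open>D |-> X_D\<close> is a homomorphism by uniqueness, and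
  the two commute with each other.\<close>

lemma psi_action:
  "lie_action (fscale sg) commutator (Der0 sg br g0) (fscale sv) (exterior_tensor sg sv V) (psi br g0 \<pi>)"
  unfolding lie_action_def
proof (intro conjI ballI allI)
  fix D \<omega> assume D: "D \<in> Der0 sg br g0" and \<omega>: "\<omega> \<in> exterior_tensor sg sv V"
  note \<omega>V = exterior_tensorD(2)[OF \<omega>]
  note alt = exterior_tensorD(1)[OF \<omega>]
  show "psi br g0 \<pi> D \<omega> \<in> exterior_tensor sg sv V" by (rule psi_exterior_tensor[OF D \<omega>])
  show "psi br g0 \<pi> D (\<omega> + \<eta>) = psi br g0 \<pi> D \<omega> + psi br g0 \<pi> D \<eta>" if "\<eta> \<in> exterior_tensor sg sv V" for \<eta>
    by (rule psi_plus[OF \<omega>V exterior_tensorD(2)[OF that]])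
  show "psi br g0 \<pi> D (fscale sv c \<omega>) = fscale sv c (psi br g0 \<pi> D \<omega>)" for c
    using \<omega>V by (simp add: fun_eq_iff psi_apply fscale_def act_scale md.scale_right_distrib)
       (simp add: derivation_transpose_def md.scale_sum_right md.scale_right_diff_distrib)
  show "psi br g0 \<pi> (D + E) \<omega> = psi br g0 \<pi> D \<omega> + psi br g0 \<pi> E \<omega>" if E: "E \<in> Der0 sg br g0" for E
  proof -
    have "derivation_transpose (D + E) \<omega> xs = derivation_transpose D \<omega> xs + derivation_transpose E \<omega> xs" for xs
      unfolding derivation_transpose_def sum.distrib[symmetric]
      using forms.alternating_add[OF alt]
      by (intro sum.cong refl) (simp add: upd_conv_take_nth_drop)
    then show ?thesis using \<omega>V by (simp add: fun_eq_iff psi_apply inner_elem_plus[OF D E] act_add_left)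
  qed
  show "psi br g0 \<pi> (fscale sg c D) \<omega> = fscale sv c (psi br g0 \<pi> D \<omega>)" for c
  proof -
    have "derivation_transpose (fscale sg c D) \<omega> xs = sv c (derivation_transpose D \<omega> xs)" for xs
      unfolding derivation_transpose_def md.scale_sum_right
      using forms.alternating_scale[OF alt]
      by (intro sum.cong refl) (simp add: upd_conv_take_nth_drop fscale_def)
    then show ?thesis
      using \<omega>V
      by (simp add: fun_eq_iff psi_apply inner_elem_scale[OF D] act_scale_left fscale_def[of sv] md.scale_right_diff_distrib)
  qed
  show "psi br g0 \<pi> (commutator D E) \<omega> + psi br g0 \<pi> E (psi br g0 \<pi> D \<omega>) = psi br g0 \<pi> D (psi br g0 \<pi> E \<omega>)"
    if E: "E \<in> Der0 sg br g0" for E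
  proof
    fix xs
    have dV: "derivation_transpose F \<omega> xs \<in> V" if "F \<in> Der0 sg br g0" for F
      by (rule exterior_tensorD(2)[OF derivation_transpose_exterior_tensor[OF \<omega> Der0_linear[OF that]]])
    \<comment> \<open>The mixed terms are symmetric in \<open>A\<close> and \<open>B\<close>, so
      they drop out of the commutator.\<close>
    have nested: "psi br g0 \<pi> A (psi br g0 \<pi> B \<omega>) xs = derivation_transpose A (derivation_transpose B \<omega>) xs
        - \<pi> (inner_elem br g0 B) (derivation_transpose A \<omega> xs) - \<pi> (inner_elem br g0 A) (derivation_transpose B \<omega> xs)
        + \<pi> (inner_elem br g0 A) (\<pi> (inner_elem br g0 B) (\<omega> xs))" if "A \<in> Der0 sg br g0" "B \<in> Der0 sg br g0" for A B
      using act_diff[OF act_mem[OF \<omega>V] dV[OF that(2)]]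
      by (simp add: psi_apply[of A] derivation_transpose_psi[OF \<omega>]) (simp add: psi_apply)
    show "(psi br g0 \<pi> (commutator D E) \<omega> + psi br g0 \<pi> E (psi br g0 \<pi> D \<omega>)) xs = psi br g0 \<pi> D (psi br g0 \<pi> E \<omega>) xs"
      using \<omega>V
      by (simp add: nested[OF D E] nested[OF E D] psi_apply[of "commutator D E"] inner_elem_commutator[OF D E] act_br
          forms.derivation_transpose_commutator[OF alt])
  qed
qed

lemma ce_differential_mem:
  assumes "\<And>xs. \<omega> xs \<in> V"
  shows "ce_differential br sv \<pi> \<omega> xs \<in> V"
  unfolding ce_differential_def
  by (intro md.subspace_add[OF subspace_V] md.subspace_sum[OF subspace_V] md.subspace_scale[OF subspace_V] act_mem assms)

lemma coboundaries_mem: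
  assumes "\<omega> \<in> coboundaries sg br sv q V \<pi>"
  shows "\<omega> xs \<in> V"
proof (cases q)
  case 0
  then show ?thesis using assms md.subspace_0[OF subspace_V] by (simp add: coboundaries_def)
next
  case (Suc m)
  then show ?thesis using assms ce_differential_mem cochains_mem by (auto simp: coboundaries_def)
qed

lemma psi_cohomology_action:
  "lie_action (fscale sg) commutator (Der0 sg br g0) (cohomology_scale sg br sv q V \<pi>)
     (cohomology sg br sv q V \<pi>) (psi_cohomology sg br g0 sv q V \<pi>)"
proof -
  have g0: "subspace g0" using semisimple by (simp add: lie_semisimple_def lie_subalgebra_def)
  have Z: "cocycles sg br sv q V \<pi> \<subseteq> exterior_tensor sg sv V"
    by (auto simp: cocycles_def cochains_def)
  have "lie_action (fscale sg) commutator (Der0 sg br g0)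
     (\<lambda>c. quotient_map (coboundaries sg br sv q V \<pi>) (fscale sv c))
     {z +o coboundaries sg br sv q V \<pi> |z. z \<in> cocycles sg br sv q V \<pi>}
     (\<lambda>D. quotient_map (coboundaries sg br sv q V \<pi>) (psi br g0 \<pi> D))"
  proof (rule fn.lie_action_quotient[OF subspace_cocycles subspace_coboundaries])
    show "lie_action (fscale sg) commutator (Der0 sg br g0) (fscale sv) (cocycles sg br sv q V \<pi>) (psi br g0 \<pi>)"
      by (rule lie_action_subset[OF psi_action Z]) (use psi_cocycles in blast)
    show "psi br g0 \<pi> D (z + b) = psi br g0 \<pi> D z + psi br g0 \<pi> D b"
      if "z \<in> cocycles sg br sv q V \<pi>" "b \<in> coboundaries sg br sv q V \<pi>" for D z b
      using that Z by (intro psi_plus coboundaries_mem exterior_tensorD(2)) auto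
  qed (use Der0_closed[OF g0] psi_coboundaries in auto)
  then show ?thesis
    by (simp add: cohomology_scale_def[abs_def] psi_cohomology_def[abs_def] cohomology_def)
qed

text \<open>The zero class goes to the zero class. On the direct sum this keeps supports
  finite.\<close>

lemma psi_quotient_coboundaries:
  "quotient_map (coboundaries sg br sv q V \<pi>) (psi br g0 \<pi> D) (coboundaries sg br sv q V \<pi>)
    = coboundaries sg br sv q V \<pi>" if "D \<in> Der0 sg br g0"
proof -
  let ?B = "coboundaries sg br sv q V \<pi>"
  have "psi br g0 \<pi> D 0 \<in> psi br g0 \<pi> D ` ?B" using fn.subspace_0[OF subspace_coboundaries] by blast
  then have "0 \<in> psi br g0 \<pi> D ` ?B" by (simp add: psi_zero)
  then have "?B \<subseteq> psi br g0 \<pi> D ` ?B + ?B" by (rule set_zero_plus2)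
  moreover have "psi br g0 \<pi> D ` ?B + ?B \<subseteq> ?B"
    using psi_coboundaries[OF that] fn.subspace_add[OF subspace_coboundaries] by (blast elim: set_plus_elim)
  ultimately show ?thesis by (simp add: quotient_map_def)
qed

end

section \<open>Total cohomology\<close>

lemma levi_irrep_if_cohomological_irrep:
  fixes sg :: "'k::{alg_closed_field, field_char_0} \<Rightarrow> 'g::ab_group_add \<Rightarrow> 'g"
  assumes "lie_algebra sg br" "finite_dim sg (UNIV :: 'g set)" "levi_decomposition sg br g0 s"
    and "vector_space sv" "(V, \<pi>) \<in> cohomological_irreps sg br sv p"
  shows "levi_irrep sg br sv V \<pi> g0 s p"
proof -
  interpret lie_algebra sg br by fact
  interpret md: vector_space sv by fact
  show ?thesis
    by unfold_locales (use assms in \<open>auto simp: cohomological_irreps_def irreducible_rep_def\<close>)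
qed

lemma Gamma_mem: "C \<in> Gamma sg br sv p \<Longrightarrow> R \<in> C \<Longrightarrow> R \<in> cohomological_irreps sg br sv p"
  by (auto simp: Gamma_def quotient_def)

lemma lie_action_total:
  fixes sg :: "'k::field \<Rightarrow> 'g::ab_group_add \<Rightarrow> 'g"
  assumes act: "\<And>C. C \<in> Gamma sg br seq_scale p \<Longrightarrow>
      lie_action (fscale sg) commutator (Der0 sg br g0)
        (cohomology_scale sg br seq_scale p (fst (r C)) (snd (r C)))
        (cohomology sg br seq_scale p (fst (r C)) (snd (r C)))
        (psi_cohomology sg br g0 seq_scale p (fst (r C)) (snd (r C)))"
    and zero: "\<And>C D. C \<in> Gamma sg br seq_scale p \<Longrightarrow> D \<in> Der0 sg br g0 \<Longrightarrow>
      psi_cohomology sg br g0 seq_scale p (fst (r C)) (snd (r C)) D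
        (coboundaries sg br seq_scale p (fst (r C)) (snd (r C)))
      = coboundaries sg br seq_scale p (fst (r C)) (snd (r C))"
  shows "lie_action (fscale sg) commutator (Der0 sg br g0) (total_scale sg br p r)
    (total_cohomology sg br p r) (psi_total sg br g0 p r)"
proof -
  let ?G = "Gamma sg br seq_scale p"
  let ?L = "Der0 sg br g0"
  let ?S = "\<lambda>C. cohomology_scale sg br seq_scale p (fst (r C)) (snd (r C))"
  let ?H = "\<lambda>C. cohomology sg br seq_scale p (fst (r C)) (snd (r C))"
  let ?B = "\<lambda>C. coboundaries sg br seq_scale p (fst (r C)) (snd (r C))"
  let ?P = "\<lambda>C. psi_cohomology sg br g0 seq_scale p (fst (r C)) (snd (r C))"
  have closed: "?P C D h \<in> ?H C" and add: "?P C D (h + h') = ?P C D h + ?P C D h'"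
    and sc: "?P C D (?S C c h) = ?S C c (?P C D h)"
    and ladd: "E \<in> ?L \<Longrightarrow> ?P C (D + E) h = ?P C D h + ?P C E h"
    and lsc: "?P C (fscale sg c D) h = ?S C c (?P C D h)"
    and brk: "E \<in> ?L \<Longrightarrow> ?P C (commutator D E) h + ?P C E (?P C D h) = ?P C D (?P C E h)"
    if "C \<in> ?G" "D \<in> ?L" "h \<in> ?H C" "h' \<in> ?H C" for C D E h h' c
    using act[OF that(1)] that(2-) unfolding lie_action_def by simp_all
  have mem: "\<Phi> C \<in> ?H C" if "\<Phi> \<in> total_cohomology sg br p r" "C \<in> ?G" for \<Phi> C
    using that by (simp add: total_cohomology_def)
  \<comment> \<open>Off \<open>Gamma\<close> all families take the dummy value \<open>{0}\<close>;
    pointwise sums respect it.\<close>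
  have zz: "{0} + {0} = ({0} :: ('g list \<Rightarrow> nat \<Rightarrow> 'k) set)" by (simp add: set_plus_def)
  show ?thesis
    unfolding lie_action_def
  proof (intro conjI ballI allI)
    fix D \<Phi> assume D: "D \<in> ?L" and \<Phi>: "\<Phi> \<in> total_cohomology sg br p r"
    show "psi_total sg br g0 p r D \<Phi> \<in> total_cohomology sg br p r"
    proof -
      have "finite {C \<in> ?G. \<Phi> C \<noteq> ?B C}" using \<Phi> by (simp add: total_cohomology_def)
      moreover have "{C \<in> ?G. ?P C D (\<Phi> C) \<noteq> ?B C} \<subseteq> {C \<in> ?G. \<Phi> C \<noteq> ?B C}"
        using zero[OF _ D] by auto
      ultimately have "finite {C \<in> ?G. ?P C D (\<Phi> C) \<noteq> ?B C}" by (rule rev_finite_subset)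
      moreover have "{C \<in> ?G. psi_total sg br g0 p r D \<Phi> C \<noteq> ?B C} = {C \<in> ?G. ?P C D (\<Phi> C) \<noteq> ?B C}"
        by (auto simp: psi_total_def)
      ultimately show ?thesis
        using closed[OF _ D mem[OF \<Phi>] mem[OF \<Phi>]] by (simp add: total_cohomology_def psi_total_def)
    qed
    show "psi_total sg br g0 p r D (\<Phi> + \<Psi>) = psi_total sg br g0 p r D \<Phi> + psi_total sg br g0 p r D \<Psi>"
      if "\<Psi> \<in> total_cohomology sg br p r" for \<Psi>
      using add[OF _ D mem[OF \<Phi>] mem[OF that]] by (simp add: fun_eq_iff psi_total_def zz)
    show "psi_total sg br g0 p r D (total_scale sg br p r c \<Phi>) = total_scale sg br p r c (psi_total sg br g0 p r D \<Phi>)" for c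
      using sc[OF _ D mem[OF \<Phi>] mem[OF \<Phi>]] by (simp add: fun_eq_iff psi_total_def total_scale_def)
    show "psi_total sg br g0 p r (D + E) \<Phi> = psi_total sg br g0 p r D \<Phi> + psi_total sg br g0 p r E \<Phi>"
      if "E \<in> ?L" for E
      using ladd[OF _ D mem[OF \<Phi>] mem[OF \<Phi>] that] by (simp add: fun_eq_iff psi_total_def zz)
    show "psi_total sg br g0 p r (fscale sg c D) \<Phi> = total_scale sg br p r c (psi_total sg br g0 p r D \<Phi>)" for c
      using lsc[OF _ D mem[OF \<Phi>] mem[OF \<Phi>]] by (simp add: fun_eq_iff psi_total_def total_scale_def)
    show "psi_total sg br g0 p r (commutator D E) \<Phi> + psi_total sg br g0 p r E (psi_total sg br g0 p r D \<Phi>)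
        = psi_total sg br g0 p r D (psi_total sg br g0 p r E \<Phi>)" if "E \<in> ?L" for E
      using brk[OF _ D mem[OF \<Phi>] mem[OF \<Phi>] that] by (simp add: fun_eq_iff psi_total_def zz)
  qed
qed

theorem theorem5p2:
  fixes sg :: "'k::{alg_closed_field, field_char_0} \<Rightarrow> 'g::ab_group_add \<Rightarrow> 'g"
    and br :: "'g \<Rightarrow> 'g \<Rightarrow> 'g"
    and g0 s :: "'g set"
    and sv :: "'k \<Rightarrow> 'v::ab_group_add \<Rightarrow> 'v"
    and p :: nat
  assumes "lie_algebra sg br"
    and "finite_dim sg (UNIV :: 'g set)"
    and "levi_decomposition sg br g0 s"
    and "vector_space sv"
  shows "(\<forall>C\<in>Gamma sg br sv p. \<forall>(V, \<pi>)\<in>C.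
            (\<forall>D\<in>Der0 sg br g0. \<forall>f\<in>exterior_dual sg. \<forall>v\<in>V.
               psi br g0 \<pi> D (tensor sv f v) =
                 tensor sv (- derivation_transpose D f) v
                 + tensor sv f (\<pi> (inner_elem br g0 D) v)) \<and>
            lie_action (fscale sg) commutator (Der0 sg br g0)
              (fscale sv) (exterior_tensor sg sv V) (psi br g0 \<pi>) \<and>
            (\<forall>D\<in>Der0 sg br g0.
               psi br g0 \<pi> D ` cocycles sg br sv p V \<pi> \<subseteq> cocycles sg br sv p V \<pi> \<and>
               psi br g0 \<pi> D ` coboundaries sg br sv p V \<pi> \<subseteq> coboundaries sg br sv p V \<pi>) \<and>
            lie_action (fscale sg) commutator (Der0 sg br g0)
              (cohomology_scale sg br sv p V \<pi>) (cohomology sg br sv p V \<pi>)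
              (psi_cohomology sg br g0 sv p V \<pi>)) \<and>
         (\<forall>r. (\<forall>C\<in>Gamma sg br seq_scale p. r C \<in> C) \<longrightarrow>
            lie_action (fscale sg) commutator (Der0 sg br g0)
              (total_scale sg br p r) (total_cohomology sg br p r)
              (psi_total sg br g0 p r))"
proof (intro conjI ballI allI impI; clarify?)
  note setting = levi_irrep_if_cohomological_irrep[OF assms(1-3)]
  {
    fix C V \<pi> assume "C \<in> Gamma sg br sv p" "(V, \<pi>) \<in> C"
    then interpret levi_irrep sg br sv V \<pi> g0 s p
      by (intro setting assms(4) Gamma_mem)
    show "(\<forall>D\<in>Der0 sg br g0. \<forall>f\<in>exterior_dual sg. \<forall>v\<in>V.
        psi br g0 \<pi> D (tensor sv f v) =
          tensor sv (- derivation_transpose D f) v + tensor sv f (\<pi> (inner_elem br g0 D) v)) \<and>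
      lie_action (fscale sg) commutator (Der0 sg br g0) (fscale sv) (exterior_tensor sg sv V) (psi br g0 \<pi>) \<and>
      (\<forall>D\<in>Der0 sg br g0.
         psi br g0 \<pi> D ` cocycles sg br sv p V \<pi> \<subseteq> cocycles sg br sv p V \<pi> \<and>
         psi br g0 \<pi> D ` coboundaries sg br sv p V \<pi> \<subseteq> coboundaries sg br sv p V \<pi>) \<and>
      lie_action (fscale sg) commutator (Der0 sg br g0) (cohomology_scale sg br sv p V \<pi>)
        (cohomology sg br sv p V \<pi>) (psi_cohomology sg br g0 sv p V \<pi>)"
      using psi_tensor psi_action psi_cocycles psi_coboundaries psi_cohomology_action by blast
  }
  fix r assume r: "\<forall>C\<in>Gamma sg br seq_scale p. r C \<in> C"
  \<comment> \<open>The total cohomology lives in the fixed ambient space of sequences, so the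
    setting is instantiated there, once for each chosen representative \<open>r C\<close> of a
    class.\<close>
  have "vector_space (seq_scale :: 'k \<Rightarrow> (nat \<Rightarrow> 'k) \<Rightarrow> nat \<Rightarrow> 'k)"
    by unfold_locales (simp_all add: fscale_def fun_eq_iff algebra_simps)
  then have levi: "levi_irrep sg br seq_scale (fst (r C)) (snd (r C)) g0 s p"
    if "C \<in> Gamma sg br seq_scale p" for C
    using r that by (intro setting) (auto intro: Gamma_mem)
  show "lie_action (fscale sg) commutator (Der0 sg br g0) (total_scale sg br p r)
      (total_cohomology sg br p r) (psi_total sg br g0 p r)"
  proof (rule lie_action_total)
    fix C assume "C \<in> Gamma sg br seq_scale p"
    then interpret levi_irrep sg br seq_scale "fst (r C)" "snd (r C)" g0 s p by (rule levi)
    show "lie_action (fscale sg) commutator (Der0 sg br g0)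
        (cohomology_scale sg br seq_scale p (fst (r C)) (snd (r C)))
        (cohomology sg br seq_scale p (fst (r C)) (snd (r C)))
        (psi_cohomology sg br g0 seq_scale p (fst (r C)) (snd (r C)))"
      by (rule psi_cohomology_action)
    show "psi_cohomology sg br g0 seq_scale p (fst (r C)) (snd (r C)) D
        (coboundaries sg br seq_scale p (fst (r C)) (snd (r C)))
        = coboundaries sg br seq_scale p (fst (r C)) (snd (r C))" if "D \<in> Der0 sg br g0" for D
      unfolding psi_cohomology_def by (rule psi_quotient_coboundaries[OF that])
  qed
qed

end
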